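(* Let $\alpha\in\mathbb{R}\setminus\mathbb{Q}$ and $\lambda>0$. For every $\theta\in\mathbb{T}_0$ which is not $2\alpha$-rational, the operator $\mathcal{H}_\theta$ has purely singular continuous spectrum in $\sigma^{\mathcal{H}}\cap(-\lambda,\lambda)$.
   Context: $\mathbb{T}=\mathbb{R}/\mathbb{Z}$. $\theta$ is called $2\alpha$-rational if $(2\alpha\mathbb{Z}+2\theta)\cap\mathbb{Z}\neq\emptyset$. Let $\mathbb{T}_0=\{\theta\in\mathbb{T}:\cos 2\pi(n\alpha+\theta)\neq 0\ \forall n\in\mathbb{Z}\}$. For $\theta\in\mathbb{T}$, $n\in\mathbb{Z}$ put $v(\theta,n)=\cos2\pi((n-1)\alpha+\theta)$ if $n$ is odd and $v(\theta,n)=\cos 2\pi(n\alpha+\theta)$ if $n$ is even; $c(\theta,n)=\lambda$ if $n$ is odd and $c(\theta,n)=\cos2\pi(n\alpha+\theta)$ if $n$ is even. For $\theta\in\mathbb{T}_0$, $\mathcal{H}_\theta$ is the operator on $\ell^2(\mathbb{Z})$ given by $(\mathcal{H}_\theta u)(n)=c(\theta,n)u(n+1)+c(\theta,n-1)u(n-1)+v(\theta,n)u(n)$; its spectrum $\sigma^{\mathcal{H}}$ is independent of $\theta$. "Purely singular continuous spectrum in $I$" means all spectral measures restricted to $I$ are singular continuous. *)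

theory Defs
  imports "HOL-Analysis.Analysis"
begin

text \<open>Points of the torus T = R/Z are represented by real numbers; all notions below are
  1-periodic in theta.\<close>

definition two_alpha_rational :: "real \<Rightarrow> real \<Rightarrow> bool" where
  "two_alpha_rational \<alpha> \<theta> \<longleftrightarrow> (\<exists>m n :: int. 2 * \<alpha> * of_int m + 2 * \<theta> = of_int n)"

definition T0 :: "real \<Rightarrow> real set" where
  "T0 \<alpha> = {\<theta>. \<forall>n::int. cos (2 * pi * (of_int n * \<alpha> + \<theta>)) \<noteq> 0}"

definition vpot :: "real \<Rightarrow> real \<Rightarrow> int \<Rightarrow> real" where
  "vpot \<alpha> \<theta> n = (if odd n then cos (2 * pi * (of_int (n - 1) * \<alpha> + \<theta>))
                  else cos (2 * pi * (of_int n * \<alpha> + \<theta>)))"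

definition cpot :: "real \<Rightarrow> real \<Rightarrow> real \<Rightarrow> int \<Rightarrow> real" where
  "cpot \<alpha> lam \<theta> n = (if odd n then lam else cos (2 * pi * (of_int n * \<alpha> + \<theta>)))"

definition Hop :: "real \<Rightarrow> real \<Rightarrow> real \<Rightarrow> (int \<Rightarrow> complex) \<Rightarrow> int \<Rightarrow> complex" where
  "Hop \<alpha> lam \<theta> u n =
     of_real (cpot \<alpha> lam \<theta> n) * u (n + 1) + of_real (cpot \<alpha> lam \<theta> (n - 1)) * u (n - 1)
     + of_real (vpot \<alpha> \<theta> n) * u n"

definition l2 :: "(int \<Rightarrow> complex) set" where
  "l2 = {u. (\<lambda>n. (cmod (u n))\<^sup>2) summable_on UNIV}"

definition l2inner :: "(int \<Rightarrow> complex) \<Rightarrow> (int \<Rightarrow> complex) \<Rightarrow> complex" where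
  "l2inner u v = infsum (\<lambda>n. cnj (u n) * v n) UNIV"

text \<open>Spectrum of an operator H on l^2(Z) (real points, the operators here being self-adjoint):
  E is in the spectrum iff H - E is not a bijection of l^2(Z) onto itself.\<close>
definition op_spectrum :: "((int \<Rightarrow> complex) \<Rightarrow> int \<Rightarrow> complex) \<Rightarrow> real set" where
  "op_spectrum H = {E. \<not> bij_betw (\<lambda>u n. H u n - of_real E * u n) l2 l2}"

text \<open>mu is the spectral measure of H associated with the vector u: a finite Borel measure on R
  whose Stieltjes (Borel) transform is the diagonal matrix element of the resolvent,
  <u, (H - z)^(-1) u> = integral of 1/(x - z) d mu(x), for every non-real z.\<close>
definition spectral_measure ::
  "((int \<Rightarrow> complex) \<Rightarrow> int \<Rightarrow> complex) \<Rightarrow> (int \<Rightarrow> complex) \<Rightarrow> real measure \<Rightarrow> bool" where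
  "spectral_measure H u \<mu> \<longleftrightarrow>
     sets \<mu> = sets borel \<and> finite_measure \<mu> \<and>
     (\<forall>z::complex. Im z \<noteq> 0 \<longrightarrow>
        (\<exists>v\<in>l2. (\<forall>n. H v n - z * v n = u n) \<and>
                 l2inner u v = integral\<^sup>L \<mu> (\<lambda>x. 1 / (complex_of_real x - z))))"

definition sing_cont_on :: "real measure \<Rightarrow> real set \<Rightarrow> bool" where
  "sing_cont_on \<mu> I \<longleftrightarrow>
     (\<forall>x\<in>I. emeasure \<mu> {x} = 0) \<and>
     (\<exists>N\<in>sets borel. emeasure lborel N = 0 \<and>
        (\<forall>A\<in>sets borel. A \<subseteq> I \<longrightarrow> emeasure \<mu> A = emeasure \<mu> (A \<inter> N)))"

definition purely_sc_spectrum_in ::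
  "((int \<Rightarrow> complex) \<Rightarrow> int \<Rightarrow> complex) \<Rightarrow> real set \<Rightarrow> bool" where
  "purely_sc_spectrum_in H I \<longleftrightarrow>
     (\<forall>u\<in>l2. \<exists>\<mu>. spectral_measure H u \<mu> \<and> sing_cont_on \<mu> I)"

end

theory Submission
  imports Defs "HOL-Probability.Probability" "HOL-Real_Asymp.Real_Asymp"
begin

text \<open>Eigenvalues. For an eigenvector \<open>u\<close> with \<open>\<bar>E\<bar> < \<lambda>\<close> put \<open>s k = u (2 k) + u (2 k + 1)\<close>. The Fourier
  transform of \<open>s\<close> and its reflection solve the same second-order difference equation over the
  rotation by \<open>2 \<alpha>\<close>, whose coefficient is singular because \<open>E + \<lambda> cos\<close> vanishes on the circle. The
  Wronskian is invariant under the rotation, hence constant, and the zeros of \<open>E + \<lambda> cos\<close> make it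
  zero; the same holds for all its multi-step versions. In terms of Fourier coefficients, all the
  sums of \<open>(s j)\<^sup>2 sin (l \<beta> j)\<close>, \<open>\<beta> j = 2 \<pi> (2 j \<alpha> + \<theta>)\<close>, vanish. As the frequencies \<open>\<beta> j\<close> and
  \<open>- \<beta> j\<close> are pairwise distinct when \<open>\<theta>\<close> is not \<open>2 \<alpha>\<close>-rational, averaging over \<open>l\<close> gives \<open>s = 0\<close>.

  Absolute continuity. By density of the orbit there are arbitrarily weak couplings near both
  ends of the lattice. If the spectral measure had an absolutely continuous part, some nonzero
  vector \<open>\<phi>\<close> would have a spectral measure with bounded density. The matrix elements of its
  Chebyshev evolution are then square-summable in time, so the total flux through a coupling of
  strength \<open>\<epsilon>\<close> is \<open>O(\<epsilon>)\<close>, while all of the energy has to leave every finite block.\<close>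

section \<open>The Hilbert space of square-summable complex sequences\<close>

text \<open>The Wronskian argument is carried out on coefficients and never on functions on the
  circle. A sequence annihilated by the factor E + lam cos solves lam (r (m + 1) + r (m - 1)) + 2 E
  r m = 0. Its characteristic roots have modulus one as |E| < lam, so it cannot tend to 0 unless it
  vanishes; this replaces the division by a singular coefficient. The product of a solution with its
  reflection contains no conjugate, which is why squares of complex numbers appear and an average
  has to separate the terms.

  The spectral measure is built and not assumed: the operator is rescaled to A with 0 <= A <= 1, its
  moments are realised by a measure on [0, 1], and functions of A are limits of polynomials in A. As
  only real polynomials act, time evolution is the Chebyshev recurrence of T = 2 A - 1 instead of a
  unitary group, and orthogonality of cosines takes the place of Plancherel's identity. The scaling
  keeps the norm of T at most 1 / 2, so that the initial energy |phi|^2 - |T phi|^2 is positive for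
  phi nonzero and cannot simply disappear.\<close>

lemma l2_0: "(\<lambda>n. 0) \<in> l2"
  by (simp add: l2_def)

lemma l2_scaleR: "u \<in> l2 \<Longrightarrow> (\<lambda>n. c *\<^sub>R u n) \<in> l2"
  by (simp add: l2_def power_mult_distrib summable_on_cmult_right)

lemma l2_comparison:
  assumes "v \<in> l2" "w \<in> l2" "\<And>n. cmod (u n) \<le> cmod (v n) + cmod (w n)"
  shows "u \<in> l2"
proof -
  have "(\<lambda>n. 2 * (cmod (v n))\<^sup>2 + 2 * (cmod (w n))\<^sup>2) summable_on UNIV"
    using assms(1,2) by (auto simp: l2_def intro!: summable_on_add summable_on_cmult_right)
  moreover have "(cmod (u n))\<^sup>2 \<le> 2 * (cmod (v n))\<^sup>2 + 2 * (cmod (w n))\<^sup>2" for n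
  proof -
    have "(cmod (u n))\<^sup>2 \<le> (cmod (v n) + cmod (w n))\<^sup>2"
      using assms(3) by (intro power_mono) auto
    also have "\<dots> \<le> 2 * (cmod (v n))\<^sup>2 + 2 * (cmod (w n))\<^sup>2"
      using sum_squares_bound[of "cmod (v n)" "cmod (w n)"] by (simp add: power2_sum)
    finally show ?thesis .
  qed
  ultimately show ?thesis
    unfolding l2_def by (auto intro: summable_on_comparison_test)
qed

lemma l2_add: "u \<in> l2 \<Longrightarrow> v \<in> l2 \<Longrightarrow> (\<lambda>n. u n + v n) \<in> l2"
  by (rule l2_comparison[of u v]) (auto intro: norm_triangle_ineq)

lemma l2_mult_summable:
  fixes u v :: "int \<Rightarrow> complex"
  assumes "u \<in> l2" "v \<in> l2"
  shows "(\<lambda>n. cmod (u n) * cmod (v n)) summable_on UNIV"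
proof -
  have "(\<lambda>n. (cmod (u n))\<^sup>2 + (cmod (v n))\<^sup>2) summable_on UNIV"
    using assms by (auto simp: l2_def intro!: summable_on_add)
  moreover have "cmod (u n) * cmod (v n) \<le> (cmod (u n))\<^sup>2 + (cmod (v n))\<^sup>2" for n
  proof -
    have "0 \<le> cmod (u n) * cmod (v n)" by simp
    then show ?thesis
      using sum_squares_bound[of "cmod (u n)" "cmod (v n)"] unfolding mult.assoc by linarith
  qed
  ultimately show ?thesis
    by (auto intro: summable_on_comparison_test)
qed

lemma l2_cnj_mult_summable:
  assumes "u \<in> l2" "v \<in> l2"
  shows "(\<lambda>n. cnj (u n) * v n) summable_on UNIV"
  by (rule abs_summable_summable) (use l2_mult_summable[OF assms] in \<open>simp add: norm_mult\<close>)

lemma l2_inner_summable: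
  assumes "u \<in> l2" "v \<in> l2"
  shows "(\<lambda>n. u n \<bullet> v n) summable_on UNIV"
proof -
  have "u n \<bullet> v n = Re (cnj (u n) * v n)" for n
    by (simp add: inner_complex_def)
  then show ?thesis
    using summable_on_Re[OF l2_cnj_mult_summable[OF assms]] by simp
qed

text \<open>A type of its own makes \<open>real_inner\<close> and completeness available. The inner
  product keeps only the real part of the complex one; the imaginary part is recovered later by
  pairing with \<open>Jc\<close>, multiplication by i.\<close>

typedef cl2 = l2 morphisms cseq Abs_cl2
  using l2_0 by blast

setup_lifting type_definition_cl2

lemma cseq_l2 [simp]: "cseq x \<in> l2"
  by (rule cseq)

instantiation cl2 :: real_inner
begin

lift_definition zero_cl2 :: cl2 is "\<lambda>n. 0" by (rule l2_0)

lift_definition plus_cl2 :: "cl2 \<Rightarrow> cl2 \<Rightarrow> cl2" is "\<lambda>u v n. u n + v n" by (rule l2_add)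

lift_definition scaleR_cl2 :: "real \<Rightarrow> cl2 \<Rightarrow> cl2" is "\<lambda>c u n. c *\<^sub>R u n" by (rule l2_scaleR)

lift_definition uminus_cl2 :: "cl2 \<Rightarrow> cl2" is "\<lambda>u n. - u n" by (simp add: l2_def)

definition minus_cl2 :: "cl2 \<Rightarrow> cl2 \<Rightarrow> cl2" where "x - y = x + (- y)" for x y :: cl2

lift_definition inner_cl2 :: "cl2 \<Rightarrow> cl2 \<Rightarrow> real" is "\<lambda>u v. infsum (\<lambda>n. u n \<bullet> v n) UNIV" .

definition norm_cl2 :: "cl2 \<Rightarrow> real" where "norm x = sqrt (x \<bullet> x)" for x :: cl2

definition dist_cl2 :: "cl2 \<Rightarrow> cl2 \<Rightarrow> real" where "dist x y = norm (x - y)" for x y :: cl2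

definition sgn_cl2 :: "cl2 \<Rightarrow> cl2" where "sgn x = inverse (norm x) *\<^sub>R x" for x :: cl2

definition uniformity_cl2 :: "(cl2 \<times> cl2) filter" where
  "uniformity = (INF e\<in>{0<..}. principal {(x, y :: cl2). dist x y < e})"

definition open_cl2 :: "cl2 set \<Rightarrow> bool" where
  "open U \<longleftrightarrow> (\<forall>x\<in>U. eventually (\<lambda>(x', y). x' = x \<longrightarrow> y \<in> U) uniformity)" for U :: "cl2 set"

instance
proof
  fix x y z :: cl2 and a b :: real
  show "x - y = x + - y" by (rule minus_cl2_def)
  show "x + y + z = x + (y + z)" by transfer (simp add: algebra_simps)
  show "x + y = y + x" by transfer (simp add: algebra_simps)
  show "0 + x = x" by transfer simp
  show "- x + x = 0" by transfer simp
  show "a *\<^sub>R (x + y) = a *\<^sub>R x + a *\<^sub>R y" by transfer (simp add: algebra_simps)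
  show "(a + b) *\<^sub>R x = a *\<^sub>R x + b *\<^sub>R x" by transfer (simp add: algebra_simps)
  show "a *\<^sub>R b *\<^sub>R x = (a * b) *\<^sub>R x" by transfer simp
  show "1 *\<^sub>R x = x" by transfer simp
  show "dist x y = norm (x - y)" by (rule dist_cl2_def)
  show "sgn x = inverse (norm x) *\<^sub>R x" by (rule sgn_cl2_def)
  show "uniformity = (INF e\<in>{0<..}. principal {(x, y :: cl2). dist x y < e})"
    by (rule uniformity_cl2_def)
  show "open U \<longleftrightarrow> (\<forall>x\<in>U. eventually (\<lambda>(x', y). x' = x \<longrightarrow> y \<in> U) uniformity)" for U :: "cl2 set"
    by (rule open_cl2_def)
  show "x \<bullet> y = y \<bullet> x" by transfer (simp add: inner_commute)
  show "(x + y) \<bullet> z = x \<bullet> z + y \<bullet> z"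
    by transfer (simp add: inner_add_left infsum_add l2_inner_summable)
  show "a *\<^sub>R x \<bullet> y = a * (x \<bullet> y)"
    by transfer (simp add: infsum_cmult_right l2_inner_summable)
  show "0 \<le> x \<bullet> x"
    by transfer (simp add: infsum_nonneg)
  show "x \<bullet> x = 0 \<longleftrightarrow> x = 0"
  proof
    show "x \<bullet> x = 0 \<Longrightarrow> x = 0"
    proof transfer
      fix u assume u: "u \<in> l2" and "(\<Sum>\<^sub>\<infinity>n. u n \<bullet> u n) = 0"
      then have "u n \<bullet> u n = 0" for n
        using nonneg_infsum_le_0D[of "\<lambda>n. u n \<bullet> u n" UNIV n] l2_inner_summable[OF u u] by auto
      then show "u = (\<lambda>n. 0)" by auto
    qed
    show "x = 0 \<Longrightarrow> x \<bullet> x = 0" by (transfer, simp)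
  qed
  show "norm x = sqrt (x \<bullet> x)" by (rule norm_cl2_def)
qed

end

lemma cseq_0 [simp]: "cseq 0 n = 0" by transfer simp
lemma cseq_add [simp]: "cseq (x + y) n = cseq x n + cseq y n" by transfer simp
lemma cseq_scaleR [simp]: "cseq (c *\<^sub>R x) n = c *\<^sub>R cseq x n" by transfer simp
lemma cseq_minus [simp]: "cseq (- x) n = - cseq x n" by transfer simp
lemma cseq_diff [simp]: "cseq (x - y) n = cseq x n - cseq y n"
  using cseq_add[of x "- y" n] by simp

lemma cseq_eqI: "(\<And>n. cseq x n = cseq y n) \<Longrightarrow> x = y"
  by (metis cseq_inject ext)

lemma inner_cl2_infsum: "x \<bullet> y = infsum (\<lambda>n. cseq x n \<bullet> cseq y n) UNIV"
  by transfer simp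

lemma inner_cl2_has_sum: "((\<lambda>n. cseq x n \<bullet> cseq y n) has_sum (x \<bullet> y)) UNIV"
  unfolding inner_cl2_infsum by (rule has_sum_infsum) (simp add: l2_inner_summable)

lemma norm_cl2_has_sum: "((\<lambda>n. (cmod (cseq x n))\<^sup>2) has_sum (norm x)\<^sup>2) UNIV"
  using inner_cl2_has_sum[of x x] by (simp add: power2_norm_eq_inner)

lemma sum_cseq_le_norm:
  assumes "finite F"
  shows "(\<Sum>n\<in>F. (cmod (cseq x n))\<^sup>2) \<le> (norm x)\<^sup>2"
  using norm_cl2_has_sum[of x] assms by (rule finite_sum_le_has_sum) auto

lemma norm_cseq_le: "cmod (cseq x n) \<le> norm x"
  by (rule power2_le_imp_le) (use sum_cseq_le_norm[of "{n}" x] in auto)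

lemma l2_boundI:
  assumes "\<And>F. finite F \<Longrightarrow> (\<Sum>n\<in>F. (cmod (u n))\<^sup>2) \<le> b"
  shows "u \<in> l2"
proof -
  have "(\<lambda>n. (cmod (u n))\<^sup>2) summable_on UNIV"
  proof (rule nonneg_bdd_above_summable_on)
    show "bdd_above (sum (\<lambda>n. (cmod (u n))\<^sup>2) ` {F. F \<subseteq> UNIV \<and> finite F})"
      by (rule bdd_aboveI[where M=b]) (use assms in blast)
  qed simp
  then show ?thesis by (simp add: l2_def)
qed

lemma norm_cl2_le:
  assumes "0 \<le> b" "\<And>F. finite F \<Longrightarrow> (\<Sum>n\<in>F. (cmod (cseq x n))\<^sup>2) \<le> b\<^sup>2"
  shows "norm x \<le> b"
proof -
  have "(norm x)\<^sup>2 \<le> b\<^sup>2"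
    using norm_cl2_has_sum[of x] by (rule has_sum_le_finite_sums) (use assms in auto)
  then show ?thesis using assms(1) by (rule power2_le_imp_le)
qed

instance cl2 :: complete_space
proof
  fix X :: "nat \<Rightarrow> cl2" assume C: "Cauchy X"
  have "Cauchy (\<lambda>i. cseq (X i) n)" for n
  proof (rule metric_CauchyI)
    fix e :: real assume "e > 0"
    then obtain M where "\<forall>i\<ge>M. \<forall>j\<ge>M. dist (X i) (X j) < e"
      using C unfolding Cauchy_def by blast
    moreover have "dist (cseq (X i) n) (cseq (X j) n) \<le> dist (X i) (X j)" for i j
      using norm_cseq_le[of "X i - X j" n] by (simp add: dist_norm)
    ultimately show "\<exists>M. \<forall>i\<ge>M. \<forall>j\<ge>M. dist (cseq (X i) n) (cseq (X j) n) < e"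
      by (meson le_less_trans)
  qed
  then have "\<forall>n. \<exists>L. (\<lambda>i. cseq (X i) n) \<longlonglongrightarrow> L"
    using Cauchy_convergent_iff convergent_def by blast
  then obtain L where L: "\<And>n. (\<lambda>i. cseq (X i) n) \<longlonglongrightarrow> L n"
    by metis
  \<comment> \<open>On finite sums the limit in j can be taken termwise. The bound is uniform in
    \<open>F\<close>, which gives both membership of \<open>L\<close> in \<open>l2\<close> and
    convergence in norm.\<close>
  have key: "(\<Sum>n\<in>F. (cmod (cseq (X i) n - L n))\<^sup>2) \<le> e\<^sup>2"
    if "finite F" "\<forall>j\<ge>i. dist (X i) (X j) < e" for F i e
  proof (rule tendsto_upperbound)
    show "(\<lambda>j. \<Sum>n\<in>F. (cmod (cseq (X i) n - cseq (X j) n))\<^sup>2) \<longlonglongrightarrow> (\<Sum>n\<in>F. (cmod (cseq (X i) n - L n))\<^sup>2)"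
      by (intro tendsto_intros L)
    have "(\<Sum>n\<in>F. (cmod (cseq (X i) n - cseq (X j) n))\<^sup>2) \<le> e\<^sup>2" if "j \<ge> i" for j
    proof -
      have "(\<Sum>n\<in>F. (cmod (cseq (X i) n - cseq (X j) n))\<^sup>2) \<le> (norm (X i - X j))\<^sup>2"
        using sum_cseq_le_norm[OF \<open>finite F\<close>, of "X i - X j"] by simp
      also have "\<dots> \<le> e\<^sup>2"
        using \<open>\<forall>j\<ge>i. dist (X i) (X j) < e\<close> that by (intro power_mono) (auto simp: dist_norm less_imp_le)
      finally show ?thesis .
    qed
    then show "\<forall>\<^sub>F j in sequentially. (\<Sum>n\<in>F. (cmod (cseq (X i) n - cseq (X j) n))\<^sup>2) \<le> e\<^sup>2"
      by (auto simp: eventually_sequentially)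
  qed auto
  obtain i0 where i0: "\<forall>j\<ge>i0. dist (X i0) (X j) < 1"
    using C unfolding Cauchy_def by (metis le_refl zero_less_one)
  have "(\<lambda>n. cseq (X i0) n - L n) \<in> l2"
    using key[OF _ i0] by (rule l2_boundI)
  then have "L \<in> l2"
    by (intro l2_comparison[of "cseq (X i0)" "\<lambda>n. cseq (X i0) n - L n" L])
       (simp_all, metis norm_minus_commute norm_triangle_sub)
  then have L_eq: "cseq (Abs_cl2 L) = L" by (simp add: Abs_cl2_inverse)
  have "X \<longlonglongrightarrow> Abs_cl2 L"
  proof (rule metric_LIMSEQ_I)
    fix e :: real assume "e > 0"
    then obtain M where M: "\<forall>i\<ge>M. \<forall>j\<ge>M. dist (X i) (X j) < e / 2"
      using C unfolding Cauchy_def by (meson half_gt_zero)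
    have "dist (X i) (Abs_cl2 L) < e" if "i \<ge> M" for i
    proof -
      have "\<forall>j\<ge>i. dist (X i) (X j) < e / 2" using M that by auto
      then have "norm (X i - Abs_cl2 L) \<le> e / 2"
        using \<open>e > 0\<close> by (intro norm_cl2_le) (auto simp: L_eq intro!: key)
      then show ?thesis using \<open>e > 0\<close> by (simp add: dist_norm)
    qed
    then show "\<exists>M. \<forall>i\<ge>M. dist (X i) (Abs_cl2 L) < e" by blast
  qed
  then show "convergent X" by (auto simp: convergent_def)
qed

section \<open>Coordinate projections and correlation sums\<close>

definition trunc :: "int set \<Rightarrow> cl2 \<Rightarrow> cl2" where
  "trunc F x = Abs_cl2 (\<lambda>n. if n \<in> F then cseq x n else 0)"

lemma cseq_trunc [simp]: "cseq (trunc F x) n = (if n \<in> F then cseq x n else 0)"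
proof -
  have "(\<lambda>n. if n \<in> F then cseq x n else 0) \<in> l2"
    by (rule l2_comparison[of "cseq x" "cseq x"]) auto
  then show ?thesis by (simp add: trunc_def Abs_cl2_inverse)
qed

lemma trunc_add: "trunc F (x + y) = trunc F x + trunc F y"
  by (rule cseq_eqI) simp

lemma trunc_scaleR: "trunc F (c *\<^sub>R x) = c *\<^sub>R trunc F x"
  by (rule cseq_eqI) simp

lemma trunc_trunc [simp]: "trunc F (trunc F x) = trunc F x"
  by (rule cseq_eqI) simp

lemma trunc_inner: "trunc F x \<bullet> y = x \<bullet> trunc F y"
  unfolding inner_cl2_infsum by (rule infsum_cong) simp

lemma inner_trunc_finite:
  assumes "finite F"
  shows "trunc F x \<bullet> y = (\<Sum>n\<in>F. cseq x n \<bullet> cseq y n)"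
proof -
  have "trunc F x \<bullet> y = infsum (\<lambda>n. cseq x n \<bullet> cseq y n) F"
    unfolding inner_cl2_infsum by (rule infsum_cong_neutral) auto
  then show ?thesis using assms by simp
qed

lemma norm_trunc_finite:
  assumes "finite F"
  shows "(norm (trunc F x))\<^sup>2 = (\<Sum>n\<in>F. (cmod (cseq x n))\<^sup>2)"
  using inner_trunc_finite[OF assms, of x "trunc F x"] by (simp add: power2_norm_eq_inner)

lemma norm_trunc_le: "norm (trunc F x) \<le> norm x"
proof (rule norm_cl2_le)
  fix G :: "int set" assume G: "finite G"
  have "(\<Sum>n\<in>G. (cmod (cseq (trunc F x) n))\<^sup>2) \<le> (\<Sum>n\<in>G. (cmod (cseq x n))\<^sup>2)"
    by (rule sum_mono) simp
  also have "\<dots> \<le> (norm x)\<^sup>2" by (rule sum_cseq_le_norm[OF G])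
  finally show "(\<Sum>n\<in>G. (cmod (cseq (trunc F x) n))\<^sup>2) \<le> (norm x)\<^sup>2" .
qed simp

lemma norm_diff_trunc:
  "(norm (x - trunc F x))\<^sup>2 = (norm x)\<^sup>2 - (norm (trunc F x))\<^sup>2"
proof -
  have "trunc F x \<bullet> trunc F x = x \<bullet> trunc F x" by (simp add: trunc_inner)
  then show ?thesis
    by (simp add: power2_norm_eq_inner inner_diff_left inner_diff_right inner_commute)
qed

text \<open>The estimate is kept for all larger \<open>G\<close> so that it applies to intervals
  exhausting the integers.\<close>

lemma trunc_approx:
  assumes "e > 0"
  obtains F where "finite F" "\<And>G. F \<subseteq> G \<Longrightarrow> norm (x - trunc G x) < e"
proof -
  have "((\<lambda>n. (cmod (cseq x n))\<^sup>2) has_sum (norm x)\<^sup>2) UNIV" by (rule norm_cl2_has_sum)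
  then obtain F where F: "finite F" "dist ((\<Sum>n\<in>F. (cmod (cseq x n))\<^sup>2)) ((norm x)\<^sup>2) \<le> e\<^sup>2 / 2"
    using has_sum_finite_approximation[of "\<lambda>n. (cmod (cseq x n))\<^sup>2" UNIV "(norm x)\<^sup>2" "e\<^sup>2 / 2"] assms by auto
  have "norm (x - trunc G x) < e" if "F \<subseteq> G" for G
  proof -
    have "(norm (trunc F x))\<^sup>2 \<le> (norm (trunc G x))\<^sup>2"
    proof -
      have "trunc F (trunc G x) = trunc F x" using that by (intro cseq_eqI) auto
      then show ?thesis using norm_trunc_le[of F "trunc G x"] by (simp add: power_mono)
    qed
    moreover have "(norm x)\<^sup>2 - (norm (trunc F x))\<^sup>2 \<le> e\<^sup>2 / 2"
      using F(2) unfolding norm_trunc_finite[OF F(1)] dist_real_def by linarith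
    moreover have "e\<^sup>2 / 2 < e\<^sup>2" using assms by simp
    ultimately have "(norm (x - trunc G x))\<^sup>2 < e\<^sup>2" unfolding norm_diff_trunc by linarith
    then show ?thesis using assms by (simp add: power2_less_imp_less)
  qed
  then show thesis using that F(1) by blast
qed

lemma cseq_tendsto_0:
  fixes f :: "nat \<Rightarrow> int"
  assumes "inj f"
  shows "(\<lambda>n. cseq x (f n)) \<longlonglongrightarrow> 0"
proof (rule LIMSEQ_I)
  fix e :: real assume "e > 0"
  then obtain F where F: "finite F" "norm (x - trunc F x) < e"
    using trunc_approx by (metis order_refl)
  have "finite (f -` F)" using F(1) assms by (rule finite_vimageI)
  then obtain N where N: "\<And>n. n \<ge> N \<Longrightarrow> f n \<notin> F"
    by (metis finite_nat_set_iff_bounded le_less_trans less_irrefl vimageI)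
  have "cmod (cseq x (f n)) < e" if "n \<ge> N" for n
    using norm_cseq_le[of "x - trunc F x" "f n"] N[OF that] F(2) by simp
  then show "\<exists>N. \<forall>n\<ge>N. norm (cseq x (f n) - 0) < e" by auto
qed

lemma l2_shift: "u \<in> l2 \<Longrightarrow> (\<lambda>n. u (n + m)) \<in> l2"
  unfolding l2_def
  using summable_on_reindex_bij_betw[of "\<lambda>n. n + m" UNIV UNIV "\<lambda>n. (cmod (u n))\<^sup>2"]
  by (auto simp: bij_betw_def inj_on_def intro: surjI[of _ "\<lambda>n. n - m"])

lemma l2_scale: "u \<in> l2 \<Longrightarrow> (\<lambda>n. c * u n) \<in> l2"
  by (simp add: l2_def norm_mult power_mult_distrib summable_on_cmult_right)

lemma correlation_summable:
  fixes s t :: "int \<Rightarrow> complex"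
  assumes "s \<in> l2" "t \<in> l2" "\<And>j. cmod (c j) \<le> 1"
  shows "(\<lambda>j. s j * t (j + m) * c j) summable_on UNIV"
proof (rule abs_summable_summable, rule summable_on_comparison_test)
  show "(\<lambda>j. cmod (s j) * cmod (t (j + m))) summable_on UNIV"
    using l2_mult_summable[OF assms(1) l2_shift[OF assms(2)]] .
  show "norm (s j * t (j + m) * c j) \<le> cmod (s j) * cmod (t (j + m))" for j
    using mult_left_mono[OF assms(3)[of j], of "cmod (s j) * cmod (t (j + m))"]
    by (simp add: norm_mult)
qed simp

text \<open>The modulus is at most the correlation of |s| with a shift of |t|. A finite part of |s|
  meets only values of t that move out to infinity and tend to 0; the tail is small by
  Cauchy-Schwarz, as shifting does not increase the norm. The factors \<open>c n j\<close> may
  depend on n because the phases in the application do.\<close>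

lemma correlation_tendsto_0:
  fixes s t :: "int \<Rightarrow> complex" and f :: "nat \<Rightarrow> int"
  assumes "s \<in> l2" "t \<in> l2" "inj f" "\<And>n j. cmod (c n j) \<le> 1"
  shows "(\<lambda>n. \<Sum>\<^sub>\<infinity>j. s j * t (j + f n) * c n j) \<longlonglongrightarrow> 0"
proof (rule Lim_null_comparison)
  define S where "S = Abs_cl2 (\<lambda>j. of_real (cmod (s j)))"
  define T where "T n = Abs_cl2 (\<lambda>j. of_real (cmod (t (j + f n))))" for n
  have S: "cseq S j = of_real (cmod (s j))" for j
    unfolding S_def using assms(1) by (subst Abs_cl2_inverse) (auto simp: l2_def)
  have T: "cseq (T n) j = of_real (cmod (t (j + f n)))" for n j
    unfolding T_def using l2_shift[OF assms(2), of "f n"] by (subst Abs_cl2_inverse) (auto simp: l2_def)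
  define T0 where "T0 = Abs_cl2 t"
  have T0: "cseq T0 = t" unfolding T0_def using assms(2) by (rule Abs_cl2_inverse)
  have normT: "norm (T n) \<le> norm T0" for n
  proof (rule norm_cl2_le)
    fix F :: "int set" assume F: "finite F"
    have "(\<Sum>j\<in>F. (cmod (cseq (T n) j))\<^sup>2) = (\<Sum>j\<in>(\<lambda>j. j + f n) ` F. (cmod (cseq T0 j))\<^sup>2)"
      by (subst sum.reindex) (auto simp: T T0 inj_on_def)
    also have "\<dots> \<le> (norm T0)\<^sup>2" using F by (intro sum_cseq_le_norm) simp
    finally show "(\<Sum>j\<in>F. (cmod (cseq (T n) j))\<^sup>2) \<le> (norm T0)\<^sup>2" .
  qed simp
  show "\<forall>\<^sub>F n in sequentially. norm (\<Sum>\<^sub>\<infinity>j. s j * t (j + f n) * c n j) \<le> S \<bullet> T n"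
  proof (rule always_eventually, rule allI)
    fix n
    have "((\<lambda>j. cmod (s j) * cmod (t (j + f n))) has_sum (S \<bullet> T n)) UNIV"
      using inner_cl2_has_sum[of S "T n"] by (simp add: S T inner_complex_def)
    moreover have "norm (s j * t (j + f n) * c n j) \<le> cmod (s j) * cmod (t (j + f n))" for j
      using mult_left_mono[OF assms(4)[of n j], of "cmod (s j) * cmod (t (j + f n))"]
      by (simp add: norm_mult)
    moreover have "((\<lambda>j. s j * t (j + f n) * c n j) has_sum (\<Sum>\<^sub>\<infinity>j. s j * t (j + f n) * c n j)) UNIV"
      using assms by (intro has_sum_infsum correlation_summable)
    ultimately show "norm (\<Sum>\<^sub>\<infinity>j. s j * t (j + f n) * c n j) \<le> S \<bullet> T n"
      using norm_infsum_le by blast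
  qed
  show "(\<lambda>n. S \<bullet> T n) \<longlonglongrightarrow> 0"
  proof (rule LIMSEQ_I)
    fix e :: real assume e: "e > 0"
    define N1 where "N1 = norm T0 + 1"
    define d where "d = e / (2 * N1)"
    have "N1 > 0" by (simp add: N1_def add_nonneg_pos)
    then have d: "d > 0" "d * (norm T0 + 1) = e / 2" using e by (auto simp: d_def N1_def[symmetric])
    obtain F where F: "finite F" "norm (S - trunc F S) < d"
      using trunc_approx[OF d(1)] by (metis order_refl)
    have "(\<lambda>n. cseq (T n) j) \<longlonglongrightarrow> 0" for j
    proof -
      have "inj (\<lambda>n. j + f n)" using assms(3) by (auto simp: inj_def)
      from tendsto_of_real[OF tendsto_norm_zero[OF cseq_tendsto_0[OF this, of T0]]]
      show ?thesis by (simp add: T T0)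
    qed
    then have "(\<lambda>n. \<Sum>j\<in>F. cseq S j \<bullet> cseq (T n) j) \<longlonglongrightarrow> (\<Sum>j\<in>F. cseq S j \<bullet> 0)"
      by (intro tendsto_intros)
    then have "(\<lambda>n. trunc F S \<bullet> T n) \<longlonglongrightarrow> 0"
      by (simp add: inner_trunc_finite[OF F(1)])
    from LIMSEQ_D[OF this, of "e / 2"] e obtain N where
      N: "\<And>n. n \<ge> N \<Longrightarrow> \<bar>trunc F S \<bullet> T n\<bar> < e / 2" by auto
    have "\<bar>S \<bullet> T n\<bar> < e" if "n \<ge> N" for n
    proof -
      have "\<bar>(S - trunc F S) \<bullet> T n\<bar> \<le> norm (S - trunc F S) * norm (T n)"
        by (rule Cauchy_Schwarz_ineq2)
      also have "\<dots> \<le> d * (norm T0 + 1)"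
        using F(2) normT[of n] d(1) by (intro mult_mono) auto
      finally have "\<bar>(S - trunc F S) \<bullet> T n\<bar> \<le> e / 2" using d(2) by simp
      moreover have "S \<bullet> T n = trunc F S \<bullet> T n + (S - trunc F S) \<bullet> T n"
        by (simp add: inner_diff_left)
      ultimately show ?thesis using N[OF that] by linarith
    qed
    then show "\<exists>N. \<forall>n\<ge>N. norm (S \<bullet> T n - 0) < e" by auto
  qed
qed

section \<open>Polynomials of an operator\<close>

definition papp :: "('a::real_vector \<Rightarrow> 'a) \<Rightarrow> real poly \<Rightarrow> 'a \<Rightarrow> 'a" where
  "papp A p x = (\<Sum>i\<le>degree p. coeff p i *\<^sub>R (A ^^ i) x)"

lemma papp_eq_sum:
  assumes "degree p \<le> n"
  shows "papp A p x = (\<Sum>i\<le>n. coeff p i *\<^sub>R (A ^^ i) x)"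
  unfolding papp_def
  by (rule sum.mono_neutral_left) (use assms in \<open>auto simp: coeff_eq_0\<close>)

lemma papp_0 [simp]: "papp A 0 x = 0"
  by (simp add: papp_def)

lemma papp_1 [simp]: "papp A 1 x = x"
  by (simp add: papp_def)

lemma papp_add: "papp A (p + q) x = papp A p x + papp A q x"
proof -
  let ?n = "max (degree p) (degree q)"
  show ?thesis
    using degree_add_le_max[of p q]
    by (simp add: papp_eq_sum[of _ ?n] sum.distrib scaleR_add_left)
qed

lemma papp_smult: "papp A (smult c p) x = c *\<^sub>R papp A p x"
  by (simp add: papp_eq_sum[of _ "degree p"] degree_smult_le scaleR_sum_right)

lemma papp_minus: "papp A (- p) x = - papp A p x"
  using papp_smult[of A "-1" p x] by simp

lemma papp_diff: "papp A (p - q) x = papp A p x - papp A q x"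
  using papp_add[of A p "- q" x] by (simp add: papp_minus)

lemma papp_sum: "papp A (\<Sum>i\<in>I. p i) x = (\<Sum>i\<in>I. papp A (p i) x)"
  by (induction I rule: infinite_finite_induct) (auto simp: papp_add)

lemma papp_pCons:
  assumes "linear A"
  shows "papp A (pCons a p) x = a *\<^sub>R x + A (papp A p x)"
proof -
  have "papp A (pCons a p) x = (\<Sum>i\<le>Suc (degree p). coeff (pCons a p) i *\<^sub>R (A ^^ i) x)"
    by (rule papp_eq_sum) (simp add: degree_pCons_le)
  also have "\<dots> = a *\<^sub>R x + (\<Sum>i\<le>degree p. coeff p i *\<^sub>R A ((A ^^ i) x))"
    by (subst sum.atMost_Suc_shift) simp
  also have "\<dots> = a *\<^sub>R x + A (papp A p x)"
    using assms by (simp add: papp_def linear_sum linear_scale)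
  finally show ?thesis .
qed

lemma papp_linear:
  assumes "linear A"
  shows "linear (papp A p)"
proof (induction p)
  case 0
  then show ?case by (simp add: linear_iff)
next
  case (pCons a p)
  show ?case
    unfolding linear_iff using assms pCons.IH
    by (simp add: papp_pCons linear_add linear_scale algebra_simps)
qed

lemma papp_mult:
  assumes "linear A"
  shows "papp A (p * q) x = papp A p (papp A q x)"
proof (induction p)
  case (pCons a p)
  then show ?case using assms
    by (simp add: papp_add papp_smult papp_pCons)
qed simp

lemma papp_commute:
  assumes "linear A"
  shows "papp A p (papp A q x) = papp A q (papp A p x)"
  using assms by (metis papp_mult mult.commute)

lemma papp_symmetric:
  fixes A :: "'a::real_inner \<Rightarrow> 'a"
  assumes "linear A" "\<And>x y. A x \<bullet> y = x \<bullet> A y"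
  shows "papp A p x \<bullet> y = x \<bullet> papp A p y"
proof (induction p arbitrary: x y)
  case (pCons a p)
  have "A (papp A p x) \<bullet> y = x \<bullet> A (papp A p y)"
    using pCons.IH[of x "A y"] papp_commute[OF assms(1), of p "[:0, 1:]" y] assms(2)
    by (simp add: papp_pCons assms(1) linear_0)
  then show ?case
    by (simp add: papp_pCons assms(1) inner_add_left inner_add_right)
qed simp

section \<open>The spectral measure of a positive contraction\<close>

text \<open>The form bounds 0 <= A <= 1 make the Bernstein polynomials of A nonnegative forms, which
  is what the moment problem on [0, 1] requires.\<close>

locale pos_contraction =
  fixes A :: "'a::{real_inner, complete_space} \<Rightarrow> 'a"
  assumes lin: "bounded_linear A"
    and sym: "A x \<bullet> y = x \<bullet> A y"
    and pos: "0 \<le> x \<bullet> A x"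
    and contr: "x \<bullet> A x \<le> x \<bullet> x"
begin

lemma linA: "linear A"
  using lin by (rule bounded_linear.linear)

lemmas papp_simps = papp_add papp_diff papp_smult papp_pCons[OF linA] papp_mult[OF linA]

abbreviation X :: "real poly" where "X \<equiv> [:0, 1:]"
abbreviation Y :: "real poly" where "Y \<equiv> [:1, -1:]"

lemma XY: "X + Y = 1"
  by (simp add: one_pCons)

lemma papp_X: "papp A X x = A x"
  using linear_0[OF linA] by (simp add: papp_simps)

lemma papp_Y: "papp A Y x = x - A x"
  using linear_0[OF linA] linear_neg[OF linA] by (simp add: papp_simps)

text \<open>Squares are stripped off: X and Y act as commuting symmetric operators, so one factor of
  a square moves to the other side of the inner product. This leaves exponents 0 and 1, and the
  mixed case rests on X Y = X Y X + Y X Y, a consequence of X + Y = 1.\<close>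

lemma papp_XY_nonneg: "0 \<le> x \<bullet> papp A (X ^ j * Y ^ k) x"
proof (induction "j + k" arbitrary: j k x rule: less_induct)
  case less
  have sq: "0 \<le> x \<bullet> papp A (q * r * q) x"
    if "\<And>y. 0 \<le> y \<bullet> papp A r y" for q r
    using that[of "papp A q x"] papp_symmetric[OF linA sym, of q x "papp A r (papp A q x)"]
    by (simp add: papp_mult[OF linA])
  consider (xx) i where "j = Suc (Suc i)" | (yy) i where "k = Suc (Suc i)"
    | (1) "j = 0" "k = 0" | (2) "j = 1" "k = 0" | (3) "j = 0" "k = 1" | (4) "j = 1" "k = 1"
    by (metis One_nat_def not0_implies_Suc)
  then show ?case
  proof cases
    case xx
    then have "0 \<le> x \<bullet> papp A (X * (X ^ i * Y ^ k) * X) x"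
      by (intro sq less) simp
    then show ?thesis by (simp only: xx power_Suc mult_ac)
  next
    case yy
    then have "0 \<le> x \<bullet> papp A (Y * (X ^ j * Y ^ i) * Y) x"
      by (intro sq less) simp
    then show ?thesis by (simp only: yy power_Suc mult_ac)
  next
    case 4
    have "X * Y = X * Y * (X + Y)" by (simp only: XY mult_1_right)
    also have "\<dots> = X * Y * X + Y * X * Y" by (simp only: algebra_simps)
    finally have "papp A (X * Y) x = papp A (X * Y * X + Y * X * Y) x"
      by (rule arg_cong[where f = "\<lambda>q. papp A q x"])
    moreover have "0 \<le> x \<bullet> papp A (X * Y * X) x" "0 \<le> x \<bullet> papp A (Y * X * Y) x"
      by (intro sq; simp add: papp_X papp_Y pos contr inner_diff_right)+
    ultimately show ?thesis
      by (simp only: 4 power_one_right papp_add inner_add_right)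
  qed (simp_all add: papp_X papp_Y pos contr inner_diff_right)
qed

text \<open>The quadratic form of the Bernstein basis polynomial of index j and degree n, taken at
  A. By \<open>wt_nonneg\<close> and \<open>sum_wt\<close> these are the masses of a discrete
  measure of total mass \<open>u \<bullet> u\<close>.\<close>

definition wt :: "'a \<Rightarrow> nat \<Rightarrow> nat \<Rightarrow> real" where
  "wt u n j = real (n choose j) * (u \<bullet> papp A (X ^ j * Y ^ (n - j)) u)"

lemma wt_nonneg: "0 \<le> wt u n j"
  by (simp add: wt_def papp_XY_nonneg)

lemma sum_binomial_XY:
  fixes r n :: nat
  assumes "r \<le> n"
  shows "(\<Sum>j\<in>{r..n}. of_nat ((n - r) choose (j - r)) * (X ^ j * Y ^ (n - j))) = X ^ r"
proof -
  have "(\<Sum>j\<in>{r..n}. of_nat ((n - r) choose (j - r)) * (X ^ j * Y ^ (n - j)))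
      = (\<Sum>i\<le>n - r. of_nat ((n - r) choose i) * (X ^ (i + r) * Y ^ (n - r - i)))"
    by (rule sum.reindex_bij_witness[where i="\<lambda>i. i + r" and j="\<lambda>j. j - r"])
       (use assms in auto)
  also have "\<dots> = X ^ r * (X + Y) ^ (n - r)"
    unfolding binomial_ring sum_distrib_left
    by (rule sum.cong) (simp_all only: power_add mult_ac)
  finally show ?thesis by (simp only: XY power_one mult_1_right)
qed

text \<open>Binomial moments of the weights are exact for every n, because (n choose j) (j choose r)
  = (n choose r) (n - r choose j - r); power moments agree with those of A only in the
  limit.\<close>

lemma sum_wt_binomial:
  assumes "r \<le> n"
  shows "(\<Sum>j\<le>n. real (j choose r) * wt u n j) = real (n choose r) * (u \<bullet> papp A (X ^ r) u)"
proof -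
  have smult: "of_nat k * p = smult (real k) p" for k :: nat and p :: "real poly"
    by (simp add: of_nat_poly)
  have "(\<Sum>j\<le>n. real (j choose r) * wt u n j) = (\<Sum>j\<in>{r..n}. real (j choose r) * wt u n j)"
    by (rule sum.mono_neutral_right) (auto simp: binomial_eq_0)
  also have "\<dots> = (\<Sum>j\<in>{r..n}. real (n choose r) * (real ((n - r) choose (j - r)) * (u \<bullet> papp A (X ^ j * Y ^ (n - j)) u)))"
  proof (rule sum.cong)
    fix j assume "j \<in> {r..n}"
    then have "(n choose j) * (j choose r) = (n choose r) * ((n - r) choose (j - r))"
      by (intro choose_mult) auto
    then have "real (n choose j) * real (j choose r) = real (n choose r) * real ((n - r) choose (j - r))"
      by (metis of_nat_mult)
    then show "real (j choose r) * wt u n j = real (n choose r) * (real ((n - r) choose (j - r)) * (u \<bullet> papp A (X ^ j * Y ^ (n - j)) u))"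
      by (simp add: wt_def algebra_simps)
  qed simp
  also have "\<dots> = real (n choose r) * (u \<bullet> papp A (\<Sum>j\<in>{r..n}. of_nat ((n - r) choose (j - r)) * (X ^ j * Y ^ (n - j))) u)"
    by (simp only: papp_sum inner_sum_right sum_distrib_left smult papp_smult inner_scaleR_right)
  finally show ?thesis by (simp only: sum_binomial_XY[OF assms])
qed

lemma sum_wt: "(\<Sum>j\<le>n. wt u n j) = u \<bullet> u"
  using sum_wt_binomial[of 0 n u] by simp

end

text \<open>Both quantities are products of r factors, (j - i) / (n - i) against j / n. The
  condition 2 r < n keeps every factor in [-1, 1], even when j < i, so the difference of the
  products is at most the sum of the differences of the factors.\<close>

lemma binomial_ratio_approx:
  fixes j n r :: nat
  assumes "j \<le> n" "2 * r < n"
  shows "\<bar>real (j choose r) / real (n choose r) - (real j / real n) ^ r\<bar> \<le> real r * (real r / (real n - real r))"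
proof -
  have "real (j choose r) / real (n choose r) = (\<Prod>i<r. (real j - real i) / (real n - real i))"
    using assms by (simp add: binomial_gbinomial gbinomial_prod_rev prod_dividef atLeast0LessThan)
  moreover have "(real j / real n) ^ r = (\<Prod>i<r. real j / real n)" by simp
  moreover have "\<bar>(\<Prod>i<r. (real j - real i) / (real n - real i)) - (\<Prod>i<r. real j / real n)\<bar>
      \<le> (\<Sum>i<r. \<bar>(real j - real i) / (real n - real i) - real j / real n\<bar>)"
    unfolding real_norm_def[symmetric]
    by (rule norm_prod_diff) (use assms in \<open>auto simp: abs_le_iff field_simps\<close>)
  moreover have "\<dots> \<le> (\<Sum>i<r. real r / (real n - real r))"
  proof (rule sum_mono)
    fix i assume "i \<in> {..<r}"
    then have i: "i < r" by simp
    have eq: "(real j - real i) / (real n - real i) - real j / real n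
        = - (real i * (real n - real j) / (real n * (real n - real i)))"
      using assms i by (simp add: field_simps)
    have "\<bar>(real j - real i) / (real n - real i) - real j / real n\<bar>
        = (real i / (real n - real i)) * ((real n - real j) / real n)"
      unfolding eq using assms i by (simp add: abs_mult)
    also have "\<dots> \<le> (real i / (real n - real i)) * 1"
      using assms i by (intro mult_left_mono) (auto simp: field_simps)
    also have "\<dots> \<le> real r / (real n - real r)"
      using assms i by (simp add: frac_le)
    finally show "\<bar>(real j - real i) / (real n - real i) - real j / real n\<bar> \<le> real r / (real n - real r)" .
  qed
  ultimately show ?thesis by simp
qed

lemma borel_measurable_poly [measurable]: "poly p \<in> borel_measurable borel" for p :: "real poly"
  by (intro borel_measurable_continuous_onI continuous_at_imp_continuous_on ballI poly_isCont)

context pos_contraction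
begin

lemma papp_X_power: "papp A (X ^ r) x = (A ^^ r) x"
  by (induction r) (simp_all only: power_0 power_Suc papp_1 papp_mult[OF linA] papp_X funpow.simps id_apply comp_def)

text \<open>The Hausdorff moment problem: the binomial weights of the operator moments give
  discrete measures, and a weak limit of these exists by Helly's selection theorem.\<close>

definition hmeas :: "'a \<Rightarrow> nat \<Rightarrow> real measure" where
  "hmeas u n = distr (point_measure {..n} (\<lambda>j. ennreal (wt u n j))) borel (\<lambda>j. real j / real n)"

lemma integral_hmeas:
  fixes f :: "real \<Rightarrow> real"
  assumes "f \<in> borel_measurable borel"
  shows "integral\<^sup>L (hmeas u n) f = (\<Sum>j\<le>n. wt u n j * f (real j / real n))"
proof -
  have "integral\<^sup>L (hmeas u n) f = integral\<^sup>L (point_measure {..n} (\<lambda>j. ennreal (wt u n j))) (\<lambda>j. f (real j / real n))"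
    unfolding hmeas_def using assms by (intro integral_distr) simp_all
  also have "\<dots> = (\<Sum>j\<le>n. wt u n j *\<^sub>R f (real j / real n))"
    by (rule lebesgue_integral_point_measure_finite) (auto simp: wt_nonneg)
  finally show ?thesis by simp
qed

lemma real_distribution_hmeas:
  assumes "norm u = 1"
  shows "real_distribution (hmeas u n)"
proof -
  have "prob_space (point_measure {..n} (\<lambda>j. ennreal (wt u n j)))"
  proof
    have "emeasure (point_measure {..n} (\<lambda>j. ennreal (wt u n j))) {..n} = (\<Sum>j\<le>n. ennreal (wt u n j))"
      by (rule emeasure_point_measure_finite) auto
    also have "\<dots> = ennreal (\<Sum>j\<le>n. wt u n j)"
      by (rule sum_ennreal) (simp add: wt_nonneg)
    also have "\<dots> = 1"
      using assms by (simp add: sum_wt norm_eq_1)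
    finally show "emeasure (point_measure {..n} (\<lambda>j. ennreal (wt u n j)))
      (space (point_measure {..n} (\<lambda>j. ennreal (wt u n j)))) = 1"
      by (simp add: space_point_measure)
  qed
  then interpret prob_space "point_measure {..n} (\<lambda>j. ennreal (wt u n j))" .
  show ?thesis unfolding hmeas_def by (rule real_distribution_distr) simp
qed

text \<open>Tightness is tested on half-open intervals; the left end -1 is there to include the atom
  at 0. For n = 0 the only atom is at 0 / 0 = 0.\<close>

lemma measure_hmeas:
  assumes "norm u = 1"
  shows "measure (hmeas u n) {-1<..1} = 1"
proof -
  interpret real_distribution "hmeas u n" using assms by (rule real_distribution_hmeas)
  have "measure (hmeas u n) {-1<..1} = integral\<^sup>L (hmeas u n) (indicator {-1<..1})"
    by simp
  also have "\<dots> = (\<Sum>j\<le>n. wt u n j * indicator {-1<..1} (real j / real n))"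
    by (rule integral_hmeas) simp
  also have "\<dots> = (\<Sum>j\<le>n. wt u n j)"
  proof (rule sum.cong)
    fix j assume "j \<in> {..n}"
    then have "real j / real n \<in> {-1<..1}"
      by (auto simp: divide_le_eq intro: less_le_trans[of "-1" 0])
    then show "wt u n j * indicator {-1<..1} (real j / real n) = wt u n j" by simp
  qed simp
  finally show ?thesis using assms by (simp add: sum_wt norm_eq_1)
qed

lemma hmeas_moment_bound:
  assumes "norm u = 1" "2 * r < n"
  shows "\<bar>(\<Sum>j\<le>n. wt u n j * (real j / real n) ^ r) - u \<bullet> (A ^^ r) u\<bar> \<le> real r * (real r / (real n - real r))"
proof -
  let ?b = "real r * (real r / (real n - real r))"
  have "(\<Sum>j\<le>n. real (j choose r) / real (n choose r) * wt u n j)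
      = (\<Sum>j\<le>n. real (j choose r) * wt u n j) / real (n choose r)"
    by (simp add: sum_divide_distrib)
  also have "\<dots> = u \<bullet> (A ^^ r) u"
    using assms(2) by (simp only: sum_wt_binomial papp_X_power) simp
  finally have eq: "(\<Sum>j\<le>n. real (j choose r) / real (n choose r) * wt u n j) = u \<bullet> (A ^^ r) u" .
  have "\<bar>(\<Sum>j\<le>n. wt u n j * (real j / real n) ^ r) - u \<bullet> (A ^^ r) u\<bar>
      = \<bar>\<Sum>j\<le>n. wt u n j * ((real j / real n) ^ r - real (j choose r) / real (n choose r))\<bar>"
    unfolding eq[symmetric] sum_subtractf[symmetric] by (simp add: algebra_simps)
  also have "\<dots> \<le> (\<Sum>j\<le>n. wt u n j * ?b)"
  proof (rule order_trans[OF sum_abs], rule sum_mono)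
    fix j assume "j \<in> {..n}"
    then show "\<bar>wt u n j * ((real j / real n) ^ r - real (j choose r) / real (n choose r))\<bar> \<le> wt u n j * ?b"
      using binomial_ratio_approx[of j n r] assms(2)
      by (subst abs_mult) (intro mult_mono; simp add: wt_nonneg abs_minus_commute)
  qed
  also have "\<dots> = (\<Sum>j\<le>n. wt u n j) * ?b" by (simp only: sum_distrib_right)
  finally show ?thesis using assms by (simp add: sum_wt norm_eq_1)
qed

lemma hmeas_moment_tendsto:
  assumes "norm u = 1"
  shows "(\<lambda>n. \<Sum>j\<le>n. wt u n j * (real j / real n) ^ r) \<longlonglongrightarrow> u \<bullet> (A ^^ r) u"
proof -
  have "(\<lambda>n. real r * (real r / (real n - real r))) \<longlonglongrightarrow> 0"
    by real_asymp
  then have "(\<lambda>n. (\<Sum>j\<le>n. wt u n j * (real j / real n) ^ r) - u \<bullet> (A ^^ r) u) \<longlonglongrightarrow> 0"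
  proof (rule Lim_null_comparison[rotated])
    show "\<forall>\<^sub>F n in sequentially. norm ((\<Sum>j\<le>n. wt u n j * (real j / real n) ^ r) - u \<bullet> (A ^^ r) u)
        \<le> real r * (real r / (real n - real r))"
      using eventually_gt_at_top[of "2 * r"] by eventually_elim (use hmeas_moment_bound[OF assms] in auto)
  qed
  then show ?thesis by (simp add: LIM_zero_iff)
qed

lemma spectral_measure_exists_unit:
  assumes u: "norm u = 1"
  shows "\<exists>M. finite_measure M \<and> sets M = sets borel \<and> (AE x in M. x \<in> {0..1}) \<and>
    (\<forall>p. u \<bullet> papp A p u = (\<integral>x. poly p x \<partial>M))"
proof -
  have "tight (hmeas u)"
    unfolding tight_def
  proof (intro conjI allI impI)
    fix e :: real assume "e > 0"
    then show "\<exists>a b. a < b \<and> (\<forall>n. 1 - e < measure (hmeas u n) {a<..b})"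
      by (intro exI[of _ "-1"] exI[of _ 1]) (simp add: measure_hmeas[OF u])
  qed (rule real_distribution_hmeas[OF u])
  then obtain r M where r: "strict_mono (r :: nat \<Rightarrow> nat)" and M: "real_distribution M"
    and wc: "weak_conv_m (hmeas u \<circ> id \<circ> r) M"
    using tight_imp_convergent_subsubsequence[of "hmeas u" id] by (auto simp: strict_mono_def)
  interpret real_distribution M by (rule M)
  \<comment> \<open>Weak convergence tests only bounded continuous functions, so powers are cut off
    outside [0, 1], where none of the approximating measures has mass. The image of the limit under
    the same map then lives on [0, 1].\<close>
  define cl :: "real \<Rightarrow> real" where "cl x = max 0 (min 1 x)" for x
  have cl_cont: "isCont cl x" for x
    unfolding cl_def by (intro continuous_intros)
  have cl_meas [measurable]: "cl \<in> borel_measurable borel"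
    unfolding cl_def by measurable
  have cl_range: "cl x \<in> {0..1}" for x by (simp add: cl_def)
  have moment: "(\<integral>x. cl x ^ k \<partial>M) = u \<bullet> (A ^^ k) u" for k
  proof -
    have "(\<lambda>n. integral\<^sup>L ((hmeas u \<circ> id \<circ> r) n) (\<lambda>x. cl x ^ k)) \<longlonglongrightarrow> (\<integral>x. cl x ^ k \<partial>M)"
    proof (rule weak_conv_imp_integral_bdd_continuous_conv[OF _ M wc])
      show "real_distribution ((hmeas u \<circ> id \<circ> r) n)" for n
        by (simp add: real_distribution_hmeas[OF u])
      show "isCont (\<lambda>x. cl x ^ k) x" for x
        by (intro continuous_intros cl_cont)
      show "norm (cl x ^ k) \<le> 1" for x
        using cl_range[of x] by (simp add: power_le_one)
    qed
    moreover have "integral\<^sup>L ((hmeas u \<circ> id \<circ> r) n) (\<lambda>x. cl x ^ k)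
        = (\<lambda>n. \<Sum>j\<le>n. wt u n j * (real j / real n) ^ k) (r n)" for n
    proof -
      have "cl (real j / real (r n)) = real j / real (r n)" if "j \<le> r n" for j
        using that by (simp add: cl_def divide_le_eq)
      then show ?thesis by (simp add: integral_hmeas)
    qed
    moreover have "(\<lambda>n. (\<lambda>n. \<Sum>j\<le>n. wt u n j * (real j / real n) ^ k) (r n)) \<longlonglongrightarrow> u \<bullet> (A ^^ k) u"
      using LIMSEQ_subseq_LIMSEQ[OF hmeas_moment_tendsto[OF u, of k] r] by (simp add: comp_def)
    ultimately show ?thesis
      using LIMSEQ_unique by fastforce
  qed
  define M' where "M' = distr M borel cl"
  have M': "real_distribution M'"
    unfolding M'_def by (rule real_distribution_distr) simp
  interpret M': real_distribution M' by (rule M')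
  show ?thesis
  proof (intro exI[of _ M'] conjI allI)
    show "AE x in M'. x \<in> {0..1}"
      unfolding M'_def using cl_range by (subst AE_distr_iff) auto
    fix p
    have int: "integrable M (\<lambda>x. cl x ^ i)" for i
    proof (rule integrable_const_bound[where B = 1])
      show "AE x in M. norm (cl x ^ i) \<le> 1" using cl_range by (auto simp: power_le_one)
    qed simp
    have "(\<integral>x. poly p x \<partial>M') = (\<integral>x. poly p (cl x) \<partial>M)"
      unfolding M'_def by (rule integral_distr) simp_all
    also have "\<dots> = (\<Sum>i\<le>degree p. coeff p i * (\<integral>x. cl x ^ i \<partial>M))"
      by (simp add: poly_altdef int)
    also have "\<dots> = u \<bullet> papp A p u"
      by (simp add: moment papp_def inner_sum_right)
    finally show "u \<bullet> papp A p u = (\<integral>x. poly p x \<partial>M')" ..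
  qed (auto simp: M'.finite_measure_axioms)
qed

lemma spectral_measure_exists:
  "\<exists>M. finite_measure M \<and> sets M = sets borel \<and> (AE x in M. x \<in> {0..1}) \<and>
    (\<forall>p. u \<bullet> papp A p u = (\<integral>x. poly p x \<partial>M))"
proof (cases "u = 0")
  case True
  have "finite_measure (null_measure (borel :: real measure))" by (rule finite_measureI) simp
  moreover have "AE x in null_measure (borel :: real measure). P x" for P
    by (rule AE_I[of _ _ UNIV]) auto
  moreover from this have "integral\<^sup>L (null_measure (borel :: real measure)) f = 0" for f :: "real \<Rightarrow> real"
    by (rule integral_eq_zero_AE)
  ultimately show ?thesis
    using True by (intro exI[of _ "null_measure borel"]) simp
next
  case False
  define v where "v = inverse (norm u) *\<^sub>R u"
  have "norm v = 1" using False by (simp add: v_def)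
  then obtain M where M: "finite_measure M" "sets M = sets borel" "AE x in M. x \<in> {0..1}"
      "\<And>p. v \<bullet> papp A p v = (\<integral>x. poly p x \<partial>M)"
    using spectral_measure_exists_unit by blast
  interpret finite_measure M by (rule M)
  note M(2)[measurable_cong]
  let ?N = "density M (\<lambda>x. ennreal ((norm u)\<^sup>2))"
  have "finite_measure ?N"
    by (rule finite_measureI) (simp add: emeasure_density nn_integral_const ennreal_mult_eq_top_iff emeasure_finite)
  moreover have "u \<bullet> papp A p u = (\<integral>x. poly p x \<partial>?N)" for p
  proof -
    have uv: "u = norm u *\<^sub>R v" using False by (simp add: v_def)
    have "u \<bullet> papp A p u = (norm u)\<^sup>2 * (v \<bullet> papp A p v)"
      by (subst (1 2) uv) (simp add: linear_scale[OF papp_linear[OF linA]] power2_eq_square)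
    also have "\<dots> = (\<integral>x. poly p x \<partial>?N)"
      by (subst integral_density) (auto simp: M(4))
    finally show ?thesis .
  qed
  moreover have "AE x in ?N. x \<in> {0..1}"
    using M(3) by (subst AE_density) auto
  ultimately show ?thesis
    using M(2) by (intro exI[of _ ?N]) auto
qed

end

section \<open>Functional calculus by bounded limits of polynomials\<close>

lemma continuous_poly_approx:
  fixes f :: "real \<Rightarrow> real"
  assumes "continuous_on {0..1} f" "0 < e"
  shows "\<exists>p. \<forall>x\<in>{0..1}. \<bar>poly p x - f x\<bar> < e"
proof -
  obtain N where N: "\<And>x. x \<in> {0..1} \<Longrightarrow> \<bar>f x - (\<Sum>k\<le>N. f (k / N) * Bernstein N k x)\<bar> < e"
    using Bernstein_Weierstrass[OF assms] by blast
  let ?p = "\<Sum>k\<le>N. smult (f (k / N) * of_nat (N choose k)) ([:0, 1:] ^ k * [:1, -1:] ^ (N - k))"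
  have "poly ?p x = (\<Sum>k\<le>N. f (k / N) * Bernstein N k x)" for x
    by (simp add: poly_sum Bernstein_def mult_ac)
  then show ?thesis using N by (intro exI[of _ ?p]) (simp add: abs_minus_commute)
qed

locale spectral_pair = pos_contraction A
  for A :: "'a::{real_inner, complete_space} \<Rightarrow> 'a" +
  fixes u :: 'a and M :: "real measure"
  assumes fin: "finite_measure M"
    and sets_M [measurable_cong]: "sets M = sets borel"
    and AE_unit: "AE x in M. x \<in> {0..1}"
    and moment: "u \<bullet> papp A p u = (\<integral>x. poly p x \<partial>M)"
begin

sublocale finite_measure M by (rule fin)

text \<open>\<^term>\<open>rep f \<phi>\<close> says that the vector \<open>\<phi>\<close> is \<open>f(A) u\<close>, where the functional
  calculus is realised by bounded pointwise limits of polynomials.\<close>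

definition rep :: "(real \<Rightarrow> real) \<Rightarrow> 'a \<Rightarrow> bool" where
  "rep f \<phi> \<longleftrightarrow> f \<in> borel_measurable borel \<and>
     (\<exists>p B. (\<forall>x\<in>{0..1}. (\<lambda>j. poly (p j) x) \<longlonglongrightarrow> f x) \<and>
            (\<forall>j. \<forall>x\<in>{0..1}. \<bar>poly (p j) x\<bar> \<le> B) \<and> (\<lambda>j. papp A (p j) u) \<longlonglongrightarrow> \<phi>)"

lemma inner_papp: "papp A p u \<bullet> papp A q u = (\<integral>x. poly p x * poly q x \<partial>M)"
  using moment[of "p * q"] papp_symmetric[OF linA sym, of p u "papp A q u"]
  by (simp add: papp_mult[OF linA])

lemma tendsto_integral_bounded:
  assumes "\<And>j. g j \<in> borel_measurable borel" "f \<in> borel_measurable borel"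
    and "\<And>x. x \<in> {0..1} \<Longrightarrow> (\<lambda>j. g j x) \<longlonglongrightarrow> f x"
    and "\<And>j x. x \<in> {0..1} \<Longrightarrow> \<bar>g j x\<bar> \<le> (B::real)"
  shows "(\<lambda>j. \<integral>x. g j x \<partial>M) \<longlonglongrightarrow> (\<integral>x. f x \<partial>M)"
proof (rule integral_dominated_convergence[where w = "\<lambda>_. B"])
  show "AE x in M. (\<lambda>j. g j x) \<longlonglongrightarrow> f x" "AE x in M. norm (g j x) \<le> B" for j
    using AE_unit assms by auto
qed (use assms in \<open>simp_all add: measurable_cong_sets[OF sets_M refl]\<close>)

text \<open>The isometry known for polynomials passes to limits by dominated convergence, constants
  being integrable for a finite measure. In particular f determines \<phi>.\<close>

lemma rep_inner:
  assumes "rep f \<phi>" "rep g \<psi>"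
  shows "\<phi> \<bullet> \<psi> = (\<integral>x. f x * g x \<partial>M)"
proof -
  obtain p B where p: "\<And>x. x \<in> {0..1} \<Longrightarrow> (\<lambda>j. poly (p j) x) \<longlonglongrightarrow> f x"
      "\<And>j x. x \<in> {0..1} \<Longrightarrow> \<bar>poly (p j) x\<bar> \<le> B" "(\<lambda>j. papp A (p j) u) \<longlonglongrightarrow> \<phi>"
    and f: "f \<in> borel_measurable borel"
    using assms(1) unfolding rep_def by blast
  obtain q C where q: "\<And>x. x \<in> {0..1} \<Longrightarrow> (\<lambda>j. poly (q j) x) \<longlonglongrightarrow> g x"
      "\<And>j x. x \<in> {0..1} \<Longrightarrow> \<bar>poly (q j) x\<bar> \<le> C" "(\<lambda>j. papp A (q j) u) \<longlonglongrightarrow> \<psi>"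
    and g: "g \<in> borel_measurable borel"
    using assms(2) unfolding rep_def by blast
  have "(\<lambda>j. \<integral>x. poly (p j) x * poly (q j) x \<partial>M) \<longlonglongrightarrow> (\<integral>x. f x * g x \<partial>M)"
  proof (rule tendsto_integral_bounded[where B = "B * C"])
    fix j and x :: real assume x: "x \<in> {0..1}"
    show "(\<lambda>j. poly (p j) x * poly (q j) x) \<longlonglongrightarrow> f x * g x"
      using p(1)[OF x] q(1)[OF x] by (rule tendsto_mult)
    show "\<bar>poly (p j) x * poly (q j) x\<bar> \<le> B * C"
      unfolding abs_mult using p(2)[OF x, of j] q(2)[OF x, of j] by (intro mult_mono) auto
  qed (use f g in simp_all)
  moreover have "(\<lambda>j. \<integral>x. poly (p j) x * poly (q j) x \<partial>M) \<longlonglongrightarrow> \<phi> \<bullet> \<psi>"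
    using tendsto_inner[OF p(3) q(3)] by (simp add: inner_papp)
  ultimately show ?thesis by (rule LIMSEQ_unique[symmetric])
qed

lemma rep_norm: "rep f \<phi> \<Longrightarrow> (norm \<phi>)\<^sup>2 = (\<integral>x. (f x)\<^sup>2 \<partial>M)"
  using rep_inner[of f \<phi> f \<phi>] by (simp add: power2_norm_eq_inner power2_eq_square[of "f _"])

lemma rep_poly: "rep (poly q) (papp A q u)"
proof -
  have "bounded (poly q ` {0..1})"
    by (intro compact_imp_bounded compact_continuous_image continuous_at_imp_continuous_on ballI poly_isCont) simp
  then obtain B where "\<forall>x\<in>{0..1}. \<bar>poly q x\<bar> \<le> B" by (auto simp: bounded_iff)
  then show ?thesis unfolding rep_def by (intro conjI exI[of _ "\<lambda>_. q"] exI[of _ B]) auto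
qed

lemma rep_1: "rep (\<lambda>x. 1) u"
  using rep_poly[of 1] by (simp add: rep_def)

lemma rep_add:
  assumes "rep f \<phi>" "rep g \<psi>"
  shows "rep (\<lambda>x. f x + g x) (\<phi> + \<psi>)"
proof -
  obtain p B where p: "\<And>x. x \<in> {0..1} \<Longrightarrow> (\<lambda>j. poly (p j) x) \<longlonglongrightarrow> f x"
      "\<And>j x. x \<in> {0..1} \<Longrightarrow> \<bar>poly (p j) x\<bar> \<le> B" "(\<lambda>j. papp A (p j) u) \<longlonglongrightarrow> \<phi>"
    and f: "f \<in> borel_measurable borel"
    using assms(1) unfolding rep_def by blast
  obtain q C where q: "\<And>x. x \<in> {0..1} \<Longrightarrow> (\<lambda>j. poly (q j) x) \<longlonglongrightarrow> g x"
      "\<And>j x. x \<in> {0..1} \<Longrightarrow> \<bar>poly (q j) x\<bar> \<le> C" "(\<lambda>j. papp A (q j) u) \<longlonglongrightarrow> \<psi>"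
    and g: "g \<in> borel_measurable borel"
    using assms(2) unfolding rep_def by blast
  have "\<bar>poly (p j + q j) x\<bar> \<le> B + C" if "x \<in> {0..1}" for j x
    using p(2)[OF that, of j] q(2)[OF that, of j] by simp
  then show ?thesis
    unfolding rep_def using f g p(1,3) q(1,3)
    by (intro conjI exI[of _ "\<lambda>j. p j + q j"] exI[of _ "B + C"])
       (auto simp: papp_add intro!: tendsto_add)
qed

lemma bounded_linear_papp: "bounded_linear (papp A q)"
proof (induction q)
  case 0
  then show ?case by (simp add: bounded_linear_zero)
next
  case (pCons a q)
  have "papp A (pCons a q) = (\<lambda>x. a *\<^sub>R x + A (papp A q x))"
    by (auto simp: papp_pCons[OF linA])
  then show ?case
    using bounded_linear_compose[OF lin pCons.IH]
    by (simp add: bounded_linear_add bounded_linear_scaleR_right)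
qed

lemma rep_papp:
  assumes "rep f \<phi>"
  shows "rep (\<lambda>x. poly q x * f x) (papp A q \<phi>)"
proof -
  obtain p B where p: "\<And>x. x \<in> {0..1} \<Longrightarrow> (\<lambda>j. poly (p j) x) \<longlonglongrightarrow> f x"
      "\<And>j x. x \<in> {0..1} \<Longrightarrow> \<bar>poly (p j) x\<bar> \<le> B" "(\<lambda>j. papp A (p j) u) \<longlonglongrightarrow> \<phi>"
    and f: "f \<in> borel_measurable borel"
    using assms(1) unfolding rep_def by blast
  obtain C where C: "\<And>x. x \<in> {0..1} \<Longrightarrow> \<bar>poly q x\<bar> \<le> C"
  proof -
    have "bounded (poly q ` {0..1})"
      by (intro compact_imp_bounded compact_continuous_image continuous_at_imp_continuous_on ballI poly_isCont) simp
    then show thesis using that unfolding bounded_iff by (metis imageI real_norm_def)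
  qed
  have "\<bar>poly (q * p j) x\<bar> \<le> C * B" if "x \<in> {0..1}" for j x
    unfolding poly_mult abs_mult using C[OF that] p(2)[OF that, of j] by (intro mult_mono) auto
  moreover have "(\<lambda>j. papp A (q * p j) u) \<longlonglongrightarrow> papp A q \<phi>"
    unfolding papp_mult[OF linA] by (rule bounded_linear.tendsto[OF bounded_linear_papp p(3)])
  ultimately show ?thesis
    unfolding rep_def using f p(1)
    by (intro conjI exI[of _ "\<lambda>j. q * p j"] exI[of _ "C * B"]) (auto intro!: tendsto_mult)
qed

lemma rep_scaleR: "rep f \<phi> \<Longrightarrow> rep (\<lambda>x. c * f x) (c *\<^sub>R \<phi>)"
  using rep_papp[of f \<phi> "[:c:]"] linear_0[OF linA] by (simp add: papp_pCons[OF linA])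

text \<open>This turns a pointwise identity on [0, 1] into an equation between vectors; the
  eigenvector and resolvent equations are obtained in this way.\<close>

lemma rep_zeroD:
  assumes "rep f \<phi>" "\<And>x. x \<in> {0..1} \<Longrightarrow> f x = 0"
  shows "\<phi> = 0"
proof -
  have "(\<integral>x. (f x)\<^sup>2 \<partial>M) = 0"
    by (rule integral_eq_zero_AE) (use AE_unit assms(2) in auto)
  then show ?thesis using rep_norm[OF assms(1)] by simp
qed

text \<open>By dominated convergence the polynomials approach f in L2 of \<open>M\<close>, hence
  their vectors form a Cauchy sequence, and completeness supplies \<phi>.\<close>

lemma rep_exists:
  assumes f: "f \<in> borel_measurable borel"
    and p: "\<And>x. x \<in> {0..1} \<Longrightarrow> (\<lambda>j. poly (p j) x) \<longlonglongrightarrow> f x"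
      "\<And>j x. x \<in> {0..1} \<Longrightarrow> \<bar>poly (p j) x\<bar> \<le> B"
  shows "\<exists>\<phi>. rep f \<phi>"
proof -
  have fB: "\<bar>f x\<bar> \<le> B" if "x \<in> {0..1}" for x
    using tendsto_rabs[OF p(1)[OF that]] by (rule LIMSEQ_le_const2) (use p(2)[OF that] in auto)
  define a where "a j = (\<integral>x. (poly (p j) x - f x)\<^sup>2 \<partial>M)" for j
  have pfB: "\<bar>(poly (p j) x - f x)\<^sup>2\<bar> \<le> (2 * B)\<^sup>2" if "x \<in> {0..1}" for j x
  proof -
    have "\<bar>poly (p j) x - f x\<bar> \<le> 2 * B" using fB[OF that] p(2)[OF that, of j] by auto
    then show ?thesis by (metis abs_ge_zero abs_power2 power2_abs power_mono)
  qed
  have "a \<longlonglongrightarrow> (\<integral>x. 0 \<partial>M)"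
    unfolding a_def
  proof (rule tendsto_integral_bounded[where B = "(2 * B)\<^sup>2"])
    fix x :: real assume "x \<in> {0..1}"
    then have "(\<lambda>j. (poly (p j) x - f x)\<^sup>2) \<longlonglongrightarrow> (f x - f x)\<^sup>2"
      by (intro tendsto_intros p(1))
    then show "(\<lambda>j. (poly (p j) x - f x)\<^sup>2) \<longlonglongrightarrow> 0" by simp
  qed (use f pfB in simp_all)
  then have a: "a \<longlonglongrightarrow> 0" by simp
  have int: "integrable M (\<lambda>x. (poly (p j) x - f x)\<^sup>2)" for j
    by (rule integrable_const_bound[where B = "(2 * B)\<^sup>2"]) (use AE_unit pfB f in auto)
  have le: "(norm (papp A (p i) u - papp A (p j) u))\<^sup>2 \<le> 2 * a i + 2 * a j" for i j
  proof -
    have "(norm (papp A (p i) u - papp A (p j) u))\<^sup>2 = (\<integral>x. (poly (p i - p j) x)\<^sup>2 \<partial>M)"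
      using rep_norm[OF rep_poly[of "p i - p j"]] by (simp only: papp_diff)
    also have "\<dots> \<le> (\<integral>x. 2 * (poly (p i) x - f x)\<^sup>2 + 2 * (poly (p j) x - f x)\<^sup>2 \<partial>M)"
    proof (rule integral_mono)
      have "integrable M (\<lambda>x. poly ((p i - p j)\<^sup>2) x)"
      proof (rule integrable_const_bound[where B = "(2 * B)\<^sup>2"])
        have "\<bar>poly ((p i - p j)\<^sup>2) x\<bar> \<le> (2 * B)\<^sup>2" if "x \<in> {0..1}" for x
        proof -
          have "\<bar>poly (p i) x - poly (p j) x\<bar> \<le> 2 * B" using p(2)[OF that, of i] p(2)[OF that, of j] by auto
          then show ?thesis by (simp add: poly_power) (metis abs_ge_zero power2_abs power_mono power_mult_distrib[of 2 B 2] four_x_squared)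
        qed
        then show "AE x in M. norm (poly ((p i - p j)\<^sup>2) x) \<le> (2 * B)\<^sup>2" using AE_unit by auto
      qed simp
      then show "integrable M (\<lambda>x. (poly (p i - p j) x)\<^sup>2)" by (simp add: poly_power)
      show "integrable M (\<lambda>x. 2 * (poly (p i) x - f x)\<^sup>2 + 2 * (poly (p j) x - f x)\<^sup>2)"
        using int by simp
      fix x
      have "0 \<le> (poly (p i) x - f x + (poly (p j) x - f x))\<^sup>2" by simp
      then show "(poly (p i - p j) x)\<^sup>2 \<le> 2 * (poly (p i) x - f x)\<^sup>2 + 2 * (poly (p j) x - f x)\<^sup>2"
        by (simp add: power2_eq_square algebra_simps)
    qed
    also have "\<dots> = 2 * a i + 2 * a j" using int by (simp add: a_def)
    finally show ?thesis .
  qed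
  have "Cauchy (\<lambda>j. papp A (p j) u)"
  proof (rule metric_CauchyI)
    fix e :: real assume e: "e > 0"
    then have "\<forall>\<^sub>F j in sequentially. a j < e\<^sup>2 / 4"
      using a by (intro order_tendstoD(2)) auto
    then obtain N where N: "\<And>j. j \<ge> N \<Longrightarrow> a j < e\<^sup>2 / 4" by (auto simp: eventually_sequentially)
    have "dist (papp A (p i) u) (papp A (p j) u) < e" if "i \<ge> N" "j \<ge> N" for i j
    proof -
      have "(norm (papp A (p i) u - papp A (p j) u))\<^sup>2 < e\<^sup>2"
        using le[of i j] N[OF that(1)] N[OF that(2)] by linarith
      then show ?thesis using e by (simp add: dist_norm power2_less_imp_less)
    qed
    then show "\<exists>N. \<forall>i\<ge>N. \<forall>j\<ge>N. dist (papp A (p i) u) (papp A (p j) u) < e" by blast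
  qed
  then obtain \<phi> where "(\<lambda>j. papp A (p j) u) \<longlonglongrightarrow> \<phi>"
    using Cauchy_convergent_iff convergent_def by blast
  then show ?thesis unfolding rep_def using f p by blast
qed

lemma rep_exists_continuous_limit:
  assumes f: "f \<in> borel_measurable borel"
    and g: "\<And>j. continuous_on {0..1} (g j)"
      "\<And>x. x \<in> {0..1} \<Longrightarrow> (\<lambda>j. g j x) \<longlonglongrightarrow> f x"
      "\<And>j x. x \<in> {0..1} \<Longrightarrow> \<bar>g j x\<bar> \<le> B"
  shows "\<exists>\<phi>. rep f \<phi>"
proof -
  have "\<exists>p. \<forall>x\<in>{0..1}. \<bar>poly p x - g j x\<bar> < inverse (real (Suc j))" for j
    by (rule continuous_poly_approx[OF g(1)]) simp
  then obtain p where p: "\<And>j x. x \<in> {0..1} \<Longrightarrow> \<bar>poly (p j) x - g j x\<bar> < inverse (real (Suc j))"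
    by metis
  show ?thesis
  proof (rule rep_exists[OF f, of p "B + 1"])
    fix j and x :: real assume x: "x \<in> {0..1}"
    have "(\<lambda>j. poly (p j) x - g j x) \<longlonglongrightarrow> 0"
      by (rule Lim_null_comparison[OF _ LIMSEQ_inverse_real_of_nat])
         (use p[OF x] in \<open>auto intro!: always_eventually less_imp_le\<close>)
    from tendsto_add[OF this g(2)[OF x]] show "(\<lambda>j. poly (p j) x) \<longlonglongrightarrow> f x" by simp
    have "inverse (real (Suc j)) \<le> 1" by (simp add: inverse_eq_divide)
    then show "\<bar>poly (p j) x\<bar> \<le> B + 1" using p[OF x, of j] g(3)[OF x, of j] by linarith
  qed
qed

lemma rep_exists_continuous:
  assumes "continuous_on UNIV f"
  shows "\<exists>\<phi>. rep f \<phi>"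
proof -
  have c: "continuous_on {0..1} f" using assms by (rule continuous_on_subset) simp
  then have "bounded (f ` {0..1})"
    by (intro compact_imp_bounded compact_continuous_image) simp_all
  then obtain B where "\<And>x. x \<in> {0..1} \<Longrightarrow> \<bar>f x\<bar> \<le> B"
    unfolding bounded_iff by (metis imageI real_norm_def)
  then show ?thesis
    using rep_exists_continuous_limit[of f "\<lambda>_. f" B] c assms
    by (simp add: borel_measurable_continuous_onI)
qed

lemma rep_exists_indicator:
  fixes K :: "real set"
  assumes "closed K"
  shows "\<exists>\<phi>. rep (indicator K) \<phi>"
\<comment> \<open>\<open>infdist x {}\<close> is 0, so for empty \<open>K\<close> the cutoffs used
  below would tend to 1 instead of 0.\<close>
proof (cases "K = {}")
  case True
  have "indicator {} = (\<lambda>_::real. 0::real)" by (auto simp: fun_eq_iff)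
  then show ?thesis using rep_exists_continuous[of "\<lambda>_. 0"] True by simp
next
  case False
  let ?g = "\<lambda>j x. max 0 (1 - real j * infdist x K)"
  show ?thesis
  proof (rule rep_exists_continuous_limit[of _ ?g 1])
    show "indicator K \<in> borel_measurable borel" using assms by simp
    show "continuous_on {0..1} (?g j)" for j by (intro continuous_intros)
    show "\<bar>?g j x\<bar> \<le> 1" for j x by (simp add: infdist_nonneg)
    show "(\<lambda>j. ?g j x) \<longlonglongrightarrow> indicator K x" for x
    proof (cases "x \<in> K")
      case True
      then show ?thesis by simp
    next
      case xK: False
      then have d: "infdist x K > 0"
        using assms False infdist_pos_not_in_closed by blast
      have "(\<lambda>j. ?g j x) \<longlonglongrightarrow> 0"
      proof (rule tendsto_eventually)
        obtain N where N: "inverse (infdist x K) < real N" using reals_Archimedean2 by blast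
        show "\<forall>\<^sub>F j in sequentially. ?g j x = 0"
          using eventually_ge_at_top[of N]
        proof eventually_elim
          case (elim j)
          then have "inverse (infdist x K) < real j" using N by linarith
          then have "1 < real j * infdist x K"
            using d by (simp add: field_simps)
          then show ?case by simp
        qed
      qed
      then show ?thesis using xK by simp
    qed
  qed
qed

end

section \<open>A Bessel inequality for Chebyshev polynomials\<close>

text \<open>Chebyshev polynomials in 2 x - 1, so that applying them to A means applying the usual
  ones to 2 A - 1.\<close>

fun cheb :: "nat \<Rightarrow> real poly" where
  "cheb 0 = 1"
| "cheb (Suc 0) = [:-1, 2:]"
| "cheb (Suc (Suc k)) = smult 2 ([:-1, 2:] * cheb (Suc k)) - cheb k"

text \<open>The parameter x = (1 - cos t) / 2 increases from 0 to 1 on [0, pi]; then 2 x - 1 = cos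
  (pi - t), which explains the reflected angle.\<close>

lemma poly_cheb_cos: "poly (cheb k) ((1 - cos t) / 2) = cos (real k * (pi - t))"
proof (induction k rule: cheb.induct)
  case 2
  then show ?case by (simp add: diff_divide_distrib)
next
  case (3 k)
  define r where "r = pi - t"
  have "real k * r = real (Suc k) * r - r" "real (Suc (Suc k)) * r = real (Suc k) * r + r"
    by (simp_all add: algebra_simps)
  then have "cos (real k * r) + cos (real (Suc (Suc k)) * r) = 2 * cos (real (Suc k) * r) * cos r"
    by (simp only: cos_add cos_diff)
  moreover have "poly [:-1, 2:] ((1 - cos t) / 2) = cos r"
    by (simp add: r_def diff_divide_distrib)
  ultimately show ?case using 3 unfolding r_def[symmetric]
    by (simp only: cheb.simps poly_diff poly_smult poly_mult) algebra
qed simp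

lemma has_integral_cos_reflected:
  fixes n :: int
  shows "((\<lambda>t. cos (of_int n * (pi - t))) has_integral (if n = 0 then pi else 0)) {0..pi}"
proof (cases "n = 0")
  case True
  then show ?thesis using has_integral_const_real[of "1::real" 0 pi] by simp
next
  case False
  have "((\<lambda>t. cos (of_int n * (pi - t))) has_integral
      (- sin (of_int n * (pi - pi)) / of_int n) - (- sin (of_int n * (pi - 0)) / of_int n)) {0..pi}"
  proof (rule fundamental_theorem_of_calculus)
    show "((\<lambda>t. - sin (of_int n * (pi - t)) / of_int n) has_vector_derivative cos (of_int n * (pi - t))) (at t within {0..pi})" for t
      unfolding has_real_derivative_iff_has_vector_derivative[symmetric]
      using False by (auto intro!: derivative_eq_intros)
  qed simp
  moreover have "sin (of_int n * pi) = 0" using sin_npi_int[of n] by (simp add: mult.commute)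
  ultimately show ?thesis using False by simp
qed

lemma cos_orthogonality:
  fixes j k :: nat
  shows "((\<lambda>t. cos (real j * (pi - t)) * cos (real k * (pi - t))) has_integral
      (if j = k then if k = 0 then pi else pi / 2 else 0)) {0..pi}"
proof -
  have "((\<lambda>t. (cos (of_int (int j - int k) * (pi - t)) + cos (of_int (int j + int k) * (pi - t))) / 2) has_integral
      ((if int j - int k = 0 then pi else 0) + (if int j + int k = 0 then pi else 0)) / 2) {0..pi}"
    by (intro has_integral_divide has_integral_add has_integral_cos_reflected)
  moreover have "(cos (of_int (int j - int k) * (pi - t)) + cos (of_int (int j + int k) * (pi - t))) / 2
      = cos (real j * (pi - t)) * cos (real k * (pi - t))" for t
    by (simp add: cos_times_cos algebra_simps)
  moreover have "((if int j - int k = 0 then pi else 0) + (if int j + int k = 0 then pi else 0)) / 2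
      = (if j = k then if k = 0 then pi else pi / 2 else 0)"
    by auto
  ultimately show ?thesis by (simp only:)
qed

text \<open>In the angle t the polynomials become orthogonal cosines with square integral at most
  pi, and the Jacobian sin t / 2 is at most 1 / 2. Lebesgue measure is thus controlled although it
  is not their orthogonality weight.\<close>

lemma integral_cheb_le:
  fixes b :: "nat \<Rightarrow> real" and n :: nat
  defines "q \<equiv> \<Sum>k<n. smult (b k) (cheb k)"
  shows "integral {0..1} (\<lambda>x. (poly q x)\<^sup>2) \<le> pi / 2 * (\<Sum>k<n. (b k)\<^sup>2)"
proof -
  define S where "S t = (\<Sum>k<n. b k * cos (real k * (pi - t)))" for t
  have qS: "poly q ((1 - cos t) / 2) = S t" for t
    by (simp add: q_def S_def poly_sum poly_cheb_cos)
  have "((\<lambda>t. (sin t / 2) *\<^sub>R (\<lambda>x. (poly q x)\<^sup>2) ((1 - cos t) / 2)) has_integral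
      integral {(1 - cos 0) / 2..(1 - cos pi) / 2} (\<lambda>x. (poly q x)\<^sup>2)) {0..pi}"
  proof (rule has_integral_substitution[where c = 0 and d = 1])
    show "(\<lambda>t. (1 - cos t) / 2) ` {0..pi} \<subseteq> {0..1::real}"
    proof -
      have "0 \<le> (1 - cos t) / 2 \<and> (1 - cos t) / 2 \<le> 1" for t :: real
        using cos_ge_minus_one[of t] cos_le_one[of t] by auto
      then show ?thesis by auto
    qed
    show "continuous_on {0..1} (\<lambda>x. (poly q x)\<^sup>2)" by (intro continuous_intros)
    show "((\<lambda>t. (1 - cos t) / 2) has_real_derivative sin t / 2) (at t within {0..pi})" for t
      by (auto intro!: derivative_eq_intros)
  qed auto
  then have 1: "((\<lambda>t. (sin t / 2) * (S t)\<^sup>2) has_integral integral {0..1} (\<lambda>x. (poly q x)\<^sup>2)) {0..pi}"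
    by (simp add: qS)
  have "((\<lambda>t. \<Sum>j<n. \<Sum>k<n. b j * b k * (cos (real j * (pi - t)) * cos (real k * (pi - t)))) has_integral
      (\<Sum>j<n. \<Sum>k<n. b j * b k * (if j = k then if k = 0 then pi else pi / 2 else 0))) {0..pi}"
    by (intro has_integral_sum has_integral_mult_right cos_orthogonality) auto
  moreover have "(\<Sum>j<n. \<Sum>k<n. b j * b k * (cos (real j * (pi - t)) * cos (real k * (pi - t)))) = (S t)\<^sup>2" for t
    unfolding S_def power2_eq_square sum_product by (simp add: mult_ac)
  ultimately have 2: "((\<lambda>t. (S t)\<^sup>2) has_integral
      (\<Sum>j<n. \<Sum>k<n. b j * b k * (if j = k then if k = 0 then pi else pi / 2 else 0))) {0..pi}"
    by simp
  have "((\<lambda>t. (S t)\<^sup>2 / 2) has_integral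
      (\<Sum>j<n. \<Sum>k<n. b j * b k * (if j = k then if k = 0 then pi else pi / 2 else 0)) / 2) {0..pi}"
    by (rule has_integral_divide[OF 2])
  then have "integral {0..1} (\<lambda>x. (poly q x)\<^sup>2) \<le>
      (\<Sum>j<n. \<Sum>k<n. b j * b k * (if j = k then if k = 0 then pi else pi / 2 else 0)) / 2"
  proof (rule has_integral_le[OF 1])
    fix t assume "t \<in> {0..pi}"
    show "sin t / 2 * (S t)\<^sup>2 \<le> (S t)\<^sup>2 / 2"
      using mult_right_mono[OF sin_le_one[of t], of "(S t)\<^sup>2"] by simp
  qed
  also have "(\<Sum>j<n. \<Sum>k<n. b j * b k * (if j = k then if k = 0 then pi else pi / 2 else 0))
      = (\<Sum>j<n. (b j)\<^sup>2 * (if j = 0 then pi else pi / 2))"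
  proof (rule sum.cong[OF refl])
    fix j assume "j \<in> {..<n}"
    have "(\<Sum>k<n. b j * b k * (if j = k then if k = 0 then pi else pi / 2 else 0))
        = (\<Sum>k<n. if j = k then b j * b k * (if k = 0 then pi else pi / 2) else 0)"
      by (rule sum.cong) auto
    also have "\<dots> = (b j)\<^sup>2 * (if j = 0 then pi else pi / 2)"
      using \<open>j \<in> {..<n}\<close> by (subst sum.delta') (auto simp: power2_eq_square)
    finally show "(\<Sum>k<n. b j * b k * (if j = k then if k = 0 then pi else pi / 2 else 0))
        = (b j)\<^sup>2 * (if j = 0 then pi else pi / 2)" .
  qed
  also have "\<dots> \<le> (\<Sum>j<n. (b j)\<^sup>2 * pi)"
    by (intro sum_mono mult_left_mono) auto
  also have "(\<Sum>j<n. (b j)\<^sup>2 * pi) = (\<Sum>j<n. (b j)\<^sup>2) * pi" by (rule sum_distrib_right[symmetric])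
  finally show ?thesis by (simp add: mult.commute)
qed

text \<open>A bound for the synthesis map is a bound for its adjoint: the hypothesis is tested with
  the coefficients \<open>\<psi> \<bullet> \<phi> k\<close>, and one factor of the resulting sum is
  cancelled.\<close>

lemma Bessel_by_duality:
  fixes \<phi> :: "nat \<Rightarrow> 'a::real_inner"
  assumes C: "0 \<le> C" and le: "\<And>b. (norm (\<Sum>k<n. b k *\<^sub>R \<phi> k))\<^sup>2 \<le> C * (\<Sum>k<n. (b k)\<^sup>2)"
  shows "(\<Sum>k<n. (\<psi> \<bullet> \<phi> k)\<^sup>2) \<le> C * (norm \<psi>)\<^sup>2"
proof -
  define S where "S = (\<Sum>k<n. (\<psi> \<bullet> \<phi> k)\<^sup>2)"
  have S0: "S \<ge> 0" by (simp add: S_def sum_nonneg)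
  have "S = \<psi> \<bullet> (\<Sum>k<n. (\<psi> \<bullet> \<phi> k) *\<^sub>R \<phi> k)"
    by (simp add: S_def inner_sum_right power2_eq_square)
  then have "\<bar>S\<bar> \<le> norm \<psi> * norm (\<Sum>k<n. (\<psi> \<bullet> \<phi> k) *\<^sub>R \<phi> k)"
    using Cauchy_Schwarz_ineq2 by metis
  then have "S\<^sup>2 \<le> (norm \<psi> * norm (\<Sum>k<n. (\<psi> \<bullet> \<phi> k) *\<^sub>R \<phi> k))\<^sup>2"
    by (metis abs_ge_zero power2_abs power_mono)
  also have "\<dots> \<le> (norm \<psi>)\<^sup>2 * (C * S)"
    unfolding power_mult_distrib S_def by (intro mult_left_mono le) simp
  finally have "S * S \<le> (C * (norm \<psi>)\<^sup>2) * S" by (simp add: power2_eq_square mult_ac)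
  then show ?thesis
  proof (cases "S = 0")
    case True
    then show ?thesis using C by (simp add: S_def)
  next
    case False
    then have "S > 0" using S0 by simp
    then have "S \<le> C * (norm \<psi>)\<^sup>2"
      using \<open>S * S \<le> (C * (norm \<psi>)\<^sup>2) * S\<close> mult_right_le_imp_le by blast
    then show ?thesis by (simp add: S_def)
  qed
qed

section \<open>The Lebesgue alternative\<close>

text \<open>Null sets whose masses approach the supremum have a union \<open>N\<close> that attains
  it; a null set with mass outside \<open>N\<close> would exceed the supremum.\<close>

lemma maximal_null_set:
  fixes M :: "real measure"
  assumes "finite_measure M" "sets M = sets borel"
  obtains N where "N \<in> null_sets lborel" "\<And>B. B \<in> null_sets lborel \<Longrightarrow> measure M (B - N) = 0"
proof -
  interpret finite_measure M by fact
  have sets: "B \<in> sets M" if "B \<in> null_sets lborel" for B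
    using that assms(2) by (simp add: null_sets_def)
  define s where "s = Sup (measure M ` null_sets lborel)"
  have bdd: "bdd_above (measure M ` null_sets lborel)"
    by (rule bdd_aboveI[where M = "measure M (space M)"]) (auto intro: bounded_measure)
  have le_s: "measure M B \<le> s" if "B \<in> null_sets lborel" for B
    unfolding s_def using bdd that by (intro cSup_upper) auto
  have "\<exists>B\<in>null_sets lborel. s - inverse (real (Suc i)) < measure M B" for i
  proof -
    have "s - inverse (real (Suc i)) < s" by simp
    then show ?thesis
      unfolding s_def using less_cSup_iff[OF _ bdd] by (metis (no_types, lifting) image_iff image_is_empty null_sets.empty_sets empty_iff)
  qed
  then obtain B where B: "\<And>i. B i \<in> null_sets lborel" "\<And>i. s - inverse (real (Suc i)) < measure M (B i)"
    by metis
  define N where "N = (\<Union>i. B i)"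
  have N: "N \<in> null_sets lborel" unfolding N_def by (rule null_sets_UN) (rule B)
  have "measure M (B i) \<le> measure M N" for i
    by (rule finite_measure_mono) (auto simp: N_def sets N[unfolded N_def])
  then have "s - inverse (real (Suc i)) \<le> measure M N" for i
    using B(2) by (meson less_imp_le order_trans)
  moreover have "(\<lambda>i. s - inverse (real (Suc i))) \<longlonglongrightarrow> s - 0"
    by (intro tendsto_intros LIMSEQ_inverse_real_of_nat)
  ultimately have s_le: "s \<le> measure M N"
    by (intro LIMSEQ_le_const2[of "\<lambda>i. s - inverse (real (Suc i))"]) auto
  show thesis
  proof (rule that[OF N])
    fix B' :: "real set" assume B': "B' \<in> null_sets lborel"
    have "measure M (N \<union> B') = measure M N + measure M (B' - N)"
      using finite_measure_Union'[of N B'] sets[OF N] sets[OF B'] by simp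
    moreover have "measure M (N \<union> B') \<le> s" using N B' by (intro le_s null_sets.Un)
    ultimately show "measure M (B' - N) = 0"
      using s_le measure_nonneg[of M "B' - N"] by linarith
  qed
qed

text \<open>Outside a maximal null set \<open>M\<close> has a density by Radon-Nikodym. If mass is
  left there, the density is bounded on a set of positive mass, and inner regularity shrinks that
  set to a compact \<open>K\<close>, for whose indicator \<open>rep_exists_indicator\<close>
  provides a vector.\<close>

lemma singular_or_bounded_density:
  fixes M :: "real measure"
  assumes fin: "finite_measure M" and sets_M: "sets M = sets borel"
  shows "(\<exists>N\<in>sets borel. emeasure lborel N = 0 \<and> emeasure M (- N) = 0) \<or>
    (\<exists>K c. compact K \<and> 0 < emeasure M K \<and>
       (\<forall>f\<in>borel_measurable borel. (\<integral>\<^sup>+x. f x * indicator K x \<partial>M) \<le> of_nat c * (\<integral>\<^sup>+x. f x \<partial>lborel)))"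
proof -
  interpret finite_measure M by fact
  note sets_M[measurable_cong]
  have space_M: "space M = UNIV" using sets_eq_imp_space_eq[OF sets_M] by simp
  obtain N where N: "N \<in> null_sets lborel" and max: "\<And>B. B \<in> null_sets lborel \<Longrightarrow> measure M (B - N) = 0"
    using maximal_null_set[OF fin sets_M] by blast
  have N_borel [measurable]: "N \<in> sets borel" using N by (simp add: null_sets_def)
  show ?thesis
  proof (cases "emeasure M (- N) = 0")
    case True
    then show ?thesis using N by (auto simp: null_sets_def)
  next
    case False
    define M' where "M' = density M (indicator (- N))"
    have M'_eq: "emeasure M' B = emeasure M (B - N)" if "B \<in> sets borel" for B
      unfolding M'_def using that sets_M
      by (subst emeasure_density) (auto simp: indicator_inter_arith[symmetric] Diff_eq Int_commute sets_M)
    have ac: "absolutely_continuous lborel M'"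
      unfolding absolutely_continuous_def
    proof
      fix B :: "real set" assume B: "B \<in> null_sets lborel"
      then have "emeasure M' B = 0"
        using max[OF B] by (subst M'_eq) (auto simp: null_sets_def emeasure_eq_measure)
      then show "B \<in> null_sets M'" using B sets_M by (simp add: null_sets_def M'_def)
    qed
    have sets_M': "sets M' = sets lborel" by (simp add: M'_def sets_M)
    define g where "g = RN_deriv lborel M'"
    have g [measurable]: "g \<in> borel_measurable borel" by (simp add: g_def)
    have dens: "density lborel g = M'"
      unfolding g_def by (rule sigma_finite_measure.density_RN_deriv[OF sigma_finite_lborel ac sets_M'])
    have fin': "emeasure M' UNIV < \<infinity>"
      by (simp add: M'_eq emeasure_finite less_top[symmetric])
    have "AE x in lborel. g x \<noteq> \<infinity>"
    proof (rule nn_integral_noteq_infinite)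
      show "integral\<^sup>N lborel g \<noteq> \<infinity>"
        using fin' unfolding dens[symmetric] by (subst (asm) emeasure_density) auto
    qed simp
    then have "AE x in M'. g x \<noteq> \<infinity>"
      unfolding dens[symmetric] by (subst AE_density) auto
    then have "AE x in M'. \<exists>c::nat. g x \<le> of_nat c"
      by eventually_elim (metis ennreal_Ex_less_of_nat infinity_ennreal_def less_imp_le top.not_eq_extremum)
    have "\<exists>c::nat. emeasure M' {x. g x \<le> of_nat c} \<noteq> 0"
    proof (rule ccontr)
      assume "\<not> ?thesis"
      then have "{x. g x \<le> of_nat c} \<in> null_sets M'" for c :: nat
        using sets_M' by (auto simp: null_sets_def)
      then have "AE x in M'. x \<notin> {x. g x \<le> of_nat c}" for c :: nat
        by (rule AE_not_in)
      then have "AE x in M'. \<forall>c::nat. x \<notin> {x. g x \<le> of_nat c}"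
        unfolding AE_all_countable by blast
      with \<open>AE x in M'. \<exists>c::nat. g x \<le> of_nat c\<close> have "AE x in M'. False"
        by eventually_elim blast
      then have "emeasure M' UNIV = 0"
        using AE_iff_measurable[of UNIV M' "\<lambda>_. False"] sets_eq_imp_space_eq[OF sets_M'] sets_M' by simp
      then show False using False by (simp add: M'_eq Compl_eq_Diff_UNIV)
    qed
    then obtain c :: nat where c: "emeasure M' {x. g x \<le> of_nat c} \<noteq> 0" by blast
    define S where "S = {x. g x \<le> of_nat c} - N"
    have S [measurable]: "S \<in> sets borel" by (simp add: S_def)
    have "0 < emeasure M S" using c by (simp add: S_def M'_eq zero_less_iff_neq_zero)
    also have "emeasure M S = (SUP K \<in> {K. K \<subseteq> S \<and> compact K}. emeasure M K)"
      by (rule inner_regular) (auto simp: sets_M emeasure_finite)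
    finally obtain K where K: "K \<subseteq> S" "compact K" "0 < emeasure M K"
      by (auto simp: less_SUP_iff)
    have K_borel [measurable]: "K \<in> sets borel" using K(2) by (simp add: borel_compact)
    have "(\<integral>\<^sup>+x. f x * indicator K x \<partial>M) \<le> of_nat c * (\<integral>\<^sup>+x. f x \<partial>lborel)"
      if f [measurable]: "f \<in> borel_measurable borel" for f
    proof -
      have "(\<integral>\<^sup>+x. f x * indicator K x \<partial>M) = (\<integral>\<^sup>+x. indicator (- N) x * (f x * indicator K x) \<partial>M)"
        by (rule nn_integral_cong) (use K(1) in \<open>auto simp: S_def indicator_def\<close>)
      also have "\<dots> = (\<integral>\<^sup>+x. f x * indicator K x \<partial>M')"
        unfolding M'_def by (subst nn_integral_density) auto
      also have "\<dots> = (\<integral>\<^sup>+x. g x * (f x * indicator K x) \<partial>lborel)"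
        unfolding dens[symmetric] by (subst nn_integral_density) auto
      also have "\<dots> \<le> (\<integral>\<^sup>+x. of_nat c * f x \<partial>lborel)"
      proof (rule nn_integral_mono)
        fix x
        show "g x * (f x * indicator K x) \<le> of_nat c * f x"
          using K(1) by (cases "x \<in> K") (auto simp: S_def intro!: mult_right_mono)
      qed
      also have "\<dots> = of_nat c * (\<integral>\<^sup>+x. f x \<partial>lborel)"
        by (rule nn_integral_cmult) simp
      finally show ?thesis .
    qed
    then show ?thesis using K(2,3) by blast
  qed
qed

section \<open>Local energy of the discrete wave equation\<close>

text \<open>The conserved energy of \<open>\<phi> (k + 2) = 2 T \<phi> (k + 1) - \<phi> k\<close>, restricted to the range of a
  projection \<open>P\<close>, changes only by the flux through the boundary of \<open>P\<close>.\<close>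

lemma local_energy_bound:
  fixes T P :: "'a::real_inner \<Rightarrow> 'a" and \<phi> :: "nat \<Rightarrow> 'a" and N :: "'a \<Rightarrow> real"
  assumes T: "linear T" "\<And>x y. T x \<bullet> y = x \<bullet> T y"
    and P: "linear P" "\<And>x y. P x \<bullet> y = x \<bullet> P y" "\<And>x. P (P x) = P x"
    and wave: "\<And>k. \<phi> (Suc (Suc k)) = 2 *\<^sub>R T (\<phi> (Suc k)) - \<phi> k"
    and flux: "\<And>x y. \<bar>P x \<bullet> T (y - P y)\<bar> \<le> e * (N x + N y)" and e: "0 \<le> e"
    and N: "\<And>x y. N (x - y) \<le> 2 * N x + 2 * N y" "\<And>x. 0 \<le> N x"
    and N_sum: "\<And>n. (\<Sum>k<n. N (\<phi> k)) \<le> C"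
    and decay: "(\<lambda>k. P (\<phi> k)) \<longlonglongrightarrow> 0" and T_bound: "\<And>x. norm (T x) \<le> norm x"
  shows "(norm (P (\<phi> 1)))\<^sup>2 + (norm (P (\<phi> 0)))\<^sup>2 - 2 * (P (\<phi> 1) \<bullet> T (P (\<phi> 0))) \<le> 10 * e * C"
proof -
  define en where "en k = (norm (P (\<phi> (Suc k))))\<^sup>2 + (norm (P (\<phi> k)))\<^sup>2 - 2 * (P (\<phi> (Suc k)) \<bullet> T (P (\<phi> k)))" for k
  \<comment> \<open>Pair \<phi> (k + 2) + \<phi> k = 2 T \<phi> (k + 1) with P of the difference of
    the outer terms. The part of T inside the range of P is absorbed into the energy by symmetry,
    and only the exchange with the complement survives.\<close>
  have diff: "en (Suc k) - en k = 2 * (P (\<phi> (Suc (Suc k)) - \<phi> k) \<bullet> T (\<phi> (Suc k) - P (\<phi> (Suc k))))" for k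
  proof -
    let ?a = "\<phi> (Suc (Suc k))" and ?b = "\<phi> (Suc k)" and ?c = "\<phi> k"
    have PP: "P x \<bullet> P y = P x \<bullet> y" for x y
      by (metis P(2,3))
    have "P (?a - ?c) \<bullet> (?a + ?c) = 2 * (P (?a - ?c) \<bullet> T ?b)"
      by (simp add: wave)
    moreover have "P (?a - ?c) \<bullet> (?a + ?c) = (norm (P ?a))\<^sup>2 - (norm (P ?c))\<^sup>2"
      by (simp add: linear_diff[OF P(1)] inner_diff_left inner_add_right power2_norm_eq_inner PP)
         (simp add: P(2) inner_commute)
    moreover have "P ?b \<bullet> T (P ?c) = P ?c \<bullet> T (P ?b)"
      by (metis T(2) inner_commute)
    ultimately show ?thesis
      by (simp add: en_def linear_diff[OF T(1)] linear_diff[OF P(1)] inner_diff_left inner_diff_right algebra_simps)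
  qed
  \<comment> \<open>\<open>N\<close> of a difference costs a factor 2 on each outer term, so the
    weights are 2 + 1 + 2; doubled, they give the constant 10.\<close>
  have step: "\<bar>en (Suc k) - en k\<bar> \<le> 2 * e * (2 * N (\<phi> (Suc (Suc k))) + N (\<phi> (Suc k)) + 2 * N (\<phi> k))" for k
  proof -
    have "\<bar>en (Suc k) - en k\<bar> = 2 * \<bar>P (\<phi> (Suc (Suc k)) - \<phi> k) \<bullet> T (\<phi> (Suc k) - P (\<phi> (Suc k)))\<bar>"
      unfolding diff by (simp add: abs_mult)
    also have "\<dots> \<le> 2 * (e * (N (\<phi> (Suc (Suc k)) - \<phi> k) + N (\<phi> (Suc k))))"
      by (intro mult_left_mono flux) simp
    also have "\<dots> \<le> 2 * (e * (2 * N (\<phi> (Suc (Suc k))) + 2 * N (\<phi> k) + N (\<phi> (Suc k))))"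
      using N(1) e by (intro mult_left_mono add_right_mono) auto
    finally show ?thesis by (simp add: algebra_simps)
  qed
  have le: "en 0 - en n \<le> 10 * e * C" for n
  proof -
    have "en 0 - en n = - (\<Sum>k<n. en (Suc k) - en k)" by (simp add: sum_lessThan_telescope)
    also have "\<dots> \<le> (\<Sum>k<n. \<bar>en (Suc k) - en k\<bar>)"
      using sum_abs[of "\<lambda>k. en (Suc k) - en k" "{..<n}"] by linarith
    also have "\<dots> \<le> (\<Sum>k<n. 2 * e * (2 * N (\<phi> (Suc (Suc k))) + N (\<phi> (Suc k)) + 2 * N (\<phi> k)))"
      by (rule sum_mono) (rule step)
    also have "\<dots> = 2 * e * (2 * (\<Sum>k<n. N (\<phi> (Suc (Suc k)))) + (\<Sum>k<n. N (\<phi> (Suc k))) + 2 * (\<Sum>k<n. N (\<phi> k)))"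
      by (simp add: sum_distrib_left sum.distrib distrib_left mult_ac)
    also have "\<dots> \<le> 2 * e * (2 * C + C + 2 * C)"
    proof -
      have sh: "(\<Sum>k<n. N (\<phi> (k + j))) \<le> C" for j
      proof -
        have "(\<Sum>k<n. N (\<phi> (k + j))) = (\<Sum>k\<in>(\<lambda>k. k + j) ` {..<n}. N (\<phi> k))"
          by (subst sum.reindex) auto
        also have "\<dots> \<le> (\<Sum>k<n + j. N (\<phi> k))"
          by (rule sum_mono2) (auto simp: N(2))
        also have "\<dots> \<le> C" by (rule N_sum)
        finally show ?thesis .
      qed
      show ?thesis
        using sh[of 0] sh[of 1] sh[of 2] e by (intro mult_left_mono add_mono) (auto simp: numeral_2_eq_2)
    qed
    finally show ?thesis by simp
  qed
  have "en \<longlonglongrightarrow> 0"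
  proof (rule Lim_null_comparison)
    have P0: "(\<lambda>k. norm (P (\<phi> k))) \<longlonglongrightarrow> 0" using tendsto_norm_zero[OF decay] .
    have P1: "(\<lambda>k. norm (P (\<phi> (Suc k)))) \<longlonglongrightarrow> 0" using LIMSEQ_Suc[OF P0] .
    have "(\<lambda>k. (norm (P (\<phi> (Suc k))))\<^sup>2 + (norm (P (\<phi> k)))\<^sup>2 + 2 * (norm (P (\<phi> (Suc k))) * norm (P (\<phi> k))))
        \<longlonglongrightarrow> 0\<^sup>2 + 0\<^sup>2 + 2 * (0 * 0)"
      by (intro tendsto_intros P0 P1)
    then show "(\<lambda>k. (norm (P (\<phi> (Suc k))))\<^sup>2 + (norm (P (\<phi> k)))\<^sup>2 + 2 * (norm (P (\<phi> (Suc k))) * norm (P (\<phi> k)))) \<longlonglongrightarrow> 0"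
      by simp
    have "norm (en k) \<le> (norm (P (\<phi> (Suc k))))\<^sup>2 + (norm (P (\<phi> k)))\<^sup>2 + 2 * (norm (P (\<phi> (Suc k))) * norm (P (\<phi> k)))" for k
    proof -
      have "\<bar>P (\<phi> (Suc k)) \<bullet> T (P (\<phi> k))\<bar> \<le> norm (P (\<phi> (Suc k))) * norm (T (P (\<phi> k)))"
        by (rule Cauchy_Schwarz_ineq2)
      also have "\<dots> \<le> norm (P (\<phi> (Suc k))) * norm (P (\<phi> k))"
        by (intro mult_left_mono T_bound) simp
      finally have "\<bar>P (\<phi> (Suc k)) \<bullet> T (P (\<phi> k))\<bar> \<le> norm (P (\<phi> (Suc k))) * norm (P (\<phi> k))" .
      moreover have "0 \<le> (norm (P (\<phi> (Suc k))))\<^sup>2" "0 \<le> (norm (P (\<phi> k)))\<^sup>2" by simp_all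
      ultimately show ?thesis unfolding en_def real_norm_def by linarith
    qed
    then show "\<forall>\<^sub>F k in sequentially. norm (en k) \<le> (norm (P (\<phi> (Suc k))))\<^sup>2 + (norm (P (\<phi> k)))\<^sup>2 + 2 * (norm (P (\<phi> (Suc k))) * norm (P (\<phi> k)))"
      by simp
  qed
  then have "(\<lambda>n. en 0 - en n) \<longlonglongrightarrow> en 0 - 0" by (intro tendsto_intros)
  then have "en 0 \<le> 10 * e * C"
    using le by (intro LIMSEQ_le_const2[of "\<lambda>n. en 0 - en n"]) auto
  then show ?thesis by (simp add: en_def)
qed

context spectral_pair
begin

text \<open>For a vector cut off to \<open>K\<close> the squared norm of q(A) \<phi> is at most c
  times the Lebesgue integral of q^2 over [0, 1], which \<open>integral_cheb_le\<close> estimates;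
  duality then bounds the sum over time.\<close>

lemma cheb_Bessel:
  assumes rep: "rep (indicator K) \<phi>" and K: "compact K"
    and dens: "\<And>f. f \<in> borel_measurable borel \<Longrightarrow> (\<integral>\<^sup>+x. f x * indicator K x \<partial>M) \<le> of_nat c * (\<integral>\<^sup>+x. f x \<partial>lborel)"
  shows "(\<Sum>k<n. (\<psi> \<bullet> papp A (cheb k) \<phi>)\<^sup>2) \<le> real c * (pi / 2) * (norm \<psi>)\<^sup>2"
proof (rule Bessel_by_duality)
  fix b :: "nat \<Rightarrow> real"
  define q where "q = (\<Sum>k<n. smult (b k) (cheb k))"
  define J where "J = integral {0..1} (\<lambda>x. (poly q x)\<^sup>2)"
  have K_borel [measurable]: "K \<in> sets borel" using K by (simp add: borel_compact)
  have "(\<lambda>x. (poly q x)\<^sup>2) integrable_on {0..1}"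
    by (intro integrable_continuous_real continuous_intros)
  then have int: "((\<lambda>x. (poly q x)\<^sup>2) has_integral J) {0..1}" unfolding J_def by (rule integrable_integral)
  have J0: "0 \<le> J" using int by (rule has_integral_nonneg) simp
  have nn: "(\<integral>\<^sup>+x. ennreal ((poly q x)\<^sup>2) * indicator {0..1} x \<partial>lborel) = ennreal J"
    by (rule nn_integral_has_integral_lebesgue'[OF _ int]) simp
  have "(\<Sum>k<n. b k *\<^sub>R papp A (cheb k) \<phi>) = papp A q \<phi>"
    by (simp add: q_def papp_sum papp_smult)
  then have "(norm (\<Sum>k<n. b k *\<^sub>R papp A (cheb k) \<phi>))\<^sup>2 = (\<integral>x. (poly q x * indicator K x)\<^sup>2 \<partial>M)"
    using rep_norm[OF rep_papp[OF rep, of q]] by simp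
  also have "\<dots> \<le> real c * J"
  proof -
    have "ennreal (\<integral>x. (poly q x * indicator K x)\<^sup>2 \<partial>M) \<le> (\<integral>\<^sup>+x. ennreal ((poly q x * indicator K x)\<^sup>2) \<partial>M)"
      using integral_eq_nn_integral[of "\<lambda>x. (poly q x * indicator K x)\<^sup>2" M]
      by (simp add: enn2real_le ennreal_enn2real_if)
    also have "\<dots> = (\<integral>\<^sup>+x. ennreal ((poly q x)\<^sup>2) * indicator {0..1} x * indicator K x \<partial>M)"
      by (rule nn_integral_cong_AE) (use AE_unit in \<open>auto simp: indicator_def\<close>)
    also have "\<dots> \<le> of_nat c * ennreal J"
      unfolding nn[symmetric] by (rule dens) simp
    also have "\<dots> = ennreal (real c * J)"
      by (simp add: ennreal_mult ennreal_of_nat_eq_real_of_nat J0)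
    finally show ?thesis using J0 by simp
  qed
  also have "\<dots> \<le> real c * (pi / 2 * (\<Sum>k<n. (b k)\<^sup>2))"
    unfolding J_def q_def by (intro mult_left_mono integral_cheb_le) simp
  finally show "(norm (\<Sum>k<n. b k *\<^sub>R papp A (cheb k) \<phi>))\<^sup>2 \<le> real c * (pi / 2) * (\<Sum>k<n. (b k)\<^sup>2)"
    by (simp add: mult_ac)
qed simp

end

section \<open>Absence of eigenvalues\<close>

text \<open>Solutions oscillate, the characteristic roots having modulus one. Concretely, the
  quadratic form \<open>I\<close> is conserved, and it is definite because its cross coefficient 2 E
  / lam is smaller than 2 in modulus; decay forces \<open>I\<close> and hence r to vanish.\<close>

lemma recurrence_decay_zero:
  fixes r :: "nat \<Rightarrow> complex" and E lam :: real
  assumes "\<bar>E\<bar> < lam"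
    and rec: "\<And>m. of_real lam * (r (m + 2) + r m) + of_real (2 * E) * r (m + 1) = 0"
    and lim: "r \<longlonglongrightarrow> 0"
  shows "r m = 0"
proof -
  have lam: "lam > 0" using assms(1) by linarith
  define b where "b = E / lam"
  have b: "\<bar>b\<bar> < 1" using assms(1) lam by (simp add: b_def abs_divide)
  have rec': "r (m + 2) + r m + (2 * b) *\<^sub>R r (m + 1) = 0" for m
  proof -
    have "of_real lam * (r (m + 2) + r m + (2 * b) *\<^sub>R r (m + 1)) = 0"
      using rec[of m] lam by (simp add: b_def scaleR_conv_of_real field_simps)
    then show ?thesis using lam by simp
  qed
  define I where "I m = (cmod (r (m + 1)))\<^sup>2 + (cmod (r m))\<^sup>2 + 2 * b * (r (m + 1) \<bullet> r m)" for m
  have "I (Suc m) - I m = (r (m + 2) - r m) \<bullet> (r (m + 2) + r m + (2 * b) *\<^sub>R r (m + 1))" for m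
    by (simp add: I_def power2_norm_eq_inner inner_diff_left inner_add_right inner_diff_right inner_commute algebra_simps)
  then have "I (Suc m) - I m = 0" for m by (simp only: rec' inner_zero_right)
  then have const: "I m = I 0" for m by (induction m) auto
  have "I \<longlonglongrightarrow> (cmod 0)\<^sup>2 + (cmod 0)\<^sup>2 + 2 * b * ((0::complex) \<bullet> 0)"
    unfolding I_def by (intro tendsto_intros lim LIMSEQ_ignore_initial_segment[OF lim])
  then have "I \<longlonglongrightarrow> 0" by simp
  moreover have "I = (\<lambda>m. I 0)" using const by blast
  ultimately have "(\<lambda>m::nat. I 0) \<longlonglongrightarrow> 0" by metis
  then have "I 0 = 0" by (simp add: LIMSEQ_const_iff)
  then have I0: "I m = 0" for m using const by simp
  have "\<bar>2 * b * (r (m + 1) \<bullet> r m)\<bar> \<le> \<bar>b\<bar> * ((cmod (r (m + 1)))\<^sup>2 + (cmod (r m))\<^sup>2)"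
  proof -
    have "\<bar>r (m + 1) \<bullet> r m\<bar> \<le> cmod (r (m + 1)) * cmod (r m)" by (rule Cauchy_Schwarz_ineq2)
    then have "2 * \<bar>r (m + 1) \<bullet> r m\<bar> \<le> (cmod (r (m + 1)))\<^sup>2 + (cmod (r m))\<^sup>2"
      using sum_squares_bound[of "cmod (r (m + 1))" "cmod (r m)"] by linarith
    from mult_left_mono[OF this, of "\<bar>b\<bar>"] show ?thesis by (simp add: abs_mult mult_ac)
  qed
  then have "(1 - \<bar>b\<bar>) * ((cmod (r (m + 1)))\<^sup>2 + (cmod (r m))\<^sup>2) \<le> 0"
    using I0[of m] unfolding I_def by (simp add: algebra_simps)
  then have "(cmod (r (m + 1)))\<^sup>2 + (cmod (r m))\<^sup>2 \<le> 0"
    using b by (simp add: mult_le_0_iff)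
  then show ?thesis by (simp add: sum_power2_le_zero_iff)
qed

text \<open>Each half-line is treated separately, starting from r 0, so the equation may fail at m =
  0. \<open>V_step\<close> relies on this exception: \<open>V 1 0\<close> is not yet known to vanish
  when it is first applied.\<close>

lemma recurrence_decay_zero_int:
  fixes r :: "int \<Rightarrow> complex" and E lam :: real
  assumes "\<bar>E\<bar> < lam"
    and rec: "\<And>m. m \<noteq> 0 \<Longrightarrow> of_real lam * (r (m + 1) + r (m - 1)) + of_real (2 * E) * r m = 0"
    and "(\<lambda>n. r (int n)) \<longlonglongrightarrow> 0" "(\<lambda>n. r (- int n)) \<longlonglongrightarrow> 0"
  shows "r m = 0"
proof -
  have "r (int n) = 0" for n
  proof (rule recurrence_decay_zero[OF assms(1)])
    fix k :: nat
    show "of_real lam * (r (int (k + 2)) + r (int k)) + of_real (2 * E) * r (int (k + 1)) = 0"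
      using rec[of "int k + 1"] by (simp add: algebra_simps)
  qed (rule assms(3))
  moreover have "r (- int n) = 0" for n
  proof (rule recurrence_decay_zero[OF assms(1)])
    fix k :: nat
    show "of_real lam * (r (- int (k + 2)) + r (- int k)) + of_real (2 * E) * r (- int (k + 1)) = 0"
      using rec[of "-1 - int k"] by (simp add: algebra_simps)
  qed (rule assms(4))
  ultimately show ?thesis by (metis int_cases2)
qed

text \<open>Both relations avoid dividing by the cosine. On the Fourier side \<open>hop_rel\<close>
  is multiplication by 2 (E + lam cos) and \<open>cos_rel\<close> is, up to phases, an average of
  two rotations; eliminating z leaves a second-order equation for s.\<close>

locale maryland_pair =
  fixes \<alpha> \<theta> E lam \<kappa> :: real and s z :: "int \<Rightarrow> complex"
  assumes irr: "\<alpha> \<notin> \<rat>" and E: "\<bar>E\<bar> < lam" and \<kappa>: "\<kappa> \<noteq> 0"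
    and s: "s \<in> l2" and z: "z \<in> l2"
    and cos_rel: "of_real \<kappa> * z j = of_real (cos (2 * pi * (2 * of_int j * \<alpha> + \<theta>))) * s j"
    and hop_rel: "s j = of_real (2 * E) * z j + of_real lam * (z (j + 1) + z (j - 1))"
begin

definition om :: "int \<Rightarrow> complex" where "om k = cis (2 * pi * \<alpha> * of_int k)"

text \<open>The phase sits at the midpoint (2 j + m) \<alpha> of 2 j \<alpha> and 2 (j + m)
  \<alpha>; exchanging the two sites leaves it unchanged, which gives \<open>D_even\<close>.\<close>

definition ph :: "int \<Rightarrow> int \<Rightarrow> int \<Rightarrow> complex" where
  "ph l m j = cis (of_int l * (2 * pi * (of_int (2 * j + m) * \<alpha> + \<theta>)))"

text \<open>On the Fourier side the eigenvalue equation is a second-order difference equation along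
  the orbits of the rotation, and \<open>V l\<close> below lists the Fourier coefficients of the \<open>l\<close>-step
  Wronskian of a solution and its reflection.\<close>

definition D :: "int \<Rightarrow> int \<Rightarrow> complex" where "D l m = (\<Sum>\<^sub>\<infinity>j. s j * s (j + m) * ph l m j)"
definition C :: "int \<Rightarrow> int \<Rightarrow> complex" where "C l m = (\<Sum>\<^sub>\<infinity>j. s j * z (j + m) * ph l m j)"
definition V :: "int \<Rightarrow> int \<Rightarrow> complex" where "V l m = D l m - D (- l) m"

lemma norm_om [simp]: "cmod (om k) = 1" and norm_ph [simp]: "cmod (ph l m j) = 1"
  by (simp_all add: om_def ph_def)

lemma om_add: "om (a + b) = om a * om b"
  by (simp add: om_def cis_mult algebra_simps)

lemma om_0 [simp]: "om 0 = 1"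
  by (simp add: om_def)

lemma om_nz [simp]: "om k \<noteq> 0"
  by (simp add: om_def)

lemma om_minus: "om (- k) = inverse (om k)"
  by (simp add: om_def cis_inverse)

lemma om_eq_1: "om k = 1 \<longleftrightarrow> k = 0"
proof
  assume "om k = 1"
  then have "cos (2 * pi * \<alpha> * of_int k) = 1"
    by (metis om_def cis.simps(1) one_complex.simps(1))
  then obtain n :: int where "2 * pi * \<alpha> * of_int k = of_int n * 2 * pi"
    by (auto simp: cos_one_2pi_int)
  then have eq: "\<alpha> * of_int k = of_int n" by simp
  show "k = 0"
  proof (rule ccontr)
    assume "k \<noteq> 0"
    then have "\<alpha> = of_int n / of_int k" using eq by (simp add: field_simps)
    then show False using irr by simp
  qed
qed simp

lemma has_sum_D: "((\<lambda>j. s j * s (j + m) * ph l m j) has_sum D l m) UNIV"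
  unfolding D_def by (intro has_sum_infsum correlation_summable s) simp

lemma has_sum_C: "((\<lambda>j. s j * z (j + m) * ph l m j) has_sum C l m) UNIV"
  unfolding C_def by (intro has_sum_infsum correlation_summable s z) simp

lemma ph_shift: "ph l (m + k) j = om (l * k) * ph l m j"
  by (simp add: ph_def om_def cis_mult algebra_simps)

lemma cos_ph:
  "of_real (2 * cos (2 * pi * (2 * of_int (j + m) * \<alpha> + \<theta>))) * ph l m j
     = om m * ph (l + 1) m j + om (- m) * ph (l - 1) m j"
proof -
  have cos_cis: "of_real (2 * cos x) = cis x + cis (- x)" for x
    by (simp add: complex_eq_iff)
  show ?thesis
    unfolding cos_cis ph_def om_def distrib_right cis_mult
    by (simp add: algebra_simps)
qed

lemma C_eq: "of_real (2 * \<kappa>) * C l m = om m * D (l + 1) m + om (- m) * D (l - 1) m"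
proof (rule has_sum_unique)
  show "((\<lambda>j. of_real (2 * \<kappa>) * (s j * z (j + m) * ph l m j)) has_sum of_real (2 * \<kappa>) * C l m) UNIV"
    by (rule has_sum_cmult_right[OF has_sum_C])
  have "of_real (2 * \<kappa>) * (s j * z (j + m) * ph l m j)
      = om m * (s j * s (j + m) * ph (l + 1) m j) + om (- m) * (s j * s (j + m) * ph (l - 1) m j)" for j
  proof -
    have "of_real (2 * \<kappa>) * (s j * z (j + m) * ph l m j)
        = 2 * s j * (of_real \<kappa> * z (j + m)) * ph l m j" by simp
    also have "\<dots> = s j * s (j + m) * (of_real (2 * cos (2 * pi * (2 * of_int (j + m) * \<alpha> + \<theta>))) * ph l m j)"
      unfolding cos_rel by simp
    finally show ?thesis unfolding cos_ph by (simp add: algebra_simps)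
  qed
  moreover have "((\<lambda>j. om m * (s j * s (j + m) * ph (l + 1) m j) + om (- m) * (s j * s (j + m) * ph (l - 1) m j))
      has_sum (om m * D (l + 1) m + om (- m) * D (l - 1) m)) UNIV"
    by (intro has_sum_add has_sum_cmult_right has_sum_D)
  ultimately show "((\<lambda>j. of_real (2 * \<kappa>) * (s j * z (j + m) * ph l m j))
      has_sum (om m * D (l + 1) m + om (- m) * D (l - 1) m)) UNIV" by simp
qed

lemma D_eq: "D l m = of_real (2 * E) * C l m + of_real lam * (om (- l) * C l (m + 1) + om l * C l (m - 1))"
proof (rule has_sum_unique[OF has_sum_D])
  have "s j * s (j + m) * ph l m j = of_real (2 * E) * (s j * z (j + m) * ph l m j)
      + of_real lam * (om (- l) * (s j * z (j + (m + 1)) * ph l (m + 1) j) + om l * (s j * z (j + (m - 1)) * ph l (m - 1) j))" for j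
  proof -
    have "om (- l) * ph l (m + 1) j = ph l m j" "om l * ph l (m - 1) j = ph l m j"
      using ph_shift[of l "m + 1" "-1" j] ph_shift[of l "m - 1" 1 j] by simp_all
    then have "om (- l) * (s j * z (j + (m + 1)) * ph l (m + 1) j) = s j * z (j + m + 1) * ph l m j"
      "om l * (s j * z (j + (m - 1)) * ph l (m - 1) j) = s j * z (j + m - 1) * ph l m j"
      by (simp_all add: mult_ac add.assoc add_diff_eq) 
    then show ?thesis
      by (simp only:) (subst hop_rel[of "j + m"], simp add: algebra_simps)
  qed
  then show "((\<lambda>j. s j * s (j + m) * ph l m j)
      has_sum (of_real (2 * E) * C l m + of_real lam * (om (- l) * C l (m + 1) + om l * C l (m - 1)))) UNIV"
    by (simp only:) (intro has_sum_add has_sum_cmult_right has_sum_C)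
qed

text \<open>\<open>C_eq\<close> comes from the cosine relation and moves l, \<open>D_eq\<close>
  comes from the hopping relation and moves m; C is eliminated between them.\<close>

lemma D_rec:
  "of_real (2 * \<kappa>) * D l m = of_real (2 * E) * (om m * D (l + 1) m + om (- m) * D (l - 1) m)
    + of_real lam * (om (m + 1 - l) * D (l + 1) (m + 1) + om (- m - 1 - l) * D (l - 1) (m + 1)
                   + om (m - 1 + l) * D (l + 1) (m - 1) + om (l - m + 1) * D (l - 1) (m - 1))"
proof -
  have "of_real (2 * \<kappa>) * D l m = of_real (2 * E) * (of_real (2 * \<kappa>) * C l m)
    + of_real lam * (om (- l) * (of_real (2 * \<kappa>) * C l (m + 1)) + om l * (of_real (2 * \<kappa>) * C l (m - 1)))"
    by (subst D_eq) (simp add: algebra_simps)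
  also have "\<dots> = of_real (2 * E) * (om m * D (l + 1) m + om (- m) * D (l - 1) m)
    + of_real lam * ((om (- l) * om (m + 1)) * D (l + 1) (m + 1) + (om (- l) * om (- (m + 1))) * D (l - 1) (m + 1)
                   + (om l * om (m - 1)) * D (l + 1) (m - 1) + (om l * om (- (m - 1))) * D (l - 1) (m - 1))"
    unfolding C_eq by (simp add: algebra_simps)
  moreover have "om (- l) * om (m + 1) = om (m + 1 - l)" "om (- l) * om (- (m + 1)) = om (- m - 1 - l)"
    "om l * om (m - 1) = om (m - 1 + l)" "om l * om (- (m - 1)) = om (l - m + 1)"
    unfolding om_add[symmetric] by (rule arg_cong[where f = om], simp)+
  ultimately show ?thesis by (simp only: add.assoc)
qed

lemma D_even: "D l (- m) = D l m"
proof (rule has_sum_unique[OF _ has_sum_D])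
  have "((\<lambda>j. s (j + m) * s (j + m + - m) * ph l (- m) (j + m)) has_sum D l (- m)) UNIV"
    using has_sum_D[of "- m" l]
    by (subst has_sum_reindex_bij_witness[where i = "\<lambda>j. j - m" and j = "\<lambda>j. j + m" and T = UNIV
          and h = "\<lambda>j. s j * s (j + - m) * ph l (- m) j" and s' = "D l (- m)"]) auto
  moreover have "ph l (- m) (j + m) = ph l m j" for j
    by (simp add: ph_def algebra_simps)
  ultimately show "((\<lambda>j. s j * s (j + m) * ph l m j) has_sum D l (- m)) UNIV"
    by (simp add: mult_ac)
qed

text \<open>Passing from (l, m) to (- l, - m) permutes the coefficients of \<open>D_rec\<close>, and
  D is even in m. Hence D (- l) m obeys the same relation as D l m, and so does the
  difference.\<close>

lemma V_rec:
  "of_real (2 * \<kappa>) * V l m = of_real (2 * E) * (om m * V (l + 1) m + om (- m) * V (l - 1) m)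
    + of_real lam * (om (m + 1 - l) * V (l + 1) (m + 1) + om (- m - 1 - l) * V (l - 1) (m + 1)
                   + om (m - 1 + l) * V (l + 1) (m - 1) + om (l - m + 1) * V (l - 1) (m - 1))"
proof -
  have even: "D k (- m - 1) = D k (m + 1)" "D k (- m + 1) = D k (m - 1)" for k
    using D_even[of k "m + 1"] D_even[of k "m - 1"] by (metis minus_add_distrib uminus_add_conv_diff add.commute diff_minus_eq_add minus_diff_eq)+
  have om_eq: "om (- m + 1 - - l) = om (l - m + 1)" "om (- (- m) - 1 - - l) = om (m - 1 + l)"
    "om (- m - 1 + - l) = om (- m - 1 - l)" "om (- l - (- m) + 1) = om (m + 1 - l)"
    by (rule arg_cong[where f = om], simp)+
  have R: "of_real (2 * \<kappa>) * D (- l) m = of_real (2 * E) * (om (- m) * D (- l + 1) m + om m * D (- l - 1) m)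
    + of_real lam * (om (l - m + 1) * D (- l + 1) (m - 1) + om (m - 1 + l) * D (- l - 1) (m - 1)
                   + om (- m - 1 - l) * D (- l + 1) (m + 1) + om (m + 1 - l) * D (- l - 1) (m + 1))"
    using D_rec[of "- l" "- m"] unfolding om_eq even by (simp only: D_even minus_minus)
  have l_eq: "- (l + 1) = - l - 1" "- (l - 1) = - l + 1" by simp_all
  show ?thesis
    using D_rec[of l m] R unfolding V_def l_eq by algebra
qed

lemma V_tendsto_0: "(\<lambda>n. V l (int n)) \<longlonglongrightarrow> 0" "(\<lambda>n. V l (- int n)) \<longlonglongrightarrow> 0"
proof -
  have "(\<lambda>n. D l (int n)) \<longlonglongrightarrow> 0" for l
    unfolding D_def by (intro correlation_tendsto_0 s) (auto simp: inj_def)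
  then show "(\<lambda>n. V l (int n)) \<longlonglongrightarrow> 0" for l
    unfolding V_def using tendsto_diff[of "\<lambda>n. D l (int n)" 0 sequentially "\<lambda>n. D (- l) (int n)" 0] by simp
  then show "(\<lambda>n. V l (- int n)) \<longlonglongrightarrow> 0"
    unfolding V_def D_even .
qed

text \<open>The bounded factor c is a change of gauge that turns the recurrence in m into one with
  constant coefficients.\<close>

lemma decay_zero:
  assumes "\<And>m. m \<noteq> 0 \<Longrightarrow> of_real lam * (c (m + 1) * V l (m + 1) + c (m - 1) * V l (m - 1)) + of_real (2 * E) * (c m * V l m) = 0"
    and "\<And>m. cmod (c m) \<le> B"
  shows "c m * V l m = 0"
proof (rule recurrence_decay_zero_int[OF E, of "\<lambda>m. c m * V l m"])
  have "(\<lambda>n. c (f n) * V l (f n)) \<longlonglongrightarrow> 0" if "(\<lambda>n. V l (f n)) \<longlonglongrightarrow> 0" for f :: "nat \<Rightarrow> int"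
  proof (rule Lim_null_comparison[where g = "\<lambda>n. B * cmod (V l (f n))"])
    show "(\<lambda>n. B * cmod (V l (f n))) \<longlonglongrightarrow> 0"
      using tendsto_mult_left[OF tendsto_norm_zero[OF that], of B] by simp
    show "\<forall>\<^sub>F n in sequentially. norm (c (f n) * V l (f n)) \<le> B * cmod (V l (f n))"
      using assms(2) by (intro always_eventually allI) (simp add: norm_mult mult_right_mono)
  qed
  note lim = this
  show "(\<lambda>n. c (int n) * V l (int n)) \<longlonglongrightarrow> 0" by (rule lim[OF V_tendsto_0(1)])
  show "(\<lambda>n. c (- int n) * V l (- int n)) \<longlonglongrightarrow> 0" by (rule lim[OF V_tendsto_0(2)])
qed (rule assms(1))

lemma V_0: "V 0 m = 0"
  by (simp add: V_def)

text \<open>At l = 0 the relation says that E + lam cos annihilates the difference of two rotations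
  of the one-step Wronskian, whose coefficients are (om m - om (- m)) V 1 m. So this difference
  vanishes, and for m \<noteq> 0 irrationality of \<alpha> allows division.\<close>

lemma V_1_nz:
  assumes "m \<noteq> 0"
  shows "V 1 m = 0"
proof -
  have neg: "V (- 1) m = - V 1 m" for m by (simp add: V_def)
  have "(om m - om (- m)) * V 1 m = 0"
  proof (rule decay_zero[where B = 2])
    fix m :: int
    show "of_real lam * ((om (m + 1) - om (- (m + 1))) * V 1 (m + 1) + (om (m - 1) - om (- (m - 1))) * V 1 (m - 1))
        + of_real (2 * E) * ((om m - om (- m)) * V 1 m) = 0"
    proof -
      have om_eq: "om (- (m + 1)) = om (- m - 1)" "om (- (m - 1)) = om (- m + 1)"
        by (rule arg_cong[where f = om], simp)+
      have "0 = of_real (2 * E) * (om m * V 1 m - om (- m) * V 1 m)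
        + of_real lam * (om (m + 1) * V 1 (m + 1) - om (- m - 1) * V 1 (m + 1)
          + om (m - 1) * V 1 (m - 1) - om (- m + 1) * V 1 (m - 1))"
        using V_rec[of 0 m] by (simp add: V_0 neg)
      then show ?thesis unfolding om_eq by algebra
    qed
    show "cmod (om m - om (- m)) \<le> 2"
      using norm_triangle_ineq4[of "om m" "om (- m)"] by simp
  qed
  moreover have "om m \<noteq> om (- m)"
  proof
    assume "om m = om (- m)"
    then have "om (m + m) = om (m + - m)" unfolding om_add by simp
    then have "om (m + m) = 1" by simp
    then show False using assms by (simp add: om_eq_1)
  qed
  ultimately show ?thesis by simp
qed

text \<open>Away from m = 0 only the terms with l + 1 remain in \<open>V_rec\<close>, and the gauge
  om (m - l m) absorbs all their phases. The decay argument then gives the conclusion at every m,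
  also at 0.\<close>

lemma V_step:
  assumes "\<And>m. V (l - 1) m = 0" "\<And>m. m \<noteq> 0 \<Longrightarrow> V l m = 0"
  shows "V (l + 1) m = 0"
proof -
  have "om (m - l * m) * V (l + 1) m = 0"
  proof (rule decay_zero[where B = 1])
    fix m :: int assume "m \<noteq> 0"
    then have rec: "of_real (2 * E) * (om m * V (l + 1) m)
        + of_real lam * (om (m + 1 - l) * V (l + 1) (m + 1) + om (m - 1 + l) * V (l + 1) (m - 1)) = 0"
      using V_rec[of l m] assms by simp
    have "om (m + 1 - l * (m + 1)) = om (- (l * m)) * om (m + 1 - l)"
      "om (m - 1 - l * (m - 1)) = om (- (l * m)) * om (m - 1 + l)"
      "om (m - l * m) = om (- (l * m)) * om m"
      unfolding om_add[symmetric] by (simp_all add: algebra_simps)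
    then have "of_real lam * (om (m + 1 - l * (m + 1)) * V (l + 1) (m + 1) + om (m - 1 - l * (m - 1)) * V (l + 1) (m - 1))
        + of_real (2 * E) * (om (m - l * m) * V (l + 1) m)
      = om (- (l * m)) * (of_real (2 * E) * (om m * V (l + 1) m)
        + of_real lam * (om (m + 1 - l) * V (l + 1) (m + 1) + om (m - 1 + l) * V (l + 1) (m - 1)))"
      by (simp add: algebra_simps)
    then show "of_real lam * (om (m + 1 - l * (m + 1)) * V (l + 1) (m + 1) + om (m - 1 - l * (m - 1)) * V (l + 1) (m - 1))
        + of_real (2 * E) * (om (m - l * m) * V (l + 1) m) = 0"
      using rec by simp
  qed simp
  then show ?thesis by simp
qed

lemma V_2: "V 2 m = 0"
  using V_step[of 1] V_0 V_1_nz by simp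

text \<open>Here the invariant Wronskian turns out to be zero and not merely constant:
  \<open>V 0\<close> and \<open>V 2\<close> vanish identically, so \<open>V_rec\<close> at l = 1, m
  = 0 reads 2 \<kappa> V 1 0 = 0.\<close>

lemma V_1: "V 1 m = 0"
proof (cases "m = 0")
  case True
  have "of_real (2 * \<kappa>) * V 1 0 = 0"
    using V_rec[of 1 0] by (simp add: V_0 V_2)
  then show ?thesis using True \<kappa> by simp
qed (rule V_1_nz)

lemma V_nat: "V (int l) m = 0"
proof -
  have "(\<forall>m. V (int l) m = 0) \<and> (\<forall>m. V (int l + 1) m = 0)"
  proof (induction l)
    case 0
    then show ?case by (simp add: V_0 V_1)
  next
    case (Suc l)
    then have "V (int l + 1 + 1) m = 0" for m
      using V_step[of "int l + 1" m] by simp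
    then show ?case using Suc by (simp add: algebra_simps)
  qed
  then show ?thesis by simp
qed

text \<open>This is the coefficient m = 0 of \<open>V l\<close>; the bracket is 2 i sin. The terms
  carry (s j)^2 and not its modulus, so the vanishing sum does not yet make each term
  vanish.\<close>

lemma sum_squares_zero:
  "((\<lambda>j. (s j)\<^sup>2 * (cis (of_nat l * (2 * pi * (2 * of_int j * \<alpha> + \<theta>)))
                  - cis (- of_nat l * (2 * pi * (2 * of_int j * \<alpha> + \<theta>))))) has_sum 0) UNIV"
proof -
  have "((\<lambda>j. s j * s (j + 0) * ph (int l) 0 j + - 1 * (s j * s (j + 0) * ph (- int l) 0 j))
      has_sum (D (int l) 0 + - 1 * D (- int l) 0)) UNIV"
    by (intro has_sum_add has_sum_cmult_right has_sum_D)
  moreover have "D (int l) 0 + - 1 * D (- int l) 0 = 0"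
    using V_nat[of l 0] by (simp add: V_def)
  ultimately have "((\<lambda>j. s j * s (j + 0) * ph (int l) 0 j + - 1 * (s j * s (j + 0) * ph (- int l) 0 j)) has_sum 0) UNIV"
    by simp
  then show ?thesis
    by (simp add: ph_def power2_eq_square algebra_simps)
qed

end

section \<open>Separating frequencies by averages of exponentials\<close>

lemma has_sum_finite_sum:
  fixes f :: "'i \<Rightarrow> 'b \<Rightarrow> complex"
  assumes "\<And>i. i \<in> I \<Longrightarrow> (f i has_sum S i) X"
  shows "((\<lambda>x. \<Sum>i\<in>I. f i x) has_sum (\<Sum>i\<in>I. S i)) X"
  using assms by (induction I rule: infinite_finite_induct) (auto intro: has_sum_add)

lemma cis_average_tendsto_0:
  fixes x :: real
  assumes "cis x \<noteq> 1"
  shows "(\<lambda>L. (\<Sum>l<L. cis (real l * x)) / of_nat L) \<longlonglongrightarrow> 0"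
proof (rule Lim_null_comparison)
  show "(\<lambda>L. 2 / cmod (cis x - 1) / real L) \<longlonglongrightarrow> 0"
    by (rule lim_const_over_n)
  have "norm ((\<Sum>l<L. cis (real l * x)) / of_nat L) \<le> 2 / cmod (cis x - 1) / real L" for L
  proof -
    have "(\<Sum>l<L. cis (real l * x)) = (cis x ^ L - 1) / (cis x - 1)"
      using geometric_sum[OF assms, of L] by (simp add: Complex.DeMoivre)
    then have "cmod (\<Sum>l<L. cis (real l * x)) \<le> 2 / cmod (cis x - 1)"
      using norm_triangle_ineq4[of "cis x ^ L" 1]
      by (simp add: norm_divide norm_power divide_right_mono)
    then show ?thesis
      using divide_right_mono[of _ _ "real L"] by (simp only: norm_divide norm_of_nat)
  qed
  then show "\<forall>\<^sub>F L in sequentially. norm ((\<Sum>l<L. cis (real l * x)) / of_nat L) \<le> 2 / cmod (cis x - 1) / real L"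
    by simp
qed

lemma cis_average_1:
  fixes x :: real
  assumes "cis x = 1"
  shows "(\<lambda>L. (\<Sum>l<L. cis (real l * x)) / of_nat L) \<longlonglongrightarrow> 1"
proof (rule tendsto_eventually)
  have 1: "cis (real l * x) = 1" for l
    using assms Complex.DeMoivre[of x l] by simp
  show "\<forall>\<^sub>F L in sequentially. (\<Sum>l<L. cis (real l * x)) / of_nat L = 1"
    using eventually_gt_at_top[of 0] by eventually_elim (simp add: 1)
qed

lemma cis_2pi_eq_1_iff: "cis (2 * pi * x) = 1 \<longleftrightarrow> (\<exists>n::int. x = of_int n)"
proof
  assume "cis (2 * pi * x) = 1"
  then have "cos (2 * pi * x) = 1" by (metis cis.simps(1) one_complex.simps(1))
  then show "\<exists>n::int. x = of_int n" by (auto simp: cos_one_2pi_int)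
qed (auto intro: cis_multiple_2pi)

context maryland_pair
begin

abbreviation frq :: "int \<Rightarrow> real" where "frq j \<equiv> 2 * of_int j * \<alpha> + \<theta>"

text \<open>Multiplying the vanishing sums by cis (- l \<beta> k) and averaging over l < L gives
  weights g L j that tend to 1 at j = k and to 0 elsewhere. They are bounded by 2 and the squares
  are summable, so the limit can be taken under the sum and leaves (s k)^2 = 0.\<close>

lemma s_zero:
  assumes nr: "\<And>m n :: int. 2 * \<alpha> * of_int m + 2 * \<theta> \<noteq> of_int n"
  shows "s k = 0"
proof (rule ccontr)
  assume sk: "s k \<noteq> 0"
  define \<beta> where "\<beta> j = 2 * pi * frq j" for j
  define A where "A L x = (\<Sum>l<L. cis (real l * x)) / of_nat L" for L :: nat and x :: real
  have A_le: "cmod (A L x) \<le> 1" for L x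
  proof -
    have "cmod (\<Sum>l<L. cis (real l * x)) \<le> (\<Sum>l<L. 1)"
      by (rule sum_norm_le) simp
    then show ?thesis by (cases "L = 0") (simp_all add: A_def norm_divide divide_le_eq)
  qed
  define g where "g L j = A L (\<beta> j - \<beta> k) - A L (- \<beta> j - \<beta> k)" for L j
  have g_le: "cmod (g L j) \<le> 2" for L j
    using norm_triangle_ineq4[of "A L (\<beta> j - \<beta> k)" "A L (- \<beta> j - \<beta> k)"] A_le[of L] unfolding g_def
    by (smt (verit))
  have irr_eq: "j = k" if "of_int j * (2 * \<alpha>) - of_int k * (2 * \<alpha>) = of_int n" for j n :: int
  proof (rule ccontr)
    assume "j \<noteq> k"
    then have "\<alpha> = of_int n / of_int (2 * (j - k))" using that by (simp add: field_simps)
    then show False using irr by simp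
  qed
  \<comment> \<open>A resonance between \<beta> k and - \<beta> j is exactly 2 \<alpha>-rationality.
    The case j = k counts too: there the two averages would cancel and the weight at k would tend to
    0.\<close>
  have refl_ne: "cis (- \<beta> j - \<beta> k) \<noteq> 1" for j
  proof
    assume "cis (- \<beta> j - \<beta> k) = 1"
    moreover have "- \<beta> j - \<beta> k = 2 * pi * (- (2 * \<alpha> * of_int (j + k) + 2 * \<theta>))"
      by (simp add: \<beta>_def algebra_simps)
    ultimately obtain n :: int where "- (2 * \<alpha> * of_int (j + k) + 2 * \<theta>) = of_int n"
      using cis_2pi_eq_1_iff by metis
    then have "2 * \<alpha> * of_int (j + k) + 2 * \<theta> = of_int (- n)" by simp
    then show False using nr by blast
  qed
  have g_lim: "(\<lambda>L. g L j) \<longlonglongrightarrow> (if j = k then 1 else 0)" for j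
  proof -
    have "(\<lambda>L. A L (\<beta> j - \<beta> k)) \<longlonglongrightarrow> (if j = k then 1 else 0)"
    proof (cases "j = k")
      case True
      then show ?thesis unfolding A_def using cis_average_1[of "\<beta> j - \<beta> k"] by simp
    next
      case False
      have "cis (\<beta> j - \<beta> k) \<noteq> 1"
      proof
        assume "cis (\<beta> j - \<beta> k) = 1"
        moreover have "\<beta> j - \<beta> k = 2 * pi * (of_int j * (2 * \<alpha>) - of_int k * (2 * \<alpha>))"
          by (simp add: \<beta>_def algebra_simps)
        ultimately show False using irr_eq False cis_2pi_eq_1_iff by metis
      qed
      then show ?thesis unfolding A_def using cis_average_tendsto_0 False by simp
    qed
    moreover have "(\<lambda>L. A L (- \<beta> j - \<beta> k)) \<longlonglongrightarrow> 0"
      unfolding A_def using refl_ne by (rule cis_average_tendsto_0)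
    ultimately show ?thesis unfolding g_def using tendsto_diff by fastforce
  qed
  have g_sum: "((\<lambda>j. (s j)\<^sup>2 * g L j) has_sum 0) UNIV" for L
  proof -
    have "((\<lambda>j. \<Sum>l<L. cis (- real l * \<beta> k) / of_nat L * ((s j)\<^sup>2 * (cis (real l * \<beta> j) - cis (- real l * \<beta> j))))
        has_sum (\<Sum>l<L. cis (- real l * \<beta> k) / of_nat L * 0)) UNIV"
      unfolding \<beta>_def by (intro has_sum_finite_sum has_sum_cmult_right sum_squares_zero)
    moreover have "(\<Sum>l<L. cis (- real l * \<beta> k) / of_nat L * ((s j)\<^sup>2 * (cis (real l * \<beta> j) - cis (- real l * \<beta> j))))
        = (s j)\<^sup>2 * g L j" for j
    proof -
      have "cis (- real l * \<beta> k) * (cis (real l * \<beta> j) - cis (- real l * \<beta> j))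
          = cis (real l * (\<beta> j - \<beta> k)) - cis (real l * (- \<beta> j - \<beta> k))" for l
        by (simp add: right_diff_distrib cis_mult algebra_simps)
      then have eq: "cis (- real l * \<beta> k) / of_nat L * ((s j)\<^sup>2 * (cis (real l * \<beta> j) - cis (- real l * \<beta> j)))
          = (s j)\<^sup>2 / of_nat L * (cis (real l * (\<beta> j - \<beta> k)) - cis (real l * (- \<beta> j - \<beta> k)))" for l
        by (metis (no_types, lifting) mult.left_commute times_divide_eq_left times_divide_eq_right)
      have "(\<Sum>l<L. cis (- real l * \<beta> k) / of_nat L * ((s j)\<^sup>2 * (cis (real l * \<beta> j) - cis (- real l * \<beta> j))))
          = (s j)\<^sup>2 / of_nat L * (\<Sum>l<L. cis (real l * (\<beta> j - \<beta> k)) - cis (real l * (- \<beta> j - \<beta> k)))"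
        unfolding eq by (rule sum_distrib_left[symmetric])
      then show ?thesis
        by (simp add: g_def A_def sum_subtractf diff_divide_distrib right_diff_distrib)
    qed
    ultimately show ?thesis by simp
  qed
  \<comment> \<open>The tail is at most e and the weights are at most 2, so the limit yields |s k|^2
    <= 2 e; with e an eighth of |s k|^2 this is absurd.\<close>
  define e where "e = (cmod (s k))\<^sup>2 / 8"
  have e: "e > 0" using sk by (simp add: e_def)
  have "(\<lambda>j. (cmod (s j))\<^sup>2) summable_on UNIV" using s by (simp add: l2_def)
  then obtain F0 where F0: "finite F0" "dist (\<Sum>j\<in>F0. (cmod (s j))\<^sup>2) (\<Sum>\<^sub>\<infinity>j. (cmod (s j))\<^sup>2) \<le> e"
    using infsum_finite_approximation[of "\<lambda>j. (cmod (s j))\<^sup>2" UNIV e] e by auto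
  define F where "F = insert k F0"
  have F: "finite F" "k \<in> F" using F0 by (auto simp: F_def)
  have sumF: "((\<lambda>j. (cmod (s j))\<^sup>2) has_sum (\<Sum>\<^sub>\<infinity>j. (cmod (s j))\<^sup>2) - (\<Sum>j\<in>F. (cmod (s j))\<^sup>2)) (- F)"
    using has_sum_Diff[OF has_sum_infsum[OF \<open>(\<lambda>j. (cmod (s j))\<^sup>2) summable_on UNIV\<close>] has_sum_finite[OF F(1)]]
    by (simp add: Compl_eq_Diff_UNIV)
  have tail: "(\<Sum>\<^sub>\<infinity>j. (cmod (s j))\<^sup>2) - (\<Sum>j\<in>F. (cmod (s j))\<^sup>2) \<le> e"
  proof -
    have "(\<Sum>j\<in>F0. (cmod (s j))\<^sup>2) \<le> (\<Sum>j\<in>F. (cmod (s j))\<^sup>2)"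
      using F(1) by (intro sum_mono2) (auto simp: F_def)
    then show ?thesis using F0(2) unfolding dist_real_def by linarith
  qed
  have bound: "cmod (\<Sum>j\<in>F. (s j)\<^sup>2 * g L j) \<le> 2 * e" for L
  proof -
    have "((\<lambda>j. (s j)\<^sup>2 * g L j) has_sum 0 - (\<Sum>j\<in>F. (s j)\<^sup>2 * g L j)) (- F)"
      using has_sum_Diff[OF g_sum[of L] has_sum_finite[OF F(1)]]
      by (simp add: Compl_eq_Diff_UNIV)
    then have "norm (0 - (\<Sum>j\<in>F. (s j)\<^sup>2 * g L j)) \<le> 2 * ((\<Sum>\<^sub>\<infinity>j. (cmod (s j))\<^sup>2) - (\<Sum>j\<in>F. (cmod (s j))\<^sup>2))"
    proof (rule norm_infsum_le)
      show "((\<lambda>j. 2 * (cmod (s j))\<^sup>2) has_sum 2 * ((\<Sum>\<^sub>\<infinity>j. (cmod (s j))\<^sup>2) - (\<Sum>j\<in>F. (cmod (s j))\<^sup>2))) (- F)"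
        by (rule has_sum_cmult_right[OF sumF])
      show "norm ((s j)\<^sup>2 * g L j) \<le> 2 * (cmod (s j))\<^sup>2" for j
        using mult_left_mono[OF g_le[of L j], of "(cmod (s j))\<^sup>2"] by (simp add: norm_mult norm_power mult.commute)
    qed
    then show ?thesis using tail by simp
  qed
  have "(\<lambda>L. \<Sum>j\<in>F. (s j)\<^sup>2 * g L j) \<longlonglongrightarrow> (\<Sum>j\<in>F. (s j)\<^sup>2 * (if j = k then 1 else 0))"
    by (intro tendsto_intros g_lim)
  also have "(\<Sum>j\<in>F. (s j)\<^sup>2 * (if j = k then 1 else 0)) = (s k)\<^sup>2"
    using F by (simp add: if_distrib[of "\<lambda>x. _ * x"] sum.delta cong: if_cong)
  finally have "cmod ((s k)\<^sup>2) \<le> 2 * e"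
    using bound by (intro LIMSEQ_le_const2[OF tendsto_norm]) auto
  then show False using e by (simp add: e_def norm_power)
qed

end

text \<open>The even and odd sublattices of an eigenvector of the mosaic operator combine to a pair
  \<open>s, z\<close> that satisfies a Maryland-type equation with reciprocal cosine potential.\<close>

lemma Hop_even:
  "Hop \<alpha> lam \<theta> u (2 * k) = of_real (cos (2 * pi * (2 * of_int k * \<alpha> + \<theta>))) * (u (2 * k) + u (2 * k + 1))
     + of_real lam * u (2 * k - 1)"
  by (simp add: Hop_def cpot_def vpot_def algebra_simps)

lemma Hop_odd:
  "Hop \<alpha> lam \<theta> u (2 * k + 1) = of_real (cos (2 * pi * (2 * of_int k * \<alpha> + \<theta>))) * (u (2 * k) + u (2 * k + 1))
     + of_real lam * u (2 * k + 2)"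
  by (simp add: Hop_def cpot_def vpot_def algebra_simps)

lemma l2_subseq:
  assumes "u \<in> l2" "inj f"
  shows "(\<lambda>n. u (f n)) \<in> l2"
proof -
  have "(\<lambda>n. (cmod (u n))\<^sup>2) summable_on range f"
    using assms(1) by (auto simp: l2_def intro: summable_on_subset_banach)
  then show ?thesis
    using summable_on_reindex[OF assms(2), of "\<lambda>n. (cmod (u n))\<^sup>2"] by (simp add: l2_def comp_def)
qed

lemma no_eigenvalue:
  assumes irr: "\<alpha> \<notin> \<rat>" and nr: "\<not> two_alpha_rational \<alpha> \<theta>" and E: "\<bar>E\<bar> < lam"
    and u: "u \<in> l2" and eig: "\<And>n. Hop \<alpha> lam \<theta> u n = of_real E * u n"
  shows "u n = 0"
proof -
  define a where "a k = complex_of_real (cos (2 * pi * (2 * of_int k * \<alpha> + \<theta>)))" for k :: int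
  define x where "x k = u (2 * k)" for k
  define y where "y k = u (2 * k + 1)" for k
  have xl2: "x \<in> l2" and yl2: "y \<in> l2"
    unfolding x_def y_def using l2_subseq[OF u, of "\<lambda>k. 2 * k"] l2_subseq[OF u, of "\<lambda>k. 2 * k + 1"]
    by (simp_all add: inj_def)
  have e1: "a k * (x k + y k) + of_real lam * y (k - 1) = of_real E * x k" for k
  proof -
    have "u (2 * k - 1) = y (k - 1)" by (simp add: y_def algebra_simps)
    then show ?thesis using Hop_even[of \<alpha> lam \<theta> u k] eig[of "2 * k"] by (simp add: a_def x_def y_def)
  qed
  have e2: "a k * (x k + y k) + of_real lam * x (k + 1) = of_real E * y k" for k
  proof -
    have "u (2 * k + 2) = x (k + 1)" by (simp add: x_def algebra_simps)
    then show ?thesis using Hop_odd[of \<alpha> lam \<theta> u k] eig[of "2 * k + 1"] by (simp add: a_def x_def y_def)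
  qed
  define \<kappa> where "\<kappa> = E\<^sup>2 - lam\<^sup>2"
  have \<kappa>: "\<kappa> \<noteq> 0" using E abs_square_less_1[of "E / lam"] by (auto simp: \<kappa>_def power2_eq_iff)
  define s where "s k = x k + y k" for k
  define z where "z k = a k * s k / of_real \<kappa>" for k
  have sl2: "s \<in> l2" unfolding s_def using l2_add[OF xl2 yl2] .
  have zl2: "z \<in> l2"
  proof (rule l2_comparison[of "\<lambda>k. of_real (1 / \<kappa>) * s k" "\<lambda>_. 0"])
    have "cmod (a k) \<le> 1" for k by (simp add: a_def)
    then show "cmod (z k) \<le> cmod (of_real (1 / \<kappa>) * s k) + cmod 0" for k
      using mult_right_mono[of "cmod (a k)" 1 "cmod (s k)"]
      by (simp add: z_def norm_mult norm_divide divide_right_mono)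
  qed (use l2_scale[OF sl2, of "of_real (1 / \<kappa>)"] l2_0 in simp_all)
  interpret maryland_pair \<alpha> \<theta> E lam \<kappa> s z
  proof
    fix j
    show "of_real \<kappa> * z j = of_real (cos (2 * pi * (2 * of_int j * \<alpha> + \<theta>))) * s j"
      using \<kappa> by (simp add: z_def a_def)
    have \<kappa>z: "of_real \<kappa> * z k = a k * s k" for k using \<kappa> by (simp add: z_def)
    \<comment> \<open>The eigenvalue equations express a s at j and its neighbours through x and y.
      In this combination the terms E lam x (j + 1) and E lam y (j - 1) cancel and (E^2 - lam^2) (x
      j + y j) remains, which dictates \<kappa>.\<close>
    have "of_real \<kappa> * s j = of_real (2 * E) * (a j * s j) + of_real lam * (a (j + 1) * s (j + 1) + a (j - 1) * s (j - 1))"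
    proof -
      have "a (j + 1) * s (j + 1) = of_real E * x (j + 1) - of_real lam * y j"
        using e1[of "j + 1"] by (simp add: s_def algebra_simps)
      moreover have "a (j - 1) * s (j - 1) = of_real E * y (j - 1) - of_real lam * x j"
        using e2[of "j - 1"] by (simp add: s_def algebra_simps)
      moreover have "a j * s j = of_real E * x j - of_real lam * y (j - 1)"
        "a j * s j = of_real E * y j - of_real lam * x (j + 1)"
        using e1[of j] e2[of j] by (simp_all add: s_def algebra_simps)
      moreover have "of_real \<kappa> = (of_real E)\<^sup>2 - (of_real lam :: complex)\<^sup>2" by (simp add: \<kappa>_def)
      moreover have "of_real (2 * E) = 2 * (of_real E :: complex)" by simp
      ultimately show ?thesis unfolding s_def by algebra
    qed
    also have "\<dots> = of_real \<kappa> * (of_real (2 * E) * z j + of_real lam * (z (j + 1) + z (j - 1)))"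
      unfolding \<kappa>z[symmetric] by (simp add: algebra_simps)
    finally show "s j = of_real (2 * E) * z j + of_real lam * (z (j + 1) + z (j - 1))"
      using \<kappa> by simp
  qed (use irr E \<kappa> sl2 zl2 in auto)
  have s0: "x k + y k = 0" for k
    using s_zero[of k] nr by (auto simp: s_def two_alpha_rational_def)
  \<comment> \<open>s = 0 still allows y = - x. The two equations then read E x k = - lam x (k - 1)
    and E x k = - lam x (k + 1), so E^2 x k = lam^2 x k.\<close>
  have x0: "x k = 0" for k
  proof -
    have 1: "of_real E * x k = - of_real lam * x (k - 1)" for k
      using e1[of k] s0[of k] s0[of "k - 1"] by (simp add: eq_neg_iff_add_eq_0[symmetric])
    have 2: "of_real E * x k = - of_real lam * x (k + 1)" for k
      using e2[of k] s0[of k] by (simp add: eq_neg_iff_add_eq_0[symmetric])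
    have "of_real (E\<^sup>2) * x k = of_real (lam\<^sup>2) * x k"
    proof -
      have "of_real (E\<^sup>2) * x k = of_real E * (of_real E * x k)" by (simp add: power2_eq_square)
      also have "\<dots> = - of_real lam * (of_real E * x (k + 1))" unfolding 2[of k] by simp
      also have "\<dots> = of_real (lam\<^sup>2) * x k" unfolding 1[of "k + 1"] by (simp add: power2_eq_square)
      finally show ?thesis .
    qed
    then have "of_real \<kappa> * x k = 0" by (simp add: \<kappa>_def left_diff_distrib)
    then show ?thesis using \<kappa> by simp
  qed
  then have y0: "y k = 0" for k using s0[of k] by simp
  show ?thesis
  proof (cases "even n")
    case True
    then show ?thesis using x0 by (auto simp: x_def elim!: evenE)
  next
    case False
    then show ?thesis using y0 by (auto simp: y_def elim!: oddE)
  qed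
qed

section \<open>The mosaic operator\<close>

definition Hc :: "real \<Rightarrow> real \<Rightarrow> real \<Rightarrow> cl2 \<Rightarrow> cl2" where
  "Hc \<alpha> lam \<theta> x = Abs_cl2 (Hop \<alpha> lam \<theta> (cseq x))"

definition delta :: "int \<Rightarrow> complex \<Rightarrow> cl2" where
  "delta m w = Abs_cl2 (\<lambda>n. if n = m then w else 0)"

lemma cseq_delta: "cseq (delta m w) n = (if n = m then w else 0)"
proof -
  have "(\<lambda>n. if n = m then w else 0) \<in> l2"
    unfolding l2_def by (auto intro!: finite_nonzero_values_imp_summable_on finite_subset[of _ "{m}"] split: if_splits)
  then show ?thesis by (simp add: delta_def Abs_cl2_inverse)
qed

lemma inner_delta: "delta m w \<bullet> x = w \<bullet> cseq x m"
proof -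
  have "delta m w \<bullet> x = infsum (\<lambda>n. cseq (delta m w) n \<bullet> cseq x n) {m}"
    unfolding inner_cl2_infsum by (rule infsum_cong_neutral) (auto simp: cseq_delta)
  then show ?thesis by (simp add: cseq_delta)
qed

lemma norm_delta: "norm (delta m w) = cmod w"
  using inner_delta[of m w "delta m w"]
  by (simp add: norm_eq_sqrt_inner cseq_delta)

text \<open>The orbit k \<beta> comes close to 1 / 4 - \<gamma> modulo 1, which brings the argument
  to a zero of the cosine, and |sin y| <= |y| turns closeness into smallness. Positivity of k fixes
  the direction of the search.\<close>

lemma irrational_rotation_cos_small:
  fixes \<beta> \<gamma> e :: real
  assumes "\<beta> \<notin> \<rat>" "e > 0"
  shows "\<exists>k::int. k > 0 \<and> \<bar>cos (2 * pi * (of_int k * \<beta> + \<gamma>))\<bar> < e"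
proof -
  have e': "e / (2 * pi) > 0" using assms(2) by simp
  obtain h k :: int where hk: "k > 0" "\<bar>of_int k * \<beta> - of_int h - (1 / 4 - \<gamma>)\<bar> < e / (2 * pi)"
    using sequence_of_fractional_parts_is_dense[OF assms(1) e'] by metis
  define d where "d = of_int k * \<beta> - of_int h - (1 / 4 - \<gamma>)"
  have "cos (2 * pi * (of_int k * \<beta> + \<gamma>)) = cos ((2 * pi * d + pi / 2) + 2 * pi * of_int h)"
    by (simp add: d_def algebra_simps)
  also have "\<dots> = - sin (2 * pi * d)"
  proof -
    have "cos ((2 * pi * d + pi / 2) + 2 * pi * of_int h) = cos (2 * pi * d + pi / 2)"
      by (simp add: cos_add)
    then show ?thesis by (simp add: cos_add)
  qed
  finally have "\<bar>cos (2 * pi * (of_int k * \<beta> + \<gamma>))\<bar> \<le> \<bar>2 * pi * d\<bar>"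
    using abs_sin_x_le_abs_x[of "2 * pi * d"] by simp
  also have "\<dots> < e"
  proof -
    have "\<bar>d\<bar> < e / (2 * pi)" using hk(2) by (simp only: d_def)
    then show ?thesis by (simp add: abs_mult field_simps)
  qed
  finally show ?thesis using hk(1) by blast
qed

locale mosaic =
  fixes \<alpha> lam \<theta> :: real
  assumes irr: "\<alpha> \<notin> \<rat>" and lam: "lam > 0"
begin

abbreviation H :: "cl2 \<Rightarrow> cl2" where "H \<equiv> Hc \<alpha> lam \<theta>"
abbreviation c :: "int \<Rightarrow> real" where "c \<equiv> cpot \<alpha> lam \<theta>"
abbreviation v :: "int \<Rightarrow> real" where "v \<equiv> vpot \<alpha> \<theta>"

lemma abs_c_le: "\<bar>c n\<bar> \<le> lam + 1"
proof -
  have "\<bar>cos (2 * pi * (of_int n * \<alpha> + \<theta>))\<bar> \<le> 1" by (rule abs_cos_le_one)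
  then have "\<bar>cos (2 * pi * (of_int n * \<alpha> + \<theta>))\<bar> \<le> lam + 1" using lam by linarith
  then show ?thesis using lam unfolding cpot_def by auto
qed

lemma abs_v_le: "\<bar>v n\<bar> \<le> lam + 1"
proof -
  have "\<bar>v n\<bar> \<le> 1" unfolding vpot_def by (auto simp: abs_cos_le_one)
  then show ?thesis using lam by linarith
qed

lemma sum_Hop_le:
  assumes "finite F"
  shows "(\<Sum>n\<in>F. (cmod (Hop \<alpha> lam \<theta> (cseq x) n))\<^sup>2) \<le> (3 * (lam + 1) * norm x)\<^sup>2"
proof -
  let ?u = "cseq x" and ?B = "lam + 1"
  have shift: "(\<Sum>n\<in>F. (cmod (?u (n + m)))\<^sup>2) \<le> (norm x)\<^sup>2" for m
  proof -
    have "(\<Sum>n\<in>F. (cmod (?u (n + m)))\<^sup>2) = (\<Sum>n\<in>(\<lambda>n. n + m) ` F. (cmod (?u n))\<^sup>2)"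
      by (subst sum.reindex) (auto simp: inj_on_def)
    also have "\<dots> \<le> (norm x)\<^sup>2" using assms by (intro sum_cseq_le_norm) simp
    finally show ?thesis .
  qed
  \<comment> \<open>The indices n + - 1 and n + 0 are written to match \<open>shift\<close>.\<close>
  have "(cmod (Hop \<alpha> lam \<theta> ?u n))\<^sup>2 \<le> 3 * ?B\<^sup>2 * ((cmod (?u (n + 1)))\<^sup>2 + (cmod (?u (n + - 1)))\<^sup>2 + (cmod (?u (n + 0)))\<^sup>2)" for n
  proof -
    let ?a = "cmod (?u (n + 1))" and ?b = "cmod (?u (n + - 1))" and ?d = "cmod (?u (n + 0))"
    have "cmod (Hop \<alpha> lam \<theta> ?u n) \<le> cmod (of_real (c n) * ?u (n + 1)) + cmod (of_real (c (n - 1)) * ?u (n - 1)) + cmod (of_real (v n) * ?u n)"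
      unfolding Hop_def by (intro order_trans[OF norm_triangle_ineq] add_right_mono norm_triangle_ineq)
    also have "\<dots> \<le> ?B * ?a + ?B * ?b + ?B * ?d"
      unfolding norm_mult norm_of_real
      by (intro add_mono mult_mono abs_c_le abs_v_le) (use lam in auto)
    finally have "(cmod (Hop \<alpha> lam \<theta> ?u n))\<^sup>2 \<le> (?B * (?a + ?b + ?d))\<^sup>2"
      by (intro power_mono) (auto simp: algebra_simps)
    also have "\<dots> = ?B\<^sup>2 * (?a + ?b + ?d)\<^sup>2" by (rule power_mult_distrib)
    also have "\<dots> \<le> ?B\<^sup>2 * (3 * (?a\<^sup>2 + ?b\<^sup>2 + ?d\<^sup>2))"
    proof (rule mult_left_mono)
      have "0 \<le> (?a - ?b)\<^sup>2 + (?a - ?d)\<^sup>2 + (?b - ?d)\<^sup>2" by simp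
      then show "(?a + ?b + ?d)\<^sup>2 \<le> 3 * (?a\<^sup>2 + ?b\<^sup>2 + ?d\<^sup>2)"
        unfolding power2_eq_square by (simp add: algebra_simps)
    qed simp
    finally show ?thesis by (simp only: mult_ac)
  qed
  then have "(\<Sum>n\<in>F. (cmod (Hop \<alpha> lam \<theta> ?u n))\<^sup>2) \<le>
      (\<Sum>n\<in>F. 3 * ?B\<^sup>2 * ((cmod (?u (n + 1)))\<^sup>2 + (cmod (?u (n + - 1)))\<^sup>2 + (cmod (?u (n + 0)))\<^sup>2))"
    by (rule sum_mono)
  also have "\<dots> = 3 * ?B\<^sup>2 * ((\<Sum>n\<in>F. (cmod (?u (n + 1)))\<^sup>2) + (\<Sum>n\<in>F. (cmod (?u (n + - 1)))\<^sup>2) + (\<Sum>n\<in>F. (cmod (?u (n + 0)))\<^sup>2))"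
    by (simp only: sum_distrib_left[symmetric] sum.distrib)
  also have "\<dots> \<le> 3 * ?B\<^sup>2 * ((norm x)\<^sup>2 + (norm x)\<^sup>2 + (norm x)\<^sup>2)"
    by (intro mult_left_mono add_mono shift) simp
  also have "\<dots> = (3 * ?B * norm x)\<^sup>2" by (simp add: power2_eq_square algebra_simps)
  finally show ?thesis .
qed

lemma cseq_H [simp]: "cseq (H x) n = Hop \<alpha> lam \<theta> (cseq x) n"
proof -
  have "Hop \<alpha> lam \<theta> (cseq x) \<in> l2" by (rule l2_boundI[OF sum_Hop_le])
  then show ?thesis by (simp add: Hc_def Abs_cl2_inverse)
qed

lemma norm_H_le: "norm (H x) \<le> 3 * (lam + 1) * norm x"
  by (rule norm_cl2_le) (use lam sum_Hop_le in auto)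

lemma linear_H: "linear H"
  by (rule linearI) (auto intro!: cseq_eqI simp: Hop_def scaleR_conv_of_real algebra_simps)

lemma H_symmetric: "H x \<bullet> y = x \<bullet> H y"
proof -
  define f where "f n = c n * (cseq x (n + 1) \<bullet> cseq y n)" for n
  define g where "g n = c n * (cseq x n \<bullet> cseq y (n + 1))" for n
  define h where "h n = v n * (cseq x n \<bullet> cseq y n)" for n
  have sum: "(\<lambda>n. b n * (s n \<bullet> t n)) summable_on UNIV"
    if "\<And>n. \<bar>b n\<bar> \<le> lam + 1" "s \<in> l2" "t \<in> l2" for b :: "int \<Rightarrow> real" and s t :: "int \<Rightarrow> complex"
  proof (rule abs_summable_summable, rule summable_on_comparison_test)
    show "(\<lambda>n. (lam + 1) * (cmod (s n) * cmod (t n))) summable_on UNIV"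
      by (intro summable_on_cmult_right l2_mult_summable that)
    show "norm (b n * (s n \<bullet> t n)) \<le> (lam + 1) * (cmod (s n) * cmod (t n))" for n
      unfolding real_norm_def abs_mult
      using that(1)[of n] Cauchy_Schwarz_ineq2[of "s n" "t n"] lam by (intro mult_mono) auto
  qed simp
  have f: "(f has_sum infsum f UNIV) UNIV" and g: "(g has_sum infsum g UNIV) UNIV"
    and h: "(h has_sum infsum h UNIV) UNIV"
    unfolding f_def g_def h_def
    by (intro has_sum_infsum sum abs_c_le abs_v_le l2_shift cseq_l2)+
  have shift: "((\<lambda>n. k (n - 1)) has_sum S) UNIV" if "(k has_sum S) UNIV" for k :: "int \<Rightarrow> real" and S
  proof -
    have "bij_betw (\<lambda>n::int. n - 1) UNIV UNIV"
      by (rule bij_betwI[where g = "\<lambda>n. n + 1"]) auto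
    from has_sum_reindex_bij_betw[OF this, of k S] that show ?thesis by simp
  qed
  have "((\<lambda>n. f n + g (n - 1) + h n) has_sum (infsum f UNIV + infsum g UNIV + infsum h UNIV)) UNIV"
    by (intro has_sum_add shift f g h)
  moreover have "f n + g (n - 1) + h n = cseq (H x) n \<bullet> cseq y n" for n
    by (simp add: f_def g_def h_def Hop_def inner_add_left scaleR_conv_of_real[symmetric])
  ultimately have 1: "H x \<bullet> y = infsum f UNIV + infsum g UNIV + infsum h UNIV"
    using has_sum_unique[OF inner_cl2_has_sum[of "H x" y]] by simp
  have "((\<lambda>n. g n + f (n - 1) + h n) has_sum (infsum g UNIV + infsum f UNIV + infsum h UNIV)) UNIV"
    by (intro has_sum_add shift f g h)
  moreover have "g n + f (n - 1) + h n = cseq x n \<bullet> cseq (H y) n" for n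
    by (simp add: f_def g_def h_def Hop_def inner_add_right scaleR_conv_of_real[symmetric])
  ultimately have "x \<bullet> H y = infsum g UNIV + infsum f UNIV + infsum h UNIV"
    using has_sum_unique[OF inner_cl2_has_sum[of x "H y"]] by simp
  then show ?thesis using 1 by simp
qed

text \<open>Twice the constant of \<open>norm_H_le\<close>, so that T has norm at most 1 / 2. The
  gap below 1 is used at the end of \<open>no_transport\<close>.\<close>

definition R :: real where "R = 6 * (lam + 1)"

definition T :: "cl2 \<Rightarrow> cl2" where "T x = inverse R *\<^sub>R H x"

definition A :: "cl2 \<Rightarrow> cl2" where "A x = (1 / 2) *\<^sub>R (x + T x)"

lemma R_ge_1: "R \<ge> 1"
  using lam by (simp add: R_def)

lemma norm_T_le: "norm (T x) \<le> norm x / 2"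
proof -
  have "norm (T x) = inverse R * norm (H x)" using R_ge_1 by (simp add: T_def)
  also have "\<dots> \<le> inverse R * (3 * (lam + 1) * norm x)"
    using R_ge_1 by (intro mult_left_mono norm_H_le) simp
  also have "\<dots> = norm x / 2" using lam by (simp add: R_def field_simps)
  finally show ?thesis .
qed

lemma linear_T: "linear T"
  unfolding T_def using linear_H by (intro linear_compose_scale_right)

lemma T_symmetric: "T x \<bullet> y = x \<bullet> T y"
  by (simp add: T_def H_symmetric)

sublocale pos_contraction A
proof (rule pos_contraction.intro)
  show "bounded_linear A"
  proof (rule bounded_linear_intro[where K = 1])
    show "A (x + y) = A x + A y" for x y
      by (simp add: A_def linear_add[OF linear_T] scaleR_add_right)
    show "A (r *\<^sub>R x) = r *\<^sub>R A x" for r x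
      by (simp add: A_def linear_scale[OF linear_T] scaleR_add_right)
    show "norm (A x) \<le> norm x * 1" for x
    proof -
      have "norm (x + T x) \<le> 2 * norm x"
        using norm_triangle_ineq[of x "T x"] norm_T_le[of x] norm_ge_zero[of x] by linarith
      then show ?thesis by (simp add: A_def)
    qed
  qed
  fix x y
  show "A x \<bullet> y = x \<bullet> A y"
    by (simp add: A_def inner_add_left inner_add_right T_symmetric)
  have "\<bar>x \<bullet> T x\<bar> \<le> norm x * norm (T x)" by (rule Cauchy_Schwarz_ineq2)
  also have "\<dots> \<le> norm x * norm x"
    using norm_T_le[of x] norm_ge_zero[of x] by (intro mult_left_mono) linarith+
  finally have le: "\<bar>x \<bullet> T x\<bar> \<le> x \<bullet> x" by (simp add: norm_eq_sqrt_inner)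
  then show "0 \<le> x \<bullet> A x" "x \<bullet> A x \<le> x \<bullet> x"
    by (auto simp: A_def inner_add_right abs_le_iff)
qed

lemma T_eq_A: "T x = 2 *\<^sub>R A x - x"
  by (simp add: A_def)

lemma H_eq_A: "H x = R *\<^sub>R (2 *\<^sub>R A x - x)"
  using R_ge_1 by (simp add: T_eq_A[symmetric] T_def)

text \<open>The operator is tridiagonal, so the block communicates with its complement only across
  the links (a, a + 1) and (b, b + 1), of strength c a and c b. \<open>N\<close> collects the four
  sites at these links; passing from H to T costs a factor 1 / R <= 1.\<close>

lemma flux:
  fixes a b :: int
  assumes "a < b" "\<bar>c a\<bar> \<le> e" "\<bar>c b\<bar> \<le> e"
  defines "P \<equiv> trunc {a + 1..b}"
    and "N \<equiv> \<lambda>x. (cmod (cseq x a))\<^sup>2 + (cmod (cseq x (a + 1)))\<^sup>2 + (cmod (cseq x b))\<^sup>2 + (cmod (cseq x (b + 1)))\<^sup>2"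
  shows "\<bar>P x \<bullet> T (y - P y)\<bar> \<le> e * (N x + N y)"
proof -
  have Hop: "cseq x n \<bullet> cseq (H (y - P y)) n
      = (if n = b then c b * (cseq x b \<bullet> cseq y (b + 1)) else 0)
      + (if n = a + 1 then c a * (cseq x (a + 1) \<bullet> cseq y a) else 0)" if "n \<in> {a + 1..b}" for n
    using that by (auto simp: Hop_def P_def inner_add_right scaleR_conv_of_real[symmetric])
  have "P x \<bullet> H (y - P y) = (\<Sum>n\<in>{a + 1..b}. cseq x n \<bullet> cseq (H (y - P y)) n)"
    unfolding P_def by (rule inner_trunc_finite) simp
  also have "\<dots> = (\<Sum>n\<in>{a + 1..b}. (if n = b then c b * (cseq x b \<bullet> cseq y (b + 1)) else 0)
      + (if n = a + 1 then c a * (cseq x (a + 1) \<bullet> cseq y a) else 0))"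
    by (rule sum.cong[OF refl Hop])
  also have "\<dots> = c b * (cseq x b \<bullet> cseq y (b + 1)) + c a * (cseq x (a + 1) \<bullet> cseq y a)"
    using assms(1) by (simp add: sum.distrib sum.delta)
  finally have eq: "P x \<bullet> H (y - P y) = c b * (cseq x b \<bullet> cseq y (b + 1)) + c a * (cseq x (a + 1) \<bullet> cseq y a)" .
  have ip: "\<bar>p \<bullet> q\<bar> \<le> (cmod p)\<^sup>2 + (cmod q)\<^sup>2" for p q :: complex
  proof -
    have "\<bar>p \<bullet> q\<bar> \<le> cmod p * cmod q" by (rule Cauchy_Schwarz_ineq2)
    moreover have "0 \<le> cmod p * cmod q" by simp
    ultimately show ?thesis using sum_squares_bound[of "cmod p" "cmod q"] unfolding mult.assoc by linarith
  qed
  have e: "e \<ge> 0" using assms(2) by linarith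
  have "\<bar>P x \<bullet> H (y - P y)\<bar> \<le> \<bar>c b\<bar> * \<bar>cseq x b \<bullet> cseq y (b + 1)\<bar> + \<bar>c a\<bar> * \<bar>cseq x (a + 1) \<bullet> cseq y a\<bar>"
    unfolding eq abs_mult[symmetric] by (rule abs_triangle_ineq)
  also have "\<dots> \<le> e * ((cmod (cseq x b))\<^sup>2 + (cmod (cseq y (b + 1)))\<^sup>2) + e * ((cmod (cseq x (a + 1)))\<^sup>2 + (cmod (cseq y a))\<^sup>2)"
    using e by (intro add_mono mult_mono assms ip) auto
  also have "\<dots> \<le> e * (N x + N y)"
    unfolding N_def distrib_left[symmetric] using e by (intro mult_left_mono) auto
  finally have le: "\<bar>P x \<bullet> H (y - P y)\<bar> \<le> e * (N x + N y)" .
  have "\<bar>P x \<bullet> T (y - P y)\<bar> = inverse R * \<bar>P x \<bullet> H (y - P y)\<bar>"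
    using R_ge_1 by (simp add: T_def abs_mult)
  also have "\<dots> \<le> 1 * \<bar>P x \<bullet> H (y - P y)\<bar>"
    using R_ge_1 by (intro mult_right_mono) (auto simp: inverse_le_1_iff)
  finally show ?thesis using le by simp
qed

text \<open>At even sites the coupling is the cosine along the rotation by 2 \<alpha>. The search
  starts at 2 j to the right and, with rotation by - 2 \<alpha>, at - 2 j to the left, so both links
  lie outside [- j, j].\<close>

lemma weak_links:
  fixes e :: real and j :: nat
  assumes "e > 0"
  shows "\<exists>a b. a < - int j \<and> int j < b \<and> \<bar>c a\<bar> \<le> e \<and> \<bar>c b\<bar> \<le> e"
proof -
  have irr2: "2 * \<alpha> \<notin> \<rat>" "- (2 * \<alpha>) \<notin> \<rat>"
  proof -
    have "2 * \<alpha> \<in> \<rat> \<Longrightarrow> \<alpha> \<in> \<rat>" using Rats_divide[of "2 * \<alpha>" 2] by simp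
    then show "2 * \<alpha> \<notin> \<rat>" using irr by blast
    then show "- (2 * \<alpha>) \<notin> \<rat>" by simp
  qed
  obtain k :: int where k: "k > 0" "\<bar>cos (2 * pi * (of_int k * (2 * \<alpha>) + (2 * real j * \<alpha> + \<theta>)))\<bar> < e"
    using irrational_rotation_cos_small[OF irr2(1) assms] by metis
  obtain l :: int where l: "l > 0" "\<bar>cos (2 * pi * (of_int l * (- (2 * \<alpha>)) + (- (2 * real j * \<alpha>) + \<theta>)))\<bar> < e"
    using irrational_rotation_cos_small[OF irr2(2) assms] by metis
  have "c (2 * (k + int j)) = cos (2 * pi * (of_int k * (2 * \<alpha>) + (2 * real j * \<alpha> + \<theta>)))"
    by (simp add: cpot_def algebra_simps)
  moreover have "c (- (2 * (l + int j))) = cos (2 * pi * (of_int l * (- (2 * \<alpha>)) + (- (2 * real j * \<alpha>) + \<theta>)))"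
    by (simp add: cpot_def algebra_simps)
  ultimately show ?thesis
    using k l by (intro exI[of _ "- (2 * (l + int j))"] exI[of _ "2 * (k + int j)"]) auto
qed

text \<open>If the Chebyshev evolution of \<open>\<phi>\<close> is square-summable in time against every vector, all of
  the local energy of \<open>\<phi>\<close> would have to leave a block through its weak end links.\<close>

lemma no_transport:
  assumes Bessel: "\<And>\<psi> n. (\<Sum>k<n. (\<psi> \<bullet> papp A (cheb k) \<phi>)\<^sup>2) \<le> C * (norm \<psi>)\<^sup>2"
  shows "\<phi> = 0"
proof -
  define f where "f k = papp A (cheb k) \<phi>" for k
  have T_papp: "papp A [:-1, 2:] x = T x" for x
    using linear_0[OF linA] by (simp add: papp_pCons[OF linA] linear_add[OF linA] linear_scale[OF linA] T_eq_A)
  have f0: "f 0 = \<phi>" by (simp add: f_def)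
  have f1: "f 1 = T \<phi>" by (simp add: f_def T_papp)
  have wave: "f (Suc (Suc k)) = 2 *\<^sub>R T (f (Suc k)) - f k" for k
    by (simp only: f_def cheb.simps papp_diff papp_smult papp_mult[OF linA] T_papp)
  \<comment> \<open>A real inner product sees one real component at a time, so a complex site needs
    two test vectors and the bound doubles; the four sites in the energy estimate then give 8
    C.\<close>
  have site: "(\<Sum>k<n. (cmod (cseq (f k) m))\<^sup>2) \<le> 2 * C" for n m
  proof -
    have "(cmod w)\<^sup>2 = (1 \<bullet> w)\<^sup>2 + (\<i> \<bullet> w)\<^sup>2" for w :: complex
      by (simp add: inner_complex_def cmod_power2)
    then have "(\<Sum>k<n. (cmod (cseq (f k) m))\<^sup>2) = (\<Sum>k<n. (delta m 1 \<bullet> f k)\<^sup>2) + (\<Sum>k<n. (delta m \<i> \<bullet> f k)\<^sup>2)"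
      by (simp add: inner_delta sum.distrib)
    also have "\<dots> \<le> C * (norm (delta m 1))\<^sup>2 + C * (norm (delta m \<i>))\<^sup>2"
      unfolding f_def by (intro add_mono Bessel)
    finally show ?thesis by (simp add: norm_delta)
  qed
  have site_lim: "(\<lambda>k. (cmod (cseq (f k) m))\<^sup>2) \<longlonglongrightarrow> 0" for m
  proof (rule summable_LIMSEQ_zero)
    show "summable (\<lambda>k. (cmod (cseq (f k) m))\<^sup>2)"
      by (rule summableI_nonneg_bounded[of _ "2 * C"]) (use site in auto)
  qed
  have "\<exists>a b. a < - int j \<and> int j < b \<and> \<bar>c a\<bar> \<le> inverse (real (Suc j)) \<and> \<bar>c b\<bar> \<le> inverse (real (Suc j))" for j
    by (rule weak_links) simp
  then obtain a b where ab: "\<And>j. a j < - int j" "\<And>j. int j < b j"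
    "\<And>j. \<bar>c (a j)\<bar> \<le> inverse (real (Suc j))" "\<And>j. \<bar>c (b j)\<bar> \<le> inverse (real (Suc j))"
    by metis
  define P where "P j = trunc {a j + 1..b j}" for j
  have P_lim: "(\<lambda>j. P j x) \<longlonglongrightarrow> x" for x
  proof (rule metric_LIMSEQ_I)
    fix e :: real assume "e > 0"
    then obtain F where F: "finite F" "\<And>G. F \<subseteq> G \<Longrightarrow> norm (x - trunc G x) < e"
      using trunc_approx by blast
    obtain J where J: "\<And>n. n \<in> F \<Longrightarrow> \<bar>n\<bar> \<le> int J"
    proof -
      have "finite ((\<lambda>n. nat \<bar>n\<bar>) ` F)" using F(1) by simp
      then obtain J where "\<forall>m\<in>(\<lambda>n. nat \<bar>n\<bar>) ` F. m \<le> J" using finite_nat_set_iff_bounded_le by blast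
      then have "\<bar>n\<bar> \<le> int J" if "n \<in> F" for n using that by (auto simp: nat_le_iff)
      then show thesis by (rule that)
    qed
    have "dist (P j x) x < e" if "j \<ge> J" for j
    proof -
      have "F \<subseteq> {a j + 1..b j}"
      proof
        fix n assume "n \<in> F"
        then have "\<bar>n\<bar> \<le> int j" using J that by force
        then show "n \<in> {a j + 1..b j}" using ab(1,2)[of j] by auto
      qed
      from F(2)[OF this] show ?thesis by (simp add: P_def dist_norm norm_minus_commute)
    qed
    then show "\<exists>J. \<forall>j\<ge>J. dist (P j x) x < e" by blast
  qed
  have energy: "(norm (P j (f 1)))\<^sup>2 + (norm (P j (f 0)))\<^sup>2 - 2 * (P j (f 1) \<bullet> T (P j (f 0)))
      \<le> 10 * inverse (real (Suc j)) * (8 * C)" for j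
  proof (rule local_energy_bound[where P = "P j" and T = T and \<phi> = f and N = "\<lambda>x. (cmod (cseq x (a j)))\<^sup>2 + (cmod (cseq x (a j + 1)))\<^sup>2
        + (cmod (cseq x (b j)))\<^sup>2 + (cmod (cseq x (b j + 1)))\<^sup>2"])
    show "linear (P j)" unfolding P_def by (rule linearI) (simp_all add: trunc_add trunc_scaleR)
    show "P j x \<bullet> y = x \<bullet> P j y" for x y by (simp add: P_def trunc_inner)
    show "P j (P j x) = P j x" for x by (simp add: P_def)
    show "\<bar>P j x \<bullet> T (y - P j y)\<bar> \<le> inverse (real (Suc j)) *
      (((cmod (cseq x (a j)))\<^sup>2 + (cmod (cseq x (a j + 1)))\<^sup>2 + (cmod (cseq x (b j)))\<^sup>2 + (cmod (cseq x (b j + 1)))\<^sup>2)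
      + ((cmod (cseq y (a j)))\<^sup>2 + (cmod (cseq y (a j + 1)))\<^sup>2 + (cmod (cseq y (b j)))\<^sup>2 + (cmod (cseq y (b j + 1)))\<^sup>2))" for x y
      unfolding P_def by (rule flux) (use ab[of j] in auto)
    show "(\<lambda>k. P j (f k)) \<longlonglongrightarrow> 0"
    proof (rule tendsto_norm_zero_cancel)
      have "(\<lambda>k. \<Sum>m\<in>{a j + 1..b j}. (cmod (cseq (f k) m))\<^sup>2) \<longlonglongrightarrow> (\<Sum>m\<in>{a j + 1..b j}. 0)"
        by (intro tendsto_sum site_lim)
      then have "(\<lambda>k. (norm (P j (f k)))\<^sup>2) \<longlonglongrightarrow> 0"
        by (simp add: P_def norm_trunc_finite)
      from tendsto_real_sqrt[OF this] show "(\<lambda>k. norm (P j (f k))) \<longlonglongrightarrow> 0" by simp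
    qed
    show "norm (T x) \<le> norm x" for x
      using norm_T_le[of x] norm_ge_zero[of x] by linarith
    have sq: "(cmod (p - q))\<^sup>2 \<le> 2 * (cmod p)\<^sup>2 + 2 * (cmod q)\<^sup>2" for p q :: complex
    proof -
      have "(cmod (p - q))\<^sup>2 \<le> (cmod p + cmod q)\<^sup>2"
        by (intro power_mono norm_triangle_ineq4) simp
      also have "\<dots> \<le> 2 * (cmod p)\<^sup>2 + 2 * (cmod q)\<^sup>2"
        using sum_squares_bound[of "cmod p" "cmod q"] by (simp add: power2_sum)
      finally show ?thesis .
    qed
    show "(cmod (cseq (x - y) (a j)))\<^sup>2 + (cmod (cseq (x - y) (a j + 1)))\<^sup>2 + (cmod (cseq (x - y) (b j)))\<^sup>2 + (cmod (cseq (x - y) (b j + 1)))\<^sup>2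
      \<le> 2 * ((cmod (cseq x (a j)))\<^sup>2 + (cmod (cseq x (a j + 1)))\<^sup>2 + (cmod (cseq x (b j)))\<^sup>2 + (cmod (cseq x (b j + 1)))\<^sup>2)
      + 2 * ((cmod (cseq y (a j)))\<^sup>2 + (cmod (cseq y (a j + 1)))\<^sup>2 + (cmod (cseq y (b j)))\<^sup>2 + (cmod (cseq y (b j + 1)))\<^sup>2)" for x y
      using sq[of "cseq x (a j)" "cseq y (a j)"] sq[of "cseq x (a j + 1)" "cseq y (a j + 1)"]
        sq[of "cseq x (b j)" "cseq y (b j)"] sq[of "cseq x (b j + 1)" "cseq y (b j + 1)"]
      by simp
    show "(\<Sum>k<n. (cmod (cseq (f k) (a j)))\<^sup>2 + (cmod (cseq (f k) (a j + 1)))\<^sup>2 + (cmod (cseq (f k) (b j)))\<^sup>2 + (cmod (cseq (f k) (b j + 1)))\<^sup>2)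
      \<le> 8 * C" for n
      unfolding sum.distrib using site[of "a j" n] site[of "a j + 1" n] site[of "b j" n] site[of "b j + 1" n] by linarith
  qed (auto simp: linear_T T_symmetric wave)
  have T_lim: "(\<lambda>j. T (P j x)) \<longlonglongrightarrow> T x" for x
  proof -
    have "bounded_linear T"
      by (rule bounded_linear_intro[where K = "1 / 2"])
         (use norm_T_le in \<open>auto simp: linear_add[OF linear_T] linear_scale[OF linear_T]\<close>)
    then show ?thesis by (rule bounded_linear.tendsto[OF _ P_lim])
  qed
  have "(\<lambda>j. (norm (P j (f 1)))\<^sup>2 + (norm (P j (f 0)))\<^sup>2 - 2 * (P j (f 1) \<bullet> T (P j (f 0))))
      \<longlonglongrightarrow> (norm (f 1))\<^sup>2 + (norm (f 0))\<^sup>2 - 2 * (f 1 \<bullet> T (f 0))"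
    by (intro tendsto_intros P_lim T_lim)
  moreover have "(\<lambda>j. 10 * inverse (real (Suc j)) * (8 * C)) \<longlonglongrightarrow> 10 * 0 * (8 * C)"
    by (intro tendsto_intros LIMSEQ_inverse_real_of_nat)
  ultimately have "(norm (f 1))\<^sup>2 + (norm (f 0))\<^sup>2 - 2 * (f 1 \<bullet> T (f 0)) \<le> 10 * 0 * (8 * C)"
    by (rule LIMSEQ_le) (use energy in blast)
  \<comment> \<open>As f 0 = \<phi> and f 1 = T \<phi>, the limiting energy is |\<phi>|^2 - |T
    \<phi>|^2; with T of norm at most 1 / 2 it is nonpositive only for \<phi> = 0.\<close>
  then have "(norm \<phi>)\<^sup>2 \<le> (norm (T \<phi>))\<^sup>2"
    by (simp add: f0 f1[simplified] power2_norm_eq_inner)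
  also have "\<dots> \<le> (norm \<phi> / 2)\<^sup>2"
    using norm_T_le by (intro power_mono) auto
  finally have "(norm \<phi>)\<^sup>2 \<le> 0" by (simp add: power_divide)
  then show ?thesis by simp
qed

end

section \<open>Complex structure on the real Hilbert space\<close>

definition Jc :: "cl2 \<Rightarrow> cl2" where "Jc x = Abs_cl2 (\<lambda>n. \<i> * cseq x n)"

lemma cseq_Jc [simp]: "cseq (Jc x) n = \<i> * cseq x n"
  unfolding Jc_def using l2_scale[OF cseq_l2[of x], of \<i>] by (simp add: Abs_cl2_inverse)

lemma l2inner_cseq: "l2inner (cseq x) (cseq y) = Complex (x \<bullet> y) (Jc x \<bullet> y)"
proof -
  have sum: "(\<lambda>n. cnj (cseq x n) * cseq y n) summable_on UNIV"
    by (rule l2_cnj_mult_summable) simp_all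
  have "Re (l2inner (cseq x) (cseq y)) = x \<bullet> y"
    unfolding l2inner_def infsum_Re[OF sum, symmetric] inner_cl2_infsum
    by (simp add: inner_complex_def)
  moreover have "Im (l2inner (cseq x) (cseq y)) = Jc x \<bullet> y"
    unfolding l2inner_def infsum_Im[OF sum, symmetric] inner_cl2_infsum
    by (rule infsum_cong) (simp add: inner_complex_def)
  ultimately show ?thesis by (simp add: complex_eq_iff)
qed

lemma Jc_antisymmetric: "Jc x \<bullet> y = - (x \<bullet> Jc y)"
proof -
  have "Jc x \<bullet> y = (\<Sum>\<^sub>\<infinity>n. - (cseq x n \<bullet> cseq (Jc y) n))"
    unfolding inner_cl2_infsum by (rule infsum_cong) (simp add: inner_complex_def)
  then show ?thesis by (simp add: infsum_uminus inner_cl2_infsum)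
qed

context mosaic
begin

lemma H_Jc: "H (Jc x) = Jc (H x)"
  by (rule cseq_eqI) (simp add: Hop_def algebra_simps)

lemma A_Jc: "A (Jc x) = Jc (A x)"
  by (rule cseq_eqI) (simp add: A_def T_def H_Jc scaleR_conv_of_real algebra_simps)

lemma papp_Jc: "papp A p (Jc x) = Jc (papp A p x)"
proof (induction p)
  case 0
  then show ?case by (simp add: cseq_eqI)
next
  case (pCons a p)
  then show ?case
    by (intro cseq_eqI) (simp add: papp_pCons[OF linA] A_Jc scaleR_conv_of_real algebra_simps)
qed

text \<open>p(A) is symmetric and commutes with i, whereas i is antisymmetric. So the complex
  diagonal matrix element of p(A) is real, and the moments in the real inner product determine
  it.\<close>

lemma Jc_inner_papp: "Jc x \<bullet> papp A p x = 0"
proof -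
  have "Jc x \<bullet> papp A p x = papp A p (Jc x) \<bullet> x"
    by (rule papp_symmetric[OF linA sym, symmetric])
  also have "\<dots> = - (Jc x \<bullet> papp A p x)"
    by (simp add: papp_Jc Jc_antisymmetric inner_commute)
  finally show ?thesis by simp
qed

text \<open>\<^term>\<open>spec\<close> is the energy in the spectrum of the mosaic operator that belongs to a point of
  the spectrum of \<^term>\<open>A\<close>.\<close>

definition spec :: "real \<Rightarrow> real" where "spec x = R * (2 * x - 1)"

lemma spec_measurable [measurable]: "spec \<in> borel_measurable borel"
  unfolding spec_def by measurable

lemma spec_eq_iff: "spec x = y \<longleftrightarrow> x = (y / R + 1) / 2"
  using R_ge_1 by (auto simp: spec_def field_simps)

lemma spec_inverse: "(spec x / R + 1) / 2 = x"
  using spec_eq_iff by metis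

lemma papp_spec: "papp A [:- R - E, 2 * R:] x = H x - E *\<^sub>R x"
  using linear_0[OF linA]
  by (simp add: papp_pCons[OF linA] linear_scale[OF linA] H_eq_A algebra_simps)

lemma poly_spec: "poly [:- R - E, 2 * R:] x = spec x - E"
  by (simp add: spec_def algebra_simps)

end

section \<open>Spectral measures of the mosaic operator\<close>

locale mosaic_measure = mosaic \<alpha> lam \<theta> + spectral_pair A U M
  for \<alpha> lam \<theta> :: real and U :: cl2 and M :: "real measure"
begin

definition \<mu> :: "real measure" where "\<mu> = distr M borel spec"

lemma sets_\<mu>: "sets \<mu> = sets borel"
  by (simp add: \<mu>_def)

lemma space_M: "space M = UNIV"
  using sets_eq_imp_space_eq[OF sets_M] by simp

lemma emeasure_\<mu>: "B \<in> sets borel \<Longrightarrow> emeasure \<mu> B = emeasure M (spec -` B)"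
  unfolding \<mu>_def by (subst emeasure_distr) (auto simp: space_M)

lemma rep_Jc_orthogonal:
  assumes "rep f \<phi>"
  shows "Jc U \<bullet> \<phi> = 0"
proof -
  obtain p where "(\<lambda>j. papp A (p j) U) \<longlonglongrightarrow> \<phi>" using assms unfolding rep_def by blast
  then have "(\<lambda>j. Jc U \<bullet> papp A (p j) U) \<longlonglongrightarrow> Jc U \<bullet> \<phi>" by (intro tendsto_intros)
  then show ?thesis by (simp add: Jc_inner_papp LIMSEQ_const_iff)
qed

text \<open>The calculus is real, so the real and imaginary parts of the resolvent function
  \<open>F\<close> are applied separately, giving \<phi> and \<psi>. The identity (spec x - w) F x =
  1, split likewise, shows that \<phi> + i \<psi> solves the resolvent equation.\<close>

lemma spectral_measure_\<mu>: "spectral_measure (Hop \<alpha> lam \<theta>) (cseq U) \<mu>"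
  unfolding spectral_measure_def
proof (intro conjI allI impI)
  show "finite_measure \<mu>" unfolding \<mu>_def by (rule finite_measure_distr) simp
  fix w :: complex assume w: "Im w \<noteq> 0"
  define F where "F x = 1 / (complex_of_real (spec x) - w)" for x
  have nz: "complex_of_real (spec x) - w \<noteq> 0" for x
    using w by (auto simp: complex_eq_iff)
  have F_cont: "continuous_on UNIV F"
    unfolding F_def spec_def using nz by (intro continuous_intros) (auto simp: spec_def)
  obtain \<phi> where \<phi>: "rep (\<lambda>x. Re (F x)) \<phi>"
    using rep_exists_continuous[of "\<lambda>x. Re (F x)"] F_cont by (auto intro: continuous_intros)
  obtain \<psi> where \<psi>: "rep (\<lambda>x. Im (F x)) \<psi>"
    using rep_exists_continuous[of "\<lambda>x. Im (F x)"] F_cont by (auto intro: continuous_intros)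
  have prod: "(complex_of_real (spec x) - w) * F x = 1" for x
    using nz[of x] by (simp add: F_def)
  have re: "(spec x - Re w) * Re (F x) + Im w * Im (F x) = 1" for x
    using arg_cong[OF prod[of x], of Re] by simp
  have im: "(spec x - Re w) * Im (F x) - Im w * Re (F x) = 0" for x
    using arg_cong[OF prod[of x], of Im] by simp
  have "(H \<phi> - Re w *\<^sub>R \<phi>) + Im w *\<^sub>R \<psi> + (- 1) *\<^sub>R U = 0"
  proof (rule rep_zeroD)
    show "rep (\<lambda>x. poly [:- R - Re w, 2 * R:] x * Re (F x) + Im w * Im (F x) + - 1 * 1)
        ((H \<phi> - Re w *\<^sub>R \<phi>) + Im w *\<^sub>R \<psi> + (- 1) *\<^sub>R U)"
      unfolding papp_spec[symmetric] by (intro rep_add rep_papp rep_scaleR \<phi> \<psi> rep_1)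
  qed (use re in \<open>simp add: poly_spec del: poly_pCons\<close>)
  then have eq1: "H \<phi> = Re w *\<^sub>R \<phi> - Im w *\<^sub>R \<psi> + U" by (simp add: algebra_simps)
  have "(H \<psi> - Re w *\<^sub>R \<psi>) + (- Im w) *\<^sub>R \<phi> = 0"
  proof (rule rep_zeroD)
    show "rep (\<lambda>x. poly [:- R - Re w, 2 * R:] x * Im (F x) + - Im w * Re (F x))
        ((H \<psi> - Re w *\<^sub>R \<psi>) + (- Im w) *\<^sub>R \<phi>)"
      unfolding papp_spec[symmetric] by (intro rep_add rep_papp rep_scaleR \<phi> \<psi>)
  qed (use im in \<open>simp add: poly_spec del: poly_pCons\<close>)
  then have eq2: "H \<psi> = Re w *\<^sub>R \<psi> + Im w *\<^sub>R \<phi>" by (simp add: algebra_simps)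
  define V where "V = \<phi> + Jc \<psi>"
  have "H V = H \<phi> + Jc (H \<psi>)" by (simp add: V_def linear_add[OF linear_H] H_Jc)
  then have "cseq (H V) n - w * cseq V n = cseq U n" for n
    by (simp only: eq1 eq2 V_def cseq_add cseq_diff cseq_Jc cseq_scaleR)
       (simp add: scaleR_conv_of_real complex_eq_iff algebra_simps)
  then have sol: "Hop \<alpha> lam \<theta> (cseq V) n - w * cseq V n = cseq U n" for n by simp
  have inner: "l2inner (cseq U) (cseq V) = Complex (U \<bullet> \<phi>) (U \<bullet> \<psi>)"
  proof -
    have "U \<bullet> Jc \<psi> = - (Jc U \<bullet> \<psi>)" using Jc_antisymmetric[of U \<psi>] by simp
    moreover have "Jc U \<bullet> Jc \<psi> = U \<bullet> \<psi>"
    proof -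
      have "Jc (Jc \<psi>) = - \<psi>" by (rule cseq_eqI) simp
      then show ?thesis using Jc_antisymmetric[of U "Jc \<psi>"] by simp
    qed
    ultimately show ?thesis
      by (simp add: l2inner_cseq V_def inner_add_right rep_Jc_orthogonal[OF \<phi>] rep_Jc_orthogonal[OF \<psi>])
  qed
  have F_bound: "cmod (F x) \<le> 1 / \<bar>Im w\<bar>" for x
  proof -
    have "\<bar>Im w\<bar> \<le> cmod (complex_of_real (spec x) - w)"
      using abs_Im_le_cmod[of "complex_of_real (spec x) - w"] by simp
    then show ?thesis using w by (simp add: F_def norm_divide frac_le)
  qed
  have F_int: "integrable M F"
    by (rule integrable_const_bound[where B = "1 / \<bar>Im w\<bar>"])
       (use F_bound F_cont in \<open>auto simp: measurable_cong_sets[OF sets_M refl] intro: borel_measurable_continuous_onI\<close>)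
  have "(\<integral>x. 1 / (complex_of_real x - w) \<partial>\<mu>) = (\<integral>x. F x \<partial>M)"
    unfolding \<mu>_def F_def by (rule integral_distr) simp_all
  also have "\<dots> = Complex (\<integral>x. Re (F x) \<partial>M) (\<integral>x. Im (F x) \<partial>M)"
    using F_int by (simp add: complex_eq_iff)
  also have "\<dots> = l2inner (cseq U) (cseq V)"
    using rep_inner[OF rep_1 \<phi>] rep_inner[OF rep_1 \<psi>] by (simp add: inner)
  finally show "\<exists>v\<in>l2. (\<forall>n. Hop \<alpha> lam \<theta> v n - w * v n = cseq U n) \<and>
      l2inner (cseq U) v = (\<integral>x. 1 / (complex_of_real x - w) \<partial>\<mu>)"
    using sol by (intro bexI[of _ "cseq V"]) auto
qed (rule sets_\<mu>)

lemma measure_indicator_norm: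
  assumes "rep (indicator K) \<phi>" "K \<in> sets borel"
  shows "(norm \<phi>)\<^sup>2 = measure M K"
proof -
  have "(norm \<phi>)\<^sup>2 = (\<integral>x. indicator K x \<partial>M)"
    unfolding rep_norm[OF assms(1)] by (rule Bochner_Integration.integral_cong) (auto simp: indicator_def)
  then show ?thesis using assms(2) by (simp add: space_M)
qed

text \<open>The spectral projection of \<open>U\<close> to the point y is an eigenvector or zero,
  and its squared norm is the mass of y. \<open>no_eigenvalue\<close> leaves only zero.\<close>

lemma no_atom:
  assumes nr: "\<not> two_alpha_rational \<alpha> \<theta>" and E: "\<bar>E\<bar> < lam"
  shows "emeasure \<mu> {E} = 0"
proof -
  define y where "y = (E / R + 1) / 2"
  obtain \<phi> where \<phi>: "rep (indicator {y}) \<phi>" using rep_exists_indicator[of "{y}"] by auto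
  have "H \<phi> - E *\<^sub>R \<phi> = 0"
  proof (rule rep_zeroD)
    show "rep (\<lambda>x. poly [:- R - E, 2 * R:] x * indicator {y} x) (H \<phi> - E *\<^sub>R \<phi>)"
      unfolding papp_spec[symmetric] by (rule rep_papp[OF \<phi>])
    have "spec y = E" using spec_eq_iff by (simp add: y_def)
    then show "poly [:- R - E, 2 * R:] x * indicator {y} x = 0" for x
      unfolding poly_spec by (auto simp: indicator_def)
  qed
  then have "cseq (H \<phi>) n = cseq (E *\<^sub>R \<phi>) n" for n by simp
  then have "cseq \<phi> n = 0" for n
    by (intro no_eigenvalue[OF irr nr E]) (simp_all add: scaleR_conv_of_real)
  then have "\<phi> = 0" by (intro cseq_eqI) simp
  then have "measure M {y} = 0" using measure_indicator_norm[OF \<phi>] by simp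
  moreover have "spec -` {E} = {y}"
    unfolding set_eq_iff vimage_singleton_eq singleton_iff spec_eq_iff y_def by simp
  ultimately show ?thesis by (simp add: emeasure_\<mu> emeasure_eq_measure)
qed

text \<open>A compact \<open>K\<close> of positive mass with bounded density would yield a nonzero
  vector, which \<open>cheb_Bessel\<close> and \<open>no_transport\<close> exclude. The other
  alternative of \<open>singular_or_bounded_density\<close> remains and is carried over by the
  affine map \<open>spec\<close>.\<close>

lemma singular:
  "\<exists>N\<in>sets borel. emeasure lborel N = 0 \<and> (\<forall>B\<in>sets borel. emeasure \<mu> B = emeasure \<mu> (B \<inter> N))"
proof -
  have "\<not> (\<exists>K c. compact K \<and> 0 < emeasure M K \<and>
       (\<forall>f\<in>borel_measurable borel. (\<integral>\<^sup>+x. f x * indicator K x \<partial>M) \<le> of_nat c * (\<integral>\<^sup>+x. f x \<partial>lborel)))"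
  proof (rule notI, elim exE conjE)
    fix K and c :: nat assume K: "compact K" "0 < emeasure M K"
      and dens: "\<forall>f\<in>borel_measurable borel. (\<integral>\<^sup>+x. f x * indicator K x \<partial>M) \<le> of_nat c * (\<integral>\<^sup>+x. f x \<partial>lborel)"
    obtain \<phi> where \<phi>: "rep (indicator K) \<phi>"
      using rep_exists_indicator[OF compact_imp_closed[OF K(1)]] by blast
    have "\<phi> = 0"
      by (rule no_transport[OF cheb_Bessel[OF \<phi> K(1)]]) (use dens in blast)
    then have "measure M K = 0"
      using measure_indicator_norm[OF \<phi>] K(1) by (simp add: borel_compact)
    then show False using K(2) by (simp add: emeasure_eq_measure)
  qed
  then obtain N where N [measurable]: "N \<in> sets borel" and null: "emeasure lborel N = 0" "emeasure M (- N) = 0"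
    using singular_or_bounded_density[OF fin sets_M] by blast
  \<comment> \<open>This is the image of \<open>N\<close> under \<open>spec\<close>, written as a
    preimage under the inverse map so that measurability is immediate.\<close>
  define N' where "N' = (\<lambda>y. (y / R + 1) / 2) -` N"
  have N' [measurable]: "N' \<in> sets borel"
    unfolding N'_def using measurable_sets[of "\<lambda>y. (y / R + 1) / 2" borel borel N] N by simp
  have vimage: "spec -` (B \<inter> N') = spec -` B \<inter> N" for B
    by (auto simp: N'_def spec_inverse)
  have "emeasure lborel N' = (\<integral>\<^sup>+x. indicator N' x \<partial>lborel)" by simp
  also have "\<dots> = ennreal \<bar>2 * R\<bar> * (\<integral>\<^sup>+x. indicator N' (- R + 2 * R * x) \<partial>lborel)"
    using R_ge_1 by (intro nn_integral_real_affine) simp_all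
  also have "(\<lambda>x. indicator N' (- R + 2 * R * x)) = (indicator N :: real \<Rightarrow> ennreal)"
    using vimage[of UNIV] by (auto simp: fun_eq_iff indicator_def spec_def algebra_simps set_eq_iff)
  finally have N'_null: "emeasure lborel N' = 0" using null(1) by simp
  have "emeasure \<mu> B = emeasure \<mu> (B \<inter> N')" if B [measurable]: "B \<in> sets borel" for B
  proof -
    have vB [measurable]: "spec -` B \<in> sets borel"
      using measurable_sets[OF spec_measurable B] by simp
    have "emeasure M (spec -` B - N) \<le> emeasure M (- N)"
      by (rule emeasure_mono) (auto simp: sets_M)
    then have "emeasure M (spec -` B - N) = 0" using null(2) by simp
    moreover have "emeasure M (spec -` B) = emeasure M (spec -` B \<inter> N) + emeasure M (spec -` B - N)"
      by (subst plus_emeasure) (auto simp: sets_M Int_Diff_Un intro!: arg_cong[where f = "emeasure M"])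
    moreover have "B \<inter> N' \<in> sets borel" by simp
    ultimately show ?thesis by (simp only: emeasure_\<mu> B vimage) simp
  qed
  then show ?thesis using N' N'_null by blast
qed

end

theorem theorem3p9:
  fixes \<alpha> lam \<theta> :: real
  assumes "\<alpha> \<notin> \<rat>" and "lam > 0"
    and "\<theta> \<in> T0 \<alpha>" and "\<not> two_alpha_rational \<alpha> \<theta>"
  shows "purely_sc_spectrum_in (Hop \<alpha> lam \<theta>)
           (op_spectrum (Hop \<alpha> lam \<theta>) \<inter> {-lam<..<lam})"
  unfolding purely_sc_spectrum_in_def
proof
  fix u :: "int \<Rightarrow> complex" assume u: "u \<in> l2"
  interpret mosaic \<alpha> lam \<theta> by unfold_locales (use assms in auto)
  define U where "U = Abs_cl2 u"
  have U: "cseq U = u" unfolding U_def using u by (rule Abs_cl2_inverse)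
  obtain M where M: "finite_measure M" "sets M = sets borel" "AE x in M. x \<in> {0..1}"
    "\<And>p. U \<bullet> papp A p U = (\<integral>x. poly p x \<partial>M)"
    using spectral_measure_exists[of U] by blast
  interpret mosaic_measure \<alpha> lam \<theta> U M
    by (rule mosaic_measure.intro[OF mosaic_axioms spectral_pair.intro[OF pos_contraction_axioms spectral_pair_axioms.intro]])
       (use M in auto)
  have sing: "sing_cont_on \<mu> (op_spectrum (Hop \<alpha> lam \<theta>) \<inter> {-lam<..<lam})"
    unfolding sing_cont_on_def
  proof
    show "\<forall>x\<in>op_spectrum (Hop \<alpha> lam \<theta>) \<inter> {-lam<..<lam}. emeasure \<mu> {x} = 0"
      using no_atom[OF assms(4)] by auto
  qed (use singular in blast)
  show "\<exists>\<mu>. spectral_measure (Hop \<alpha> lam \<theta>) u \<mu> \<and>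
      sing_cont_on \<mu> (op_spectrum (Hop \<alpha> lam \<theta>) \<inter> {-lam<..<lam})"
    by (rule exI[of _ \<mu>], rule conjI[OF spectral_measure_\<mu>[unfolded U] sing])
qed

end
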